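(* Let $L=\partial_t+\sum_{j=1}^d A_j\,\partial_{x_j}$ with constant matrices $A_j\in\mathrm{Hom}(\mathbb C^k)$ be strongly hyperbolic, and suppose that $\{x_1=0\}$ is characteristic for $L$ and that its conormal variety satisfies the smooth variety hypothesis. Let $f$ be compactly supported, piecewise smooth on $\mathbb R^{1+d}$ with singularities only on $\{x_1=0\}$, with $f=0$ for $t\le0$ and for $t\ge T$. Let $u$ be the solution of $Lu=f$ with $u=0$ for $t\le 0$; it is piecewise smooth with singularities only on $\{x_1=0\}$, and $J_u^0(t,x')$, $J_u^1(t,x')$ denote the jumps of $u$ and $\partial u/\partial x_1$ across $\{x_1=0\}$. Set $K:=\underline\pi\,L_{tan}\,Q\,L_{tan}\,J_u^0$. Then either $K$ is identically equal to zero on $\{t>T\}$, or $J_u^1$ grows linearly in time, in the following sense: for every $(t_0,x_0')$ with $t_0>T$ and $K(t_0,x_0')\neq0$, the ratio $|J_u^1(t_0+s,\,x_0'+s\mathbf v')|/s$ converges to a strictly positive finite limit as $s\to+\infty$.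
   Context: Write $x=(x_1,x')$, $\xi=(\xi_1,\xi')\in\mathbb R\times\mathbb R^{d-1}$ and $A(\xi)=\sum_{j=1}^d A_j\xi_j$. Strongly hyperbolic means $\sup_{\xi\in\mathbb R^d}\|e^{iA(\xi)}\|<\infty$; it implies that each $A(\xi)$ is diagonalizable with real eigenvalues. $\mathrm{Char}(L)=\{(\tau,\xi)\in\mathbb R^{1+d}\setminus 0:\det(\tau I+A(\xi))=0\}$. $\{x_1=0\}$ is characteristic when $\det A_1=0$. The smooth variety hypothesis for its conormal variety $\{\tau=0,\xi'=0\}\setminus0$ means that on a conic neighborhood of this set $\mathrm{Char}(L)$ is the graph of a real analytic function $\tau(\xi)$, homogeneous of degree one, with $\tau(1,0,\dots,0)=0$. The group velocity is $\mathbf v=-\nabla_\xi\tau(1,0,\dots,0)$; its first component is $0$, and $\mathbf v'=(v_2,\dots,v_d)$. "Piecewise smooth with singularities only on $\{x_1=0\}$" means that the restrictions to $\{x_1>0\}$ and $\{x_1<0\}$ extend to $C^\infty$ functions on the closed half spaces. For such $h$, $J_h^n(t,x')=\partial_{x_1}^nh(t,0+,x')-\partial_{x_1}^nh(t,0-,x')$. $\underline\pi$ is the projection of $\mathbb C^k$ onto $\ker A_1$ along $\mathrm{Range}\,A_1$. $L_{tan}=\partial_t+\sum_{j=2}^dA_j\partial_{x_j}$. $Q$ is the partial inverse of $A_1$ defined by $Q\,\underline\pi=0$ and $QA_1(I-\underline\pi)=I-\underline\pi$. *)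

theory Defs
  imports "HOL-Analysis.Analysis"
begin

text \<open>
  Space-time points are pairs \<open>(t, x)\<close> with \<open>x :: real ^ 'd\<close>, where \<open>'d\<close> is an arbitrary finite
  index type with a distinguished index \<open>i1\<close> playing the role of the first coordinate; in this way
  all dimensions \<open>d \<ge> 1\<close> are covered.  A function of \<open>(t, x')\<close> is represented as a
  function of \<open>(t, x)\<close> that does not depend on the coordinate \<open>x $ i1\<close>.
\<close>

definition set_coord :: "'d::finite \<Rightarrow> real \<Rightarrow> real ^ 'd \<Rightarrow> real ^ 'd" where
  "set_coord i1 s x = (\<chi> j. if j = i1 then s else x $ j)"


subsection \<open>Symbol, strong hyperbolicity, characteristic variety\<close>

definition symb :: "('d::finite \<Rightarrow> complex ^ 'k ^ 'k) \<Rightarrow> real ^ 'd \<Rightarrow> complex ^ 'k ^ 'k" where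
  "symb A \<xi> = (\<Sum>j\<in>UNIV. (\<xi> $ j) *\<^sub>R A j)"

text \<open>The product \<open>*\<close> on vectors is componentwise, so \<open>exp\<close> does not provide the
  matrix exponential.\<close>

definition mat_exp :: "complex ^ 'k ^ 'k \<Rightarrow> complex ^ 'k ^ 'k" where
  "mat_exp M = (\<Sum>n. (1 / fact n) *\<^sub>R (((**) M ^^ n) (mat 1)))"

definition strongly_hyperbolic :: "('d::finite \<Rightarrow> complex ^ 'k ^ 'k) \<Rightarrow> bool" where
  "strongly_hyperbolic A \<longleftrightarrow>
     bdd_above (range (\<lambda>\<xi>. onorm ((*v) (mat_exp (mat \<i> ** symb A \<xi>)))))"

definition Char :: "('d::finite \<Rightarrow> complex ^ 'k ^ 'k) \<Rightarrow> (real \<times> (real ^ 'd)) set" where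
  "Char A = {(\<tau>, \<xi>). (\<tau>, \<xi>) \<noteq> 0 \<and> det (mat (complex_of_real \<tau>) + symb A \<xi>) = 0}"

definition conormal :: "'d::finite \<Rightarrow> (real \<times> (real ^ 'd)) set" where
  "conormal i1 = {(\<tau>, \<xi>). \<tau> = 0 \<and> (\<forall>j. j \<noteq> i1 \<longrightarrow> \<xi> $ j = 0)} - {0}"

definition conic :: "'a::real_vector set \<Rightarrow> bool" where
  "conic S \<longleftrightarrow> (\<forall>x\<in>S. \<forall>c>0. c *\<^sub>R x \<in> S)"

definition real_analytic_on :: "(real ^ 'd \<Rightarrow> real) \<Rightarrow> (real ^ 'd::finite) set \<Rightarrow> bool" where
  "real_analytic_on f U \<longleftrightarrow>
     (\<forall>a\<in>U. \<exists>r>0. \<exists>c :: ('d \<Rightarrow> nat) \<Rightarrow> real. \<forall>x\<in>ball a r.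
        ((\<lambda>\<alpha>. c \<alpha> * (\<Prod>j\<in>UNIV. (x $ j - a $ j) ^ \<alpha> j)) has_sum f x) UNIV)"

text \<open>Only the values of \<open>\<tau>\<close> on \<open>U\<close> matter.\<close>

definition smooth_variety ::
  "('d::finite \<Rightarrow> complex ^ 'k ^ 'k) \<Rightarrow> 'd \<Rightarrow> (real ^ 'd \<Rightarrow> real) \<Rightarrow> bool" where
  "smooth_variety A i1 \<tau> \<longleftrightarrow>
     (\<exists>\<Gamma> U. open \<Gamma> \<and> conic \<Gamma> \<and> conormal i1 \<subseteq> \<Gamma> \<and>
        open U \<and> conic U \<and> real_analytic_on \<tau> U \<and>
        (\<forall>\<xi>\<in>U. \<forall>c>0. \<tau> (c *\<^sub>R \<xi>) = c * \<tau> \<xi>) \<and>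
        Char A \<inter> \<Gamma> = (\<lambda>\<xi>. (\<tau> \<xi>, \<xi>)) ` U) \<and>
     \<tau> (axis i1 1) = 0"

definition group_velocity :: "'d::finite \<Rightarrow> (real ^ 'd \<Rightarrow> real) \<Rightarrow> real ^ 'd" where
  "group_velocity i1 \<tau> = (\<chi> j. - frechet_derivative \<tau> (at (axis i1 1)) (axis j 1))"


subsection \<open>Piecewise smooth functions and jumps\<close>

text \<open>Derivatives are taken within \<open>S\<close>, so on a closed half space this is smoothness up to the
  boundary.\<close>

primrec Ck_on :: "nat \<Rightarrow> 'a::euclidean_space set \<Rightarrow> ('a \<Rightarrow> 'b::real_normed_vector) \<Rightarrow> bool" where
  "Ck_on 0 S f \<longleftrightarrow> continuous_on S f"
| "Ck_on (Suc n) S f \<longleftrightarrow>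
     (\<exists>f'. (\<forall>x\<in>S. (f has_derivative f' x) (at x within S)) \<and> (\<forall>v. Ck_on n S (\<lambda>x. f' x v)))"

definition Cinf_on :: "'a::euclidean_space set \<Rightarrow> ('a \<Rightarrow> 'b::real_normed_vector) \<Rightarrow> bool" where
  "Cinf_on S f \<longleftrightarrow> (\<forall>n. Ck_on n S f)"

definition compactly_supported :: "('a::topological_space \<Rightarrow> 'b::zero) \<Rightarrow> bool" where
  "compactly_supported f \<longleftrightarrow> compact (closure {p. f p \<noteq> 0})"

text \<open>No condition is imposed on the values of \<open>h\<close> on the hyperplane itself.\<close>

definition piecewise_smooth ::
  "'d::finite \<Rightarrow> (real \<times> (real ^ 'd) \<Rightarrow> 'b::real_normed_vector) \<Rightarrow> bool" where
  "piecewise_smooth i1 h \<longleftrightarrow>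
     (\<exists>g. Cinf_on {(t, x). x $ i1 \<ge> 0} g \<and> (\<forall>t x. x $ i1 > 0 \<longrightarrow> h (t, x) = g (t, x))) \<and>
     (\<exists>g. Cinf_on {(t, x). x $ i1 \<le> 0} g \<and> (\<forall>t x. x $ i1 < 0 \<longrightarrow> h (t, x) = g (t, x)))"

definition dir_deriv :: "'a::real_normed_vector \<Rightarrow> ('a \<Rightarrow> 'b::real_normed_vector) \<Rightarrow> 'a \<Rightarrow> 'b" where
  "dir_deriv e h p = vector_derivative (\<lambda>s. h (p + s *\<^sub>R e)) (at 0)"

abbreviation Dt :: "(real \<times> (real ^ 'd::finite) \<Rightarrow> 'b::real_normed_vector) \<Rightarrow> real \<times> (real ^ 'd) \<Rightarrow> 'b"
  where "Dt \<equiv> dir_deriv (1, 0)"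

abbreviation Dx ::
  "'d::finite \<Rightarrow> (real \<times> (real ^ 'd) \<Rightarrow> 'b::real_normed_vector) \<Rightarrow> real \<times> (real ^ 'd) \<Rightarrow> 'b"
  where "Dx j \<equiv> dir_deriv (0, axis j 1)"

definition jump ::
  "'d::finite \<Rightarrow> nat \<Rightarrow> (real \<times> (real ^ 'd) \<Rightarrow> 'b::real_normed_vector) \<Rightarrow> real \<times> (real ^ 'd) \<Rightarrow> 'b" where
  "jump i1 n h = (\<lambda>(t, x).
     Lim (at_right 0) (\<lambda>s. (Dx i1 ^^ n) h (t, set_coord i1 s x)) -
     Lim (at_left 0) (\<lambda>s. (Dx i1 ^^ n) h (t, set_coord i1 s x)))"


subsection \<open>The equation and the operators on the hyperplane\<close>

text \<open>\<open>L u = f\<close> in the sense of distributions, for locally integrable \<open>u\<close> and \<open>f\<close> (as piecewise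
  smooth functions are).  The equation across the hyperplane is part of this notion.  The measure
  is \<open>lebesgue\<close> rather than \<open>lborel\<close> because the values on the hyperplane are
  arbitrary and need not be Borel measurable.\<close>

definition weak_solution ::
  "('d::finite \<Rightarrow> complex ^ 'k ^ 'k) \<Rightarrow> (real \<times> (real ^ 'd) \<Rightarrow> complex ^ 'k) \<Rightarrow>
   (real \<times> (real ^ 'd) \<Rightarrow> complex ^ 'k) \<Rightarrow> bool" where
  "weak_solution A u f \<longleftrightarrow>
     (\<forall>\<phi> :: real \<times> (real ^ 'd) \<Rightarrow> real. Cinf_on UNIV \<phi> \<and> compactly_supported \<phi> \<longrightarrow>
        - (LINT p|lebesgue. Dt \<phi> p *\<^sub>R u p + (\<Sum>j\<in>UNIV. Dx j \<phi> p *\<^sub>R (A j *v u p)))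
        = (LINT p|lebesgue. \<phi> p *\<^sub>R f p))"

definition L_tan ::
  "('d::finite \<Rightarrow> complex ^ 'k ^ 'k) \<Rightarrow> 'd \<Rightarrow> (real \<times> (real ^ 'd) \<Rightarrow> complex ^ 'k) \<Rightarrow>
   real \<times> (real ^ 'd) \<Rightarrow> complex ^ 'k" where
  "L_tan A i1 w p = Dt w p + (\<Sum>j\<in>UNIV - {i1}. A j *v Dx j w p)"

text \<open>The projection onto the kernel along the range; it exists if and only if the two are
  complementary, which strong hyperbolicity guarantees for \<open>M = A i1\<close>.\<close>

definition ker_proj :: "complex ^ 'k ^ 'k \<Rightarrow> complex ^ 'k ^ 'k" where
  "ker_proj M = (THE P. P ** P = P \<and> range ((*v) P) = {v. M *v v = 0} \<and>
                        {v. P *v v = 0} = range ((*v) M))"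

definition partial_inverse :: "complex ^ 'k ^ 'k \<Rightarrow> complex ^ 'k ^ 'k" where
  "partial_inverse M = (THE Q. Q ** ker_proj M = 0 \<and>
                               Q ** M ** (mat 1 - ker_proj M) = mat 1 - ker_proj M)"

definition K_fun ::
  "('d::finite \<Rightarrow> complex ^ 'k ^ 'k) \<Rightarrow> 'd \<Rightarrow> (real \<times> (real ^ 'd) \<Rightarrow> complex ^ 'k) \<Rightarrow>
   real \<times> (real ^ 'd) \<Rightarrow> complex ^ 'k" where
  "K_fun A i1 J p =
     ker_proj (A i1) *v L_tan A i1 (\<lambda>q. partial_inverse (A i1) *v L_tan A i1 J q) p"

end

theory Submission
  imports Defs "HOL-Computational_Algebra.Fundamental_Theorem_Algebra"
begin

text \<open>
  Let \<open>J0\<close>, \<open>J1\<close>, \<open>J2\<close> be the jumps of \<open>u\<close> and of its first two derivatives in \<open>x1\<close>, let \<open>A1 = A i1\<close>, and let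
  \<open>P\<close> and \<open>Q\<close> be \<open>ker_proj A1\<close> and \<open>partial_inverse A1\<close>.  For \<open>t > T\<close> the source is gone, and
    \<open>A1 J0 = 0\<close>,  \<open>L_tan J0 + A1 J1 = 0\<close>,  \<open>L_tan J1 + A1 J2 = 0\<close>.
  The theorem is a consequence of these equations and of the identity \<open>P A_j P = v_j P\<close>
  (\<open>projected_symbol_group_velocity\<close>), by which \<open>P L_tan P\<close> is \<open>P\<close> times the derivative along the ray
  direction \<open>r = (1, v')\<close>.  Applying \<open>P\<close> to the second equation shows that \<open>J0\<close> is constant along rays.
  Applying \<open>Q\<close> to it gives \<open>Q L_tan J0 = P J1 - J1\<close>; so this part of \<open>J1\<close> is constant along rays too, and
  so is \<open>K\<close>.  Applying \<open>P\<close> to the third equation shows that the derivative of \<open>P J1\<close> along the ray is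
  \<open>P L_tan (P J1 - J1) = K\<close>.  Therefore \<open>J1 (p + s r) = J1 p + s K p\<close> exactly
  (\<open>jump_transport\<close>), and the ratio in question tends to the norm of \<open>K p\<close>.  It is thus the second
  alternative that always holds; when \<open>K\<close> vanishes for \<open>t > T\<close> it is vacuous.

  The identity \<open>P A_j P = v_j P\<close> is first order perturbation theory.  The bound on \<open>exp (i A(\<xi>))\<close> makes
  every \<open>A(\<xi>)\<close> diagonalizable with real eigenvalues and spectral components bounded uniformly in \<open>\<xi>\<close>
  (\<open>real_spectral_decomposition\<close>, \<open>spectral_component_bound\<close>).  Near the conormal direction the only small
  eigenvalue is \<open>- \<tau>\<close>, so every vector of the kernel of \<open>A1\<close> is close to an eigenvector for \<open>- \<tau>\<close>
  (\<open>kernel_perturbation\<close>); projecting the eigenvalue equation onto the kernel gives the identity.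

  The equations for the jumps come from the weak equation by rescaling one fixed bump function around a
  point (\<open>blow_up\<close>).  Off the hyperplane, where \<open>u\<close> is differentiable, the first order term gives the
  equation pointwise (\<open>interior_equation\<close>); on the hyperplane the limit of order zero gives \<open>A1 J0 = 0\<close>
  (\<open>jump_relation\<close>).  Boundary integrals are avoided: all integrations by parts are instances of the
  translation invariance of Lebesgue measure (\<open>integral_derivative_invariant_set\<close>).
\<close>

section \<open>Complex matrices with a bounded exponential group\<close>

lemma mv_scaleR: "(s *\<^sub>R M) *v x = s *\<^sub>R (M *v (x::complex ^ 'n))" for M :: "complex ^ 'n ^ 'm"
  by (simp add: matrix_vector_mult_def vec_eq_iff scaleR_sum_right)

lemma mv_scaleR2: "M *v (s *\<^sub>R x) = s *\<^sub>R (M *v (x::complex ^ 'n))" for M :: "complex ^ 'n ^ 'm"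
  by (simp add: matrix_vector_mult_def vec_eq_iff scaleR_sum_right)

lemma mv_smult: "M *v (c *s x) = c *s (M *v (x::complex ^ 'n))" for M :: "complex ^ 'n ^ 'm"
  by (simp add: matrix_vector_mult_def vec_eq_iff sum_distrib_left algebra_simps)

lemma mat_mv: "mat c *v x = c *s (x::complex ^ 'n)"
  by (simp add: matrix_vector_mult_def mat_def vec_eq_iff if_distrib if_distribR cong: if_cong)

lemma scaleR_smult: "s *\<^sub>R x = complex_of_real s *s (x::complex ^ 'n)"
  by (simp add: vec_eq_iff) (simp add: scaleR_conv_of_real)

lemma norm_smult: "norm (c *s x) = cmod c * norm (x::complex ^ 'n)"
  by (simp add: norm_vec_def norm_mult L2_set_right_distrib)

lemma bounded_linear_mv: "bounded_linear ((*v) (M::complex ^ 'n ^ 'm))"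
  by (rule linear_conv_bounded_linear[THEN iffD1])
     (auto intro!: linearI simp: matrix_vector_right_distrib mv_scaleR2)

lemma bounded_linear_mv_left: "bounded_linear (\<lambda>M::complex ^ 'n ^ 'm. M *v x)"
  by (rule linear_conv_bounded_linear[THEN iffD1])
     (auto intro!: linearI simp: matrix_vector_mult_add_rdistrib mv_scaleR)

lemma bounded_linear_smult_left: "bounded_linear (\<lambda>c. c *s (x::complex ^ 'n))"
  by (rule linear_conv_bounded_linear[THEN iffD1])
     (auto intro!: linearI simp: vec_eq_iff algebra_simps)

lemma mat_power_apply:
  fixes M :: "complex ^ 'n ^ 'n"
  shows "(((**) M ^^ n) (mat 1)) *v x = ((*v) M ^^ n) x"
proof (induction n)
  case (Suc n)
  have "((**) M ^^ Suc n) (mat 1) *v x = M *v (((**) M ^^ n) (mat 1) *v x)"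
    by (simp add: matrix_vector_mul_assoc)
  then show ?case using Suc by simp
qed simp

lemma summable_mat_exp: "summable (\<lambda>n. (1 / fact n) *\<^sub>R (((**) M ^^ n) (mat 1)))"
  for M :: "complex ^ 'n ^ 'n"
proof -
  have "linear (\<lambda>B::complex ^ 'n ^ 'n. M ** B)"
  proof (rule linearI)
    show "M ** (B + B') = M ** B + M ** B'" for B B' :: "complex ^ 'n ^ 'n"
      by (rule matrix_add_ldistrib)
    show "M ** (r *\<^sub>R B) = r *\<^sub>R (M ** B)" for r and B :: "complex ^ 'n ^ 'n"
      by (simp add: vec_eq_iff matrix_matrix_mult_def scaleR_sum_right)
  qed
  then have "bounded_linear (\<lambda>B::complex ^ 'n ^ 'n. M ** B)"
    by (rule linear_conv_bounded_linear[THEN iffD1])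
  from bounded_linear.pos_bounded[OF this]
  obtain K where K: "K > 0" "\<And>B. norm (M ** B :: complex ^ 'n ^ 'n) \<le> norm B * K"
    by blast
  have b: "norm (((**) M ^^ n) (mat 1)) \<le> K ^ n * norm (mat 1 :: complex ^ 'n ^ 'n)" for n
  proof (induction n)
    case (Suc n)
    have "norm (((**) M ^^ Suc n) (mat 1)) \<le> norm (((**) M ^^ n) (mat 1)) * K"
      using K(2)[of "((**) M ^^ n) (mat 1)"] by simp
    also have "\<dots> \<le> (K ^ n * norm (mat 1 :: complex ^ 'n ^ 'n)) * K"
      using Suc K(1) by (intro mult_right_mono) auto
    finally show ?case by (simp add: algebra_simps)
  qed simp
  have "summable (\<lambda>n. inverse (fact n) * K ^ n * norm (mat 1 :: complex ^ 'n ^ 'n))"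
    by (rule summable_mult2[OF summable_exp])
  moreover have "norm ((1 / fact n) *\<^sub>R (((**) M ^^ n) (mat 1)))
      \<le> inverse (fact n) * K ^ n * norm (mat 1 :: complex ^ 'n ^ 'n)" for n
  proof -
    have "norm ((1 / fact n) *\<^sub>R (((**) M ^^ n) (mat 1))) = inverse (fact n) * norm (((**) M ^^ n) (mat 1))"
      by (simp add: divide_inverse)
    also have "\<dots> \<le> inverse (fact n) * (K ^ n * norm (mat 1 :: complex ^ 'n ^ 'n))"
      using b by (intro mult_left_mono) auto
    finally show ?thesis by (simp add: mult.assoc)
  qed
  ultimately show ?thesis by (rule summable_comparison_test'[where N = 0])
qed

lemma mat_exp_apply:
  "(\<lambda>n. (1 / fact n) *\<^sub>R (((*v) M ^^ n) x)) sums (mat_exp M *v (x::complex ^ 'n))"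
  using bounded_linear.sums[OF bounded_linear_mv_left summable_sums[OF summable_mat_exp], of M x]
  by (simp add: mat_exp_def mv_scaleR mat_power_apply)

text \<open>A vector with \<open>(N - \<nu>)^2 x = 0\<close>: the linear factor it produces in the exponential is what
  boundedness excludes.\<close>
lemma mat_exp_generalized_eigenvector:
  fixes x y :: "complex ^ 'n"
  assumes x: "N *v x = \<nu> *s x + y" and y: "N *v y = \<nu> *s y"
  shows "mat_exp N *v x = exp \<nu> *s (x + y)"
proof -
  have pw: "((*v) N ^^ n) x = \<nu> ^ n *s x + (of_nat n * \<nu> ^ (n - 1)) *s y" for n
  proof (induction n)
    case (Suc n)
    have "((*v) N ^^ Suc n) x = \<nu> ^ n *s (\<nu> *s x + y) + (of_nat n * \<nu> ^ (n - 1)) *s (\<nu> *s y)"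
      using Suc by (simp add: matrix_vector_right_distrib mv_smult x y)
    also have "\<dots> = \<nu> ^ Suc n *s x + (of_nat (Suc n) * \<nu> ^ (Suc n - 1)) *s y"
      by (cases n) (simp_all add: vec_eq_iff algebra_simps)
    finally show ?case .
  qed simp
  have e1: "(\<lambda>n. \<nu> ^ n / fact n) sums exp \<nu>"
    using exp_converges[of \<nu>] by (simp add: scaleR_conv_of_real field_simps)
  have "(\<lambda>n. of_nat (Suc n) * \<nu> ^ n / fact (Suc n)) = (\<lambda>n. \<nu> ^ n / fact n)"
    by (simp del: of_nat_Suc)
  then have "(\<lambda>n. of_nat n * \<nu> ^ (n - 1) / fact n) sums exp \<nu>"
    using e1 sums_Suc_iff[of "\<lambda>n. of_nat n * \<nu> ^ (n - 1) / fact n" "exp \<nu>"] by simp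
  from sums_add[OF bounded_linear.sums[OF bounded_linear_smult_left e1, of x]
      bounded_linear.sums[OF bounded_linear_smult_left this, of y]]
  moreover have "(1 / fact n) *\<^sub>R (((*v) N ^^ n) x)
      = (\<nu> ^ n / fact n) *s x + (of_nat n * \<nu> ^ (n - 1) / fact n) *s y" for n
    by (simp add: pw scaleR_smult vec_eq_iff ring_distribs divide_inverse mult_ac)
  ultimately have "(\<lambda>n. (1 / fact n) *\<^sub>R (((*v) N ^^ n) x)) sums (exp \<nu> *s x + exp \<nu> *s y)"
    by simp
  with mat_exp_apply[of N x] have "mat_exp N *v x = exp \<nu> *s x + exp \<nu> *s y"
    using sums_unique2 by blast
  then show ?thesis by (simp add: vec_eq_iff algebra_simps)
qed

definition bounded_group :: "real \<Rightarrow> complex ^ 'n ^ 'n \<Rightarrow> bool" where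
  "bounded_group C M \<longleftrightarrow> (\<forall>s x. norm (mat_exp (mat \<i> ** (s *\<^sub>R M)) *v x) \<le> C * norm x)"

lemma i_mat_mv: "(mat \<i> ** (s *\<^sub>R M)) *v x = (\<i> * complex_of_real s) *s (M *v (x::complex ^ 'n))"
  by (simp add: matrix_vector_mul_assoc[symmetric] mat_mv mv_scaleR scaleR_smult)

lemma bounded_group_generalized:
  fixes x y :: "complex ^ 'n"
  assumes C: "bounded_group C M" and x: "M *v x = \<mu> *s x + y" and y: "M *v y = \<mu> *s y"
  shows "norm (exp (\<i> * of_real s * \<mu>) *s (x + (\<i> * of_real s) *s y)) \<le> C * norm x"
proof -
  let ?N = "mat \<i> ** (s *\<^sub>R M)"
  have "?N *v x = (\<i> * of_real s * \<mu>) *s x + (\<i> * of_real s) *s y"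
    unfolding i_mat_mv x by (simp add: vec_eq_iff algebra_simps)
  moreover have "?N *v ((\<i> * of_real s) *s y) = (\<i> * of_real s * \<mu>) *s ((\<i> * of_real s) *s y)"
    unfolding i_mat_mv mv_smult y by (simp add: vec_eq_iff algebra_simps)
  ultimately show ?thesis
    using C mat_exp_generalized_eigenvector unfolding bounded_group_def by metis
qed

lemma bounded_group_eigenvalue_real:
  fixes x :: "complex ^ 'n"
  assumes C: "bounded_group C M" and x: "M *v x = \<mu> *s x" "x \<noteq> 0"
  shows "Im \<mu> = 0"
proof (rule ccontr)
  assume I: "Im \<mu> \<noteq> 0"
  have b: "exp (- s * Im \<mu>) \<le> C" for s
  proof -
    have "norm (exp (\<i> * of_real s * \<mu>) *s (x + (\<i> * of_real s) *s 0)) \<le> C * norm x"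
      using C x by (intro bounded_group_generalized) auto
    then have "exp (- s * Im \<mu>) * norm x \<le> C * norm x" by (simp add: norm_smult)
    then show ?thesis using x(2) by simp
  qed
  have "exp (- (- (\<bar>C\<bar> / Im \<mu>)) * Im \<mu>) \<le> C" by (rule b)
  then have "exp \<bar>C\<bar> \<le> C" using I by simp
  moreover have "exp \<bar>C\<bar> \<ge> 1 + \<bar>C\<bar>" by (rule exp_ge_add_one_self)
  ultimately show False by linarith
qed

text \<open>A Jordan chain of length two would make the group grow linearly in \<open>s\<close>.\<close>
lemma bounded_group_semisimple:
  fixes x y :: "complex ^ 'n"
  assumes C: "bounded_group C M" and x: "M *v x = \<mu> *s x + y" and y: "M *v y = \<mu> *s y"
  shows "y = 0"
proof (rule ccontr)
  assume y0: "y \<noteq> 0"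
  have I: "Im \<mu> = 0" using bounded_group_eigenvalue_real C y y0 by blast
  have b: "\<bar>s\<bar> * norm y \<le> norm x + C * norm x" for s
  proof -
    have "norm (x + (\<i> * of_real s) *s y) \<le> C * norm x"
      using bounded_group_generalized[OF C x y, of s] I by (simp only: norm_smult) simp
    moreover have "norm ((\<i> * of_real s) *s y) \<le> norm (x + (\<i> * of_real s) *s y) + norm x"
      using norm_triangle_ineq4[of "x + (\<i> * of_real s) *s y" x] by simp
    ultimately show ?thesis by (simp add: norm_smult norm_mult)
  qed
  have "(norm x + C * norm x + 1) / norm y * norm y \<le> norm x + C * norm x"
    by (rule order_trans[OF mult_right_mono[OF abs_ge_self] b]) simp
  then show False using y0 by simp
qed

lemma strongly_hyperbolic_bounded_group:
  fixes A :: "'d::finite \<Rightarrow> complex ^ 'k ^ 'k"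
  assumes "strongly_hyperbolic A"
  obtains C where "C > 0" "\<And>\<xi>. bounded_group C (symb A \<xi>)"
proof -
  obtain C where C: "\<And>\<xi>. onorm ((*v) (mat_exp (mat \<i> ** symb A \<xi>))) \<le> C"
    using assms unfolding strongly_hyperbolic_def bdd_above_def by auto
  have "bounded_group (max C 1) (symb A \<xi>)" for \<xi>
    unfolding bounded_group_def
  proof (intro allI)
    fix s :: real and x :: "complex ^ 'k"
    have e: "s *\<^sub>R symb A \<xi> = symb A (s *\<^sub>R \<xi>)" by (simp add: symb_def scaleR_sum_right)
    have "norm (mat_exp (mat \<i> ** (s *\<^sub>R symb A \<xi>)) *v x)
          \<le> onorm ((*v) (mat_exp (mat \<i> ** symb A (s *\<^sub>R \<xi>)))) * norm x"
      unfolding e by (rule onorm[OF bounded_linear_mv])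
    also have "\<dots> \<le> max C 1 * norm x" by (intro mult_right_mono) (auto intro: max.coboundedI1 C)
    finally show "norm (mat_exp (mat \<i> ** (s *\<^sub>R symb A \<xi>)) *v x) \<le> max C 1 * norm x" .
  qed
  then show ?thesis using that[of "max C 1"] by simp
qed

section \<open>Spectral decomposition with uniform bounds\<close>
lemma mv_sum: "M *v (\<Sum>i\<in>S. f i) = (\<Sum>i\<in>S. M *v (f i :: complex ^ 'n))"
  for M :: "complex ^ 'n ^ 'm"
  by (rule linear_sum[OF bounded_linear.linear[OF bounded_linear_mv]])

definition poly_act :: "complex ^ 'n ^ 'n \<Rightarrow> complex poly \<Rightarrow> complex ^ 'n \<Rightarrow> complex ^ 'n" where
  "poly_act M p v = (\<Sum>i\<le>degree p. coeff p i *s ((*v) M ^^ i) v)"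

lemma poly_act_altdef:
  assumes "degree p \<le> n"
  shows "poly_act M p v = (\<Sum>i\<le>n. coeff p i *s ((*v) M ^^ i) v)"
  unfolding poly_act_def
  by (rule sum.mono_neutral_left) (use assms in \<open>auto simp: coeff_eq_0\<close>)

text \<open>Peeling off one root turns an annihilating polynomial of \<open>v\<close> into one of smaller degree of
  \<open>M v - \<mu> v\<close>; this drives the induction in \<open>eigenvector_decomposition_roots\<close>.\<close>
lemma poly_act_linear_factor:
  "poly_act M ([:-\<mu>, 1:] * q) v = poly_act M q (M *v v - \<mu> *s v)"
proof -
  let ?n = "degree q" and ?f = "\<lambda>i. ((*v) M ^^ i) v"
  have pw: "((*v) M ^^ i) (M *v v - \<mu> *s v) = ?f (Suc i) - \<mu> *s ?f i" for i
    by (induction i) (simp_all add: matrix_vector_mult_diff_distrib mv_smult)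
  have c: "coeff ([:-\<mu>, 1:] * q) i = coeff (pCons 0 q) i - \<mu> * coeff q i" for i
    by simp
  have "poly_act M ([:-\<mu>, 1:] * q) v = (\<Sum>i\<le>Suc ?n. coeff ([:-\<mu>, 1:] * q) i *s ?f i)"
    by (rule poly_act_altdef) (rule order_trans[OF degree_mult_le], simp)
  also have "\<dots> = (\<Sum>i\<le>Suc ?n. coeff (pCons 0 q) i *s ?f i) - (\<Sum>i\<le>Suc ?n. (\<mu> * coeff q i) *s ?f i)"
    by (simp only: c vec.scale_left_diff_distrib sum_subtractf)
  also have "(\<Sum>i\<le>Suc ?n. coeff (pCons 0 q) i *s ?f i) = (\<Sum>i\<le>?n. coeff q i *s ?f (Suc i))"
    by (subst sum.atMost_Suc_shift) simp
  also have "(\<Sum>i\<le>Suc ?n. (\<mu> * coeff q i) *s ?f i) = (\<Sum>i\<le>?n. (\<mu> * coeff q i) *s ?f i)"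
    by (simp add: coeff_eq_0)
  finally show ?thesis
    unfolding poly_act_def pw vec.scale_right_diff_distrib sum_subtractf
    by (simp add: mult.commute)
qed

text \<open>The \<open>CARD('n) + 1\<close> vectors \<open>v, M v, M^2 v, \<dots>\<close> are linearly dependent.\<close>
lemma annihilating_poly:
  fixes M :: "complex ^ 'n ^ 'n"
  obtains p where "p \<noteq> 0" "degree p \<le> CARD('n)" "poly_act M p v = 0"
proof -
  let ?N = "CARD('n)" and ?f = "\<lambda>i. ((*v) M ^^ i) v"
  have "\<exists>c. (\<exists>i\<le>?N. c i \<noteq> 0) \<and> (\<Sum>i\<le>?N. c i *s ?f i) = 0"
  proof (cases "inj_on ?f {..?N}")
    case True
    have "\<not> card (?f ` {..?N}) \<le> vec.dim (?f ` {..?N})"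
      using True dim_subset_UNIV_cart_gen[of "?f ` {..?N}"] by (simp add: card_image)
    then have "vec.dependent (?f ` {..?N})"
      using vec.independent_bound_general by blast
    then obtain u where u: "\<exists>x\<in>?f ` {..?N}. u x \<noteq> 0" "(\<Sum>x\<in>?f ` {..?N}. u x *s x) = 0"
      by (subst (asm) vec.dependent_finite) auto
    then show ?thesis
      by (intro exI[of _ "\<lambda>i. u (?f i)"]) (auto simp: sum.reindex[OF True])
  next
    case False
    then obtain i j where ij: "i \<le> ?N" "j \<le> ?N" "i \<noteq> j" "?f i = ?f j"
      by (auto simp: inj_on_def)
    have "(\<Sum>k\<le>?N. (if k = i then 1 else if k = j then - 1 else 0) *s ?f k)
        = (\<Sum>k\<in>{i, j}. (if k = i then 1 else if k = j then - 1 else 0) *s ?f k)"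
      by (rule sum.mono_neutral_right) (use ij in auto)
    also have "\<dots> = 0" using ij by simp
    finally show ?thesis using ij(1)
      by (intro exI[of _ "\<lambda>k. if k = i then 1 else if k = j then - 1 else 0"]) auto
  qed
  then obtain c where c: "\<exists>i\<le>?N. c i \<noteq> 0" "(\<Sum>i\<le>?N. c i *s ?f i) = 0" by blast
  define p where "p = (\<Sum>i\<le>?N. monom (c i) i)"
  have cp: "coeff p j = (if j \<le> ?N then c j else 0)" for j
    by (simp add: p_def coeff_sum)
  have d: "degree p \<le> ?N" by (rule degree_le) (simp add: cp)
  show ?thesis
  proof
    show "p \<noteq> 0" using c(1) cp by (metis coeff_0)
    show "poly_act M p v = 0" using c(2) by (simp add: poly_act_altdef[OF d] cp)
  qed (rule d)
qed

text \<open>Induction on the degree.  With \<open>M v - \<mu> v = \<Sum> y_\<nu>\<close>, dividing each \<open>y_\<nu>\<close> by \<open>\<nu> - \<mu>\<close> and subtracting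
  from \<open>v\<close> leaves a vector that \<open>(M - \<mu>)^2\<close> annihilates, hence an eigenvector by \<open>ss\<close>.\<close>
lemma eigenvector_decomposition_roots:
  fixes M :: "complex ^ 'n ^ 'n"
  assumes ss: "\<And>x y \<mu>. M *v x = \<mu> *s x + y \<Longrightarrow> M *v y = \<mu> *s y \<Longrightarrow> y = 0"
    and "p \<noteq> 0" "poly_act M p v = 0"
  shows "\<exists>x. v = (\<Sum>\<mu>\<in>{z. poly p z = 0}. x \<mu>) \<and> (\<forall>\<mu>. M *v x \<mu> = \<mu> *s x \<mu>)"
  using assms(2,3)
proof (induction "degree p" arbitrary: p v)
  case 0
  then have c: "coeff p 0 \<noteq> 0" by (metis leading_coeff_0_iff)
  have "coeff p 0 *s v = 0" using 0 by (simp add: poly_act_def)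
  with c have "v = 0" by simp
  then show ?case by (intro exI[of _ "\<lambda>_. 0"]) simp
next
  case (Suc n)
  have "\<not> constant (poly p)" using Suc.hyps(2) by (simp add: constant_degree)
  then obtain \<mu> where \<mu>: "poly p \<mu> = 0" using fundamental_theorem_of_algebra by blast
  then obtain q where q: "p = [:-\<mu>, 1:] * q" by (auto simp: poly_eq_0_iff_dvd elim: dvdE)
  have q0: "q \<noteq> 0" using q Suc.prems by auto
  have "degree ([:-\<mu>, 1:] * q) = Suc (degree q)" using q0 by (subst degree_mult_eq) auto
  then have dq: "n = degree q" using Suc.hyps(2) q by simp
  let ?R = "{z. poly q z = 0}"
  have fin: "finite ?R" using q0 by (rule poly_roots_finite)
  have rp: "{z. poly p z = 0} = insert \<mu> (?R - {\<mu>})" using q by auto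
  have "poly_act M q (M *v v - \<mu> *s v) = 0"
    using Suc.prems(2) unfolding q poly_act_linear_factor .
  from Suc.hyps(1)[OF dq q0 this] obtain y where
    y: "M *v v - \<mu> *s v = (\<Sum>\<nu>\<in>?R. y \<nu>)" "\<And>\<nu>. M *v y \<nu> = \<nu> *s y \<nu>" by blast
  define w where "w = v - (\<Sum>\<nu>\<in>?R - {\<mu>}. (1 / (\<nu> - \<mu>)) *s y \<nu>)"
  define r where "r = (if \<mu> \<in> ?R then y \<mu> else 0)"
  have "M *v w - \<mu> *s w = (\<Sum>\<nu>\<in>?R. y \<nu>)
      - (\<Sum>\<nu>\<in>?R - {\<mu>}. (1 / (\<nu> - \<mu>)) *s (M *v y \<nu>) - (\<mu> / (\<nu> - \<mu>)) *s y \<nu>)"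
    by (simp add: w_def y(1)[symmetric] matrix_vector_mult_diff_distrib vec.scale_right_diff_distrib
        mv_sum mv_smult sum_subtractf vec.scale_sum_right)
  also have "(\<Sum>\<nu>\<in>?R - {\<mu>}. (1 / (\<nu> - \<mu>)) *s (M *v y \<nu>) - (\<mu> / (\<nu> - \<mu>)) *s y \<nu>)
      = (\<Sum>\<nu>\<in>?R - {\<mu>}. y \<nu>)"
  proof (rule sum.cong[OF refl])
    fix \<nu> assume "\<nu> \<in> ?R - {\<mu>}"
    then have "\<nu> / (\<nu> - \<mu>) - \<mu> / (\<nu> - \<mu>) = 1" by (simp add: diff_divide_distrib[symmetric])
    then show "(1 / (\<nu> - \<mu>)) *s (M *v y \<nu>) - (\<mu> / (\<nu> - \<mu>)) *s y \<nu> = y \<nu>"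
      by (simp add: y(2) vec.scale_left_diff_distrib[symmetric])
  qed
  also have "(\<Sum>\<nu>\<in>?R. y \<nu>) - (\<Sum>\<nu>\<in>?R - {\<mu>}. y \<nu>) = r"
    using fin by (simp add: r_def sum_diff1)
  finally have "M *v w = \<mu> *s w + r" by (simp add: algebra_simps)
  moreover have "M *v r = \<mu> *s r" by (simp add: r_def y(2))
  ultimately have "M *v w = \<mu> *s w" using ss[of w \<mu> r] by simp
  moreover have "v = w + (\<Sum>\<nu>\<in>?R - {\<mu>}. (1 / (\<nu> - \<mu>)) *s y \<nu>)" by (simp add: w_def)
  moreover have "(\<Sum>\<nu>\<in>insert \<mu> (?R - {\<mu>}). if \<nu> = \<mu> then w else (1 / (\<nu> - \<mu>)) *s y \<nu>)
      = w + (\<Sum>\<nu>\<in>?R - {\<mu>}. (1 / (\<nu> - \<mu>)) *s y \<nu>)"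
    using fin by (subst sum.insert) (auto intro!: sum.cong arg_cong2[where f = "(+)"])
  ultimately show ?case
    unfolding rp
    by (intro exI[of _ "\<lambda>\<nu>. if \<nu> = \<mu> then w else (1 / (\<nu> - \<mu>)) *s y \<nu>"])
       (simp add: y(2) mv_smult vec.scale_left_commute)
qed

lemma cesaro_unimodular:
  fixes z :: complex
  assumes "cmod z = 1" "z \<noteq> 1"
  shows "(\<lambda>N. (\<Sum>n<N. z ^ n) / of_nat N) \<longlonglongrightarrow> 0"
proof (rule Lim_null_comparison)
  show "\<forall>\<^sub>F N in sequentially. norm ((\<Sum>n<N. z ^ n) / of_nat N) \<le> (2 / cmod (1 - z)) / real N"
  proof (rule always_eventually, rule allI)
    fix N
    have "cmod (\<Sum>n<N. z ^ n) = cmod (1 - z ^ N) / cmod (1 - z)"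
      using assms(2) by (simp add: sum_gp_strict norm_divide)
    also have b: "\<dots> \<le> 2 / cmod (1 - z)"
      using norm_triangle_ineq4[of 1 "z ^ N"] assms(1)
      by (intro divide_right_mono) (simp_all add: norm_power)
    finally show "norm ((\<Sum>n<N. z ^ n) / of_nat N) \<le> (2 / cmod (1 - z)) / real N"
      unfolding norm_divide norm_of_nat by (rule divide_right_mono) simp
  qed
  show "(\<lambda>N. (2 / cmod (1 - z)) / real N) \<longlonglongrightarrow> 0"
    by (rule lim_const_over_n)
qed

text \<open>A single spectral component is recovered from the orbit under \<open>exp (i s M)\<close> by averaging against
  \<open>exp (- i s \<mu>)\<close>; hence it is bounded by the same constant as the group.  The average is taken over
  equidistant times, so that it is a finite geometric sum.\<close>
lemma spectral_component_bound:
  fixes M :: "complex ^ 'n ^ 'n" and x :: "real \<Rightarrow> complex ^ 'n"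
  assumes C: "bounded_group C M" and fin: "finite S" and \<mu>: "\<mu> \<in> S"
    and x: "\<And>\<nu>. M *v x \<nu> = of_real \<nu> *s x \<nu>"
  shows "norm (x \<mu>) \<le> C * norm (\<Sum>\<nu>\<in>S. x \<nu>)"
proof -
  let ?v = "\<Sum>\<nu>\<in>S. x \<nu>"
  \<comment> \<open>A step so small that distinct eigenvalues give distinct points of the unit circle.\<close>
  define \<theta> where "\<theta> = 1 / (1 + (\<Sum>\<nu>\<in>S. \<bar>\<nu> - \<mu>\<bar>))"
  have sum0: "0 \<le> (\<Sum>\<nu>\<in>S. \<bar>\<nu> - \<mu>\<bar>)" by (simp add: sum_nonneg)
  have \<theta>0: "\<theta> > 0" using sum0 by (simp add: \<theta>_def add_pos_nonneg)
  define z where "z \<nu> = exp (\<i> * of_real (\<theta> * (\<nu> - \<mu>)))" for \<nu>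
  have z1: "cmod (z \<nu>) = 1" for \<nu> by (simp add: z_def)
  have zn: "z \<nu> \<noteq> 1" if "\<nu> \<in> S" "\<nu> \<noteq> \<mu>" for \<nu>
  proof
    assume "z \<nu> = 1"
    then obtain n :: int where n: "\<theta> * (\<nu> - \<mu>) = of_int (2 * n) * pi"
      unfolding z_def exp_eq_1 by auto
    have "\<bar>\<nu> - \<mu>\<bar> \<le> (\<Sum>\<nu>\<in>S. \<bar>\<nu> - \<mu>\<bar>)" using that fin by (intro member_le_sum) auto
    then have l: "\<bar>\<theta> * (\<nu> - \<mu>)\<bar> < 1" using sum0 by (simp add: \<theta>_def abs_mult)
    have "n \<noteq> 0" using n that \<theta>0 by auto
    then have "\<bar>of_int (2 * n) * pi\<bar> \<ge> 2 * pi" by (simp add: abs_mult)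
    then show False using l n pi_gt3 by simp
  qed
  have avg: "(\<lambda>N. \<Sum>\<nu>\<in>S. ((\<Sum>n<N. z \<nu> ^ n) / of_nat N) *s x \<nu>) \<longlonglongrightarrow> (\<Sum>\<nu>\<in>S. (if \<nu> = \<mu> then 1 else 0) *s x \<nu>)"
  proof (intro tendsto_sum bounded_linear.tendsto[OF bounded_linear_smult_left])
    fix \<nu> assume "\<nu> \<in> S"
    show "(\<lambda>N. (\<Sum>n<N. z \<nu> ^ n) / of_nat N) \<longlonglongrightarrow> (if \<nu> = \<mu> then 1 else 0)"
    proof (cases "\<nu> = \<mu>")
      case True
      have "\<forall>\<^sub>F N in sequentially. (\<Sum>n<N. z \<nu> ^ n) / of_nat N = 1"
        using eventually_gt_at_top[of 0] by eventually_elim (simp add: True z_def)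
      then show ?thesis using True by (simp add: tendsto_eventually)
    next
      case False
      then show ?thesis using cesaro_unimodular[OF z1 zn[OF \<open>\<nu> \<in> S\<close>]] by simp
    qed
  qed
  have lim: "(\<Sum>\<nu>\<in>S. (if \<nu> = \<mu> then 1 else 0) *s x \<nu>) = x \<mu>"
    using fin \<mu> by (simp add: if_distrib[of "\<lambda>c. c *s _"] cong: if_cong)
  have b: "norm (\<Sum>\<nu>\<in>S. z \<nu> ^ n *s x \<nu>) \<le> C * norm ?v" for n :: nat
  proof -
    let ?s = "of_nat n * \<theta>"
    let ?E = "mat_exp (mat \<i> ** (?s *\<^sub>R M))"
    have ev: "?E *v x \<nu> = exp (\<i> * of_real ?s * of_real \<nu>) *s x \<nu>" for \<nu>
      using mat_exp_generalized_eigenvector[of "mat \<i> ** (?s *\<^sub>R M)" "x \<nu>" "\<i> * of_real ?s * of_real \<nu>" 0]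
      by (simp add: i_mat_mv x)
    have "z \<nu> ^ n = exp (- \<i> * of_real (?s * \<mu>)) * exp (\<i> * of_real ?s * of_real \<nu>)" for \<nu>
      by (simp add: z_def exp_of_nat_mult[symmetric] exp_add[symmetric] algebra_simps)
    then have "(\<Sum>\<nu>\<in>S. z \<nu> ^ n *s x \<nu>) = exp (- \<i> * of_real (?s * \<mu>)) *s (?E *v ?v)"
      by (simp add: mv_sum ev vec.scale_sum_right)
    then have "norm (\<Sum>\<nu>\<in>S. z \<nu> ^ n *s x \<nu>) = norm (?E *v ?v)" by (simp add: norm_smult)
    then show ?thesis using C by (simp add: bounded_group_def)
  qed
  have "norm (\<Sum>\<nu>\<in>S. ((\<Sum>n<N. z \<nu> ^ n) / of_nat N) *s x \<nu>) \<le> C * norm ?v" if "N > 0" for N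
  proof -
    have "(\<Sum>\<nu>\<in>S. ((\<Sum>n<N. z \<nu> ^ n) / of_nat N) *s x \<nu>)
        = (1 / of_nat N) *s (\<Sum>n<N. \<Sum>\<nu>\<in>S. z \<nu> ^ n *s x \<nu>)"
      by (subst sum.swap) (simp add: vec.scale_sum_right vec.scale_sum_left[symmetric])
    then have "norm (\<Sum>\<nu>\<in>S. ((\<Sum>n<N. z \<nu> ^ n) / of_nat N) *s x \<nu>)
        = norm (\<Sum>n<N. \<Sum>\<nu>\<in>S. z \<nu> ^ n *s x \<nu>) / real N"
      by (simp add: norm_smult norm_divide)
    also have "\<dots> \<le> (real N * (C * norm ?v)) / real N"
      using sum_norm_le[of "{..<N}" "\<lambda>n. \<Sum>\<nu>\<in>S. z \<nu> ^ n *s x \<nu>" "\<lambda>_. C * norm ?v"] b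
      by (intro divide_right_mono) auto
    finally show ?thesis using that by simp
  qed
  then have "\<forall>\<^sub>F N in sequentially. norm (\<Sum>\<nu>\<in>S. ((\<Sum>n<N. z \<nu> ^ n) / of_nat N) *s x \<nu>) \<le> C * norm ?v"
    using eventually_gt_at_top[of 0] by (rule eventually_mono[rotated])
  then show ?thesis
    using tendsto_upperbound[OF tendsto_norm[OF avg]] lim by simp
qed

text \<open>The bound on the number of components, like that of \<open>spectral_component_bound\<close> on their size, depends
  on the matrix only through its dimension and the constant of the group; perturbation theory requires
  this uniformity.\<close>
lemma real_spectral_decomposition:
  fixes M :: "complex ^ 'n ^ 'n"
  assumes C: "bounded_group C M"
  obtains S x where "finite S" "card S \<le> CARD('n)" "v = (\<Sum>\<mu>\<in>S. x \<mu>)"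
    "\<And>\<mu>::real. M *v x \<mu> = of_real \<mu> *s x \<mu>" "\<And>\<mu>. \<mu> \<in> S \<Longrightarrow> x \<mu> \<noteq> 0"
proof -
  obtain p where p: "p \<noteq> 0" "degree p \<le> CARD('n)" "poly_act M p v = 0"
    by (rule annihilating_poly)
  have "\<exists>x. v = (\<Sum>\<mu>\<in>{z. poly p z = 0}. x \<mu>) \<and> (\<forall>\<mu>. M *v x \<mu> = \<mu> *s x \<mu>)"
    by (rule eigenvector_decomposition_roots[OF _ p(1,3)]) (rule bounded_group_semisimple[OF C])
  then obtain x where x: "v = (\<Sum>\<mu>\<in>{z. poly p z = 0}. x \<mu>)" "\<And>\<mu>. M *v x \<mu> = \<mu> *s x \<mu>" by blast
  let ?R = "{z. poly p z = 0}"
  have fin: "finite ?R" using p(1) by (rule poly_roots_finite)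
  let ?R' = "{z\<in>?R. x z \<noteq> 0}"
  have re: "of_real (Re z) = z" if "x z \<noteq> 0" for z
    using bounded_group_eigenvalue_real[OF C x(2)[of z] that] by (simp add: complex_eq_iff)
  have inj: "inj_on Re ?R'" by (rule inj_on_inverseI[of _ of_real]) (use re in auto)
  show ?thesis
  proof
    show "finite (Re ` ?R')" using fin by simp
    have "card (Re ` ?R') \<le> card ?R"
      unfolding card_image[OF inj] using fin by (intro card_mono) auto
    also have "\<dots> \<le> CARD('n)" using card_poly_roots_bound[OF p(1)] p(2) by simp
    finally show "card (Re ` ?R') \<le> CARD('n)" .
    have "v = (\<Sum>\<mu>\<in>?R'. x \<mu>)"
      unfolding x(1) by (rule sum.mono_neutral_right) (use fin in auto)
    also have "\<dots> = (\<Sum>\<mu>\<in>Re ` ?R'. x (of_real \<mu>))"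
      by (subst sum.reindex[OF inj]) (auto simp: re intro!: sum.cong)
    finally show "v = (\<Sum>\<mu>\<in>Re ` ?R'. x (of_real \<mu>))" .
    show "M *v x (of_real \<mu>) = of_real \<mu> *s x (of_real \<mu>)" for \<mu> by (rule x(2))
    show "x (of_real \<mu>) \<noteq> 0" if "\<mu> \<in> Re ` ?R'" for \<mu> using that re by auto
  qed
qed

section \<open>Projection onto the kernel and partial inverse\<close>
text \<open>By \<open>ss\<close> the matrix is injective on its range, hence maps the range onto itself.\<close>
lemma ker_range_decomposition:
  fixes M :: "complex ^ 'n ^ 'n"
  assumes ss: "\<And>v. M *v (M *v v) = 0 \<Longrightarrow> M *v v = 0"
  shows "\<exists>w. M *v (v - M *v w) = 0"
proof -
  let ?R = "range ((*v) M)"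
  have lin: "linear ((*v) M)" by (rule bounded_linear.linear[OF bounded_linear_mv])
  have sub: "subspace ?R" using linear_subspace_image[OF lin subspace_UNIV] .
  have "inj_on ((*v) M) ?R"
  proof (rule inj_onI)
    fix x y assume "x \<in> ?R" "y \<in> ?R" and e: "M *v x = M *v y"
    then obtain a b where ab: "x = M *v a" "y = M *v b" by auto
    have "M *v (M *v (a - b)) = 0" using e unfolding ab matrix_vector_mult_diff_distrib by simp
    from ss[OF this] show "x = y" unfolding ab matrix_vector_mult_diff_distrib by simp
  qed
  moreover have "span ?R = ?R" using sub by (rule span_eq_iff[THEN iffD2])
  ultimately have "inj_on ((*v) M) (span ?R)" by (simp only:)
  then have "dim (((*v) M) ` ?R) = dim ?R" by (rule dim_image_eq[OF lin])
  then have "((*v) M) ` ?R = ?R"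
    by (intro subspace_dim_equal[OF linear_subspace_image[OF lin sub] sub] image_subsetI rangeI) simp
  moreover have "M *v v \<in> ?R" by simp
  ultimately have "M *v v \<in> ((*v) M) ` ?R" by (simp only:)
  then obtain w where "M *v v = M *v (M *v w)" by (elim imageE) simp
  then show ?thesis by (intro exI[of _ w]) (simp add: matrix_vector_mult_diff_distrib)
qed

text \<open>The projection is built as a function, sending \<open>v\<close> to the kernel component of its decomposition; it is
  linear because that component is unique.\<close>
lemma ker_proj_spec:
  fixes M :: "complex ^ 'n ^ 'n"
  assumes ss: "\<And>v. M *v (M *v v) = 0 \<Longrightarrow> M *v v = 0"
  shows "ker_proj M ** ker_proj M = ker_proj M \<and>
    range ((*v) (ker_proj M)) = {v. M *v v = 0} \<and> {v. ker_proj M *v v = 0} = range ((*v) M)"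
proof -
  let ?good = "\<lambda>v y. M *v y = 0 \<and> (\<exists>w. v - y = M *v w)"
  define pf where "pf v = (SOME y. ?good v y)" for v
  have good: "?good v (pf v)" for v
    unfolding pf_def
  proof (rule someI_ex)
    obtain w where "M *v (v - M *v w) = 0" using ker_range_decomposition[OF ss] by blast
    then show "\<exists>y. ?good v y" by (intro exI[of _ "v - M *v w"]) auto
  qed
  have uniq: "y = y'" if "?good v y" "?good v y'" for v y y'
  proof -
    obtain w w' where w: "v - y = M *v w" "v - y' = M *v w'" using \<open>?good v y\<close> \<open>?good v y'\<close> by blast
    have e: "y' - y = M *v (w - w')" unfolding matrix_vector_mult_diff_distrib w[symmetric] by simp
    have "M *v (y' - y) = 0" using that by (simp add: matrix_vector_mult_diff_distrib)
    then have "M *v (w - w') = 0" unfolding e by (rule ss)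
    then show ?thesis using e by simp
  qed
  have pf_add: "pf (a + b) = pf a + pf b" for a b
  proof (rule uniq[OF good])
    obtain w w' where "a - pf a = M *v w" "b - pf b = M *v w'" using good by meson
    then have "a + b - (pf a + pf b) = M *v (w + w')"
      unfolding matrix_vector_right_distrib by (metis add_diff_add)
    then show "?good (a + b) (pf a + pf b)"
      using good by (intro conjI exI[of _ "w + w'"]) (simp_all add: matrix_vector_right_distrib)
  qed
  have pf_scale: "pf (c *s a) = c *s pf a" for c a
  proof (rule uniq[OF good])
    obtain w where "a - pf a = M *v w" using good by meson
    then have "c *s a - c *s pf a = M *v (c *s w)"
      by (simp add: mv_smult vec.scale_right_diff_distrib[symmetric])
    then show "?good (c *s a) (c *s pf a)"
      using good by (intro conjI exI[of _ "c *s w"]) (simp_all add: mv_smult)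
  qed
  have "Vector_Spaces.linear (*s) (*s) pf"
    by (unfold_locales) (simp_all add: pf_add pf_scale vec.scale_right_distrib vec.scale_left_distrib)
  then have mp: "matrix pf *v v = pf v" for v by (rule matrix_works)
  have pker: "pf y = y" if "M *v y = 0" for y
    by (rule uniq[OF good]) (use that in \<open>auto intro: exI[of _ 0]\<close>)
  have prange: "pf (M *v w) = 0" for w
    by (rule uniq[OF good]) auto
  define Pr where "Pr P \<longleftrightarrow> P ** P = P \<and> range ((*v) P) = {v. M *v v = 0} \<and> {v. P *v v = 0} = range ((*v) M)"
    for P
  have "Pr (matrix pf)"
    unfolding Pr_def
  proof (intro conjI)
    show "matrix pf ** matrix pf = matrix pf"
      unfolding matrix_eq using good pker by (simp add: matrix_vector_mul_assoc[symmetric] mp)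
    have "v \<in> range pf" if "M *v v = 0" for v using pker[OF that] by (metis rangeI)
    then show "range ((*v) (matrix pf)) = {v. M *v v = 0}" using good by (auto simp: mp)
    have "v \<in> range ((*v) M)" if "pf v = 0" for v using good[of v] that by auto
    then show "{v. matrix pf *v v = 0} = range ((*v) M)" by (auto simp: mp prange)
  qed
  moreover have "P = matrix pf" if "Pr P" for P
    unfolding matrix_eq
  proof
    fix v
    have "?good v (P *v v)"
    proof
      show "M *v (P *v v) = 0" using that unfolding Pr_def by blast
      have "P *v (v - P *v v) = 0"
        using that unfolding Pr_def by (simp add: matrix_vector_mult_diff_distrib matrix_vector_mul_assoc)
      then show "\<exists>w. v - P *v v = M *v w" using that unfolding Pr_def by blast
    qed
    then show "P *v v = matrix pf *v v" using uniq good by (metis mp)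
  qed
  ultimately have "\<exists>!P. Pr P" by blast
  then have "Pr (THE P. Pr P)" by (rule theI')
  moreover have "ker_proj M = (THE P. Pr P)" by (simp add: ker_proj_def Pr_def)
  ultimately show ?thesis by (simp add: Pr_def)
qed

context
  fixes M :: "complex ^ 'n ^ 'n"
  assumes ss: "\<And>v. M *v (M *v v) = 0 \<Longrightarrow> M *v v = 0"
begin

lemma ker_proj_in_ker: "M *v (ker_proj M *v v) = 0"
  using ker_proj_spec[OF ss] by blast

lemma ker_proj_range: "ker_proj M *v (M *v v) = 0"
  using ker_proj_spec[OF ss] by blast

lemma ker_proj_idem: "ker_proj M *v (ker_proj M *v v) = ker_proj M *v v"
  using ker_proj_spec[OF ss] by (simp add: matrix_vector_mul_assoc)

lemma ker_proj_ker:
  assumes "M *v v = 0" shows "ker_proj M *v v = v"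
proof -
  have "v \<in> range ((*v) (ker_proj M))" using ker_proj_spec[OF ss] assms by blast
  then show ?thesis using ker_proj_idem by auto
qed

lemma ker_proj_complement: "\<exists>w. v - ker_proj M *v v = M *v w"
proof -
  have "ker_proj M *v (v - ker_proj M *v v) = 0"
    by (simp add: matrix_vector_mult_diff_distrib ker_proj_idem)
  then show ?thesis using ker_proj_spec[OF ss] by blast
qed

text \<open>\<open>M + ker_proj M\<close> is injective, and the partial inverse is its inverse composed with the
  complementary projection.\<close>
lemma partial_inverse_mult: "partial_inverse M *v (M *v v) = v - ker_proj M *v v"
proof -
  let ?P = "ker_proj M"
  define Pr where "Pr Q \<longleftrightarrow> Q ** ?P = 0 \<and> Q ** M ** (mat 1 - ?P) = mat 1 - ?P" for Q
  have MP: "M *v (v - ?P *v v) = M *v v" for v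
    by (simp add: matrix_vector_mult_diff_distrib ker_proj_in_ker)
  have Pr_iff: "Pr Q \<longleftrightarrow> (\<forall>v. Q *v (?P *v v) = 0) \<and> (\<forall>v. Q *v (M *v v) = v - ?P *v v)" for Q
    unfolding Pr_def matrix_eq
    by (simp add: matrix_vector_mul_assoc[symmetric] matrix_vector_mult_diff_rdistrib MP)
  have "v = 0" if "(M + ?P) *v v = 0" for v
  proof -
    have e: "M *v v + ?P *v v = 0" using that by (simp add: matrix_vector_mult_add_rdistrib)
    have "?P *v (M *v v + ?P *v v) = ?P *v v"
      by (simp add: matrix_vector_right_distrib ker_proj_range ker_proj_idem)
    then have "?P *v v = 0" unfolding e by simp
    moreover from this e have "M *v v = 0" by simp
    ultimately show "v = 0" using ker_proj_ker by simp
  qed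
  then obtain B where B: "B ** (M + ?P) = mat 1"
    by (metis matrix_left_invertible_ker)
  have Bv: "B *v (M *v v) + B *v (?P *v v) = v" for v
  proof -
    have "(B ** (M + ?P)) *v v = v" using B by simp
    then show ?thesis
      by (simp only: matrix_vector_mul_assoc[symmetric] matrix_vector_mult_add_rdistrib
          matrix_vector_right_distrib)
  qed
  have "Pr (B ** (mat 1 - ?P))"
    unfolding Pr_iff
  proof (intro conjI allI)
    show "B ** (mat 1 - ?P) *v (?P *v v) = 0" for v
      by (simp add: matrix_vector_mul_assoc[symmetric] matrix_vector_mult_diff_rdistrib ker_proj_idem)
    have "B *v (M *v v) = v - ?P *v v" for v
      using Bv[of "v - ?P *v v"] unfolding MP by (simp add: matrix_vector_mult_diff_distrib ker_proj_idem)
    then show "B ** (mat 1 - ?P) *v (M *v v) = v - ?P *v v" for v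
      by (simp add: matrix_vector_mul_assoc[symmetric] matrix_vector_mult_diff_rdistrib ker_proj_range)
  qed
  moreover have "Q = Q'" if "Pr Q" "Pr Q'" for Q Q'
    unfolding matrix_eq
  proof
    fix v
    obtain w where "v - ?P *v v = M *v w" using ker_proj_complement by blast
    then have v: "v = ?P *v v + M *v w" by (simp add: algebra_simps)
    have "Q *v (?P *v v + M *v w) = Q' *v (?P *v v + M *v w)"
      using that unfolding Pr_iff by (simp add: matrix_vector_right_distrib)
    then show "Q *v v = Q' *v v" using v by simp
  qed
  ultimately have "\<exists>!Q. Pr Q" by blast
  then have "Pr (THE Q. Pr Q)" by (rule theI')
  moreover have "partial_inverse M = (THE Q. Pr Q)" by (simp add: partial_inverse_def Pr_def)
  ultimately show ?thesis by (simp add: Pr_iff)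
qed

end

lemma bounded_group_ker_sq:
  assumes "bounded_group C M" "M *v (M *v v) = 0"
  shows "M *v v = 0"
  using bounded_group_semisimple[OF assms(1), of v 0 "M *v v"] assms(2) by simp

lemma det_zero_iff_kernel:
  fixes M :: "complex ^ 'n ^ 'n"
  shows "det M = 0 \<longleftrightarrow> (\<exists>v. v \<noteq> 0 \<and> M *v v = 0)"
  by (metis invertible_det_nz invertible_left_inverse matrix_left_invertible_ker)

section \<open>Perturbation of the kernel and group velocity\<close>
lemma symb_add: "symb A (\<xi> + \<eta>) = symb A \<xi> + symb A \<eta>"
  by (simp add: symb_def scaleR_left_distrib sum.distrib)

lemma symb_scaleR: "symb A (s *\<^sub>R \<xi>) = s *\<^sub>R symb A \<xi>"
  by (simp add: symb_def scaleR_sum_right)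

lemma symb_axis: "symb A (axis j 1) = A j"
proof -
  have "symb A (axis j 1) = (\<Sum>i\<in>UNIV. if i = j then A i else 0)"
    unfolding symb_def by (rule sum.cong) (auto simp: axis_def)
  then show ?thesis by simp
qed

lemma symb_bound:
  obtains B where "B > 0" "\<And>h w. norm (symb A h *v w) \<le> B * norm h * norm w"
proof -
  define B where "B = 1 + (\<Sum>j\<in>UNIV. onorm ((*v) (A j)))"
  have o: "0 \<le> onorm ((*v) (A j))" for j by (rule onorm_pos_le[OF bounded_linear_mv])
  have "norm (symb A h *v w) \<le> B * norm h * norm w" for h w
  proof -
    have "symb A h *v w = (\<Sum>j\<in>UNIV. (h $ j) *\<^sub>R (A j *v w))"
      unfolding symb_def
      by (simp add: linear_sum[OF bounded_linear.linear[OF bounded_linear_mv_left]] mv_scaleR)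
    then have "norm (symb A h *v w) \<le> (\<Sum>j\<in>UNIV. \<bar>h $ j\<bar> * norm (A j *v w))"
      using norm_sum[of "\<lambda>j. (h $ j) *\<^sub>R (A j *v w)" UNIV] by simp
    also have "\<dots> \<le> (\<Sum>j\<in>UNIV. norm h * (onorm ((*v) (A j)) * norm w))"
      using o by (intro sum_mono mult_mono component_le_norm_cart onorm[OF bounded_linear_mv]) auto
    also have "\<dots> \<le> B * norm h * norm w"
      by (simp add: B_def sum_distrib_left[symmetric] sum_distrib_right[symmetric] algebra_simps)
    finally show ?thesis .
  qed
  moreover have "B > 0" using o by (simp add: B_def add_pos_nonneg sum_nonneg)
  ultimately show ?thesis using that by blast
qed

text \<open>The smooth variety hypothesis makes \<open>- \<tau>\<close> the only eigenvalue near \<open>0\<close> of the symbols near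
  \<open>symb A (axis i1 1)\<close>.  The other spectral components of a vector \<open>w\<close> of the kernel are of order
  \<open>h\<close>: their eigenvalues are bounded away from \<open>0\<close>, while \<open>M w\<close> is of order \<open>h\<close>.\<close>
lemma kernel_perturbation:
  fixes A :: "'d::finite \<Rightarrow> complex ^ 'k ^ 'k"
  assumes sh: "strongly_hyperbolic A" and sv: "smooth_variety A i1 \<tau>"
  obtains \<delta> C where "\<delta> > 0" "C > 0"
    "\<And>h w. norm h < \<delta> \<Longrightarrow> A i1 *v w = 0 \<Longrightarrow>
       \<exists>w'. symb A (axis i1 1 + h) *v w' = of_real (- \<tau> (axis i1 1 + h)) *s w' \<and>
            norm (w - w') \<le> C * norm h * norm w"
proof -
  let ?e = "axis i1 1 :: real ^ 'd"
  obtain C where C: "C > 0" "\<And>\<xi>. bounded_group C (symb A \<xi>)"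
    by (rule strongly_hyperbolic_bounded_group[OF sh]) blast
  obtain B where B: "B > 0" "\<And>h w. norm (symb A h *v w) \<le> B * norm h * norm w"
    by (rule symb_bound[of A]) blast
  obtain \<Gamma> U where \<Gamma>: "open \<Gamma>" "conormal i1 \<subseteq> \<Gamma>" "Char A \<inter> \<Gamma> = (\<lambda>\<xi>. (\<tau> \<xi>, \<xi>)) ` U"
    using sv unfolding smooth_variety_def by blast
  have "(0, ?e) \<in> conormal i1" by (auto simp: conormal_def axis_def vec_eq_iff zero_prod_def)
  then have "(0, ?e) \<in> \<Gamma>" using \<Gamma>(2) by blast
  then obtain r where r: "r > 0" "ball (0, ?e) r \<subseteq> \<Gamma>" using \<Gamma>(1) open_contains_ball by blast
  define \<delta> where "\<delta> = min (r / 2) (1 / 2)"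
  have \<delta>: "\<delta> > 0" "\<delta> < 1" using r(1) by (simp_all add: \<delta>_def)
  let ?K = "C * B / \<delta> * real CARD('k)"
  show ?thesis
  proof
    show "\<delta> > 0" by fact
    show "?K > 0" using C(1) B(1) \<delta>(1) by simp
    fix h :: "real ^ 'd" and w :: "complex ^ 'k"
    assume h: "norm h < \<delta>" and w: "A i1 *v w = 0"
    let ?M = "symb A (?e + h)"
    obtain S x where S: "finite S" "card S \<le> CARD('k)" "w = (\<Sum>\<mu>\<in>S. x \<mu>)"
      "\<And>\<mu>::real. ?M *v x \<mu> = of_real \<mu> *s x \<mu>" "\<And>\<mu>. \<mu> \<in> S \<Longrightarrow> x \<mu> \<noteq> 0"
      by (rule real_spectral_decomposition[OF C(2)[of "?e + h"], of w]) blast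
    have near: "\<mu> = - \<tau> (?e + h)" if "\<mu> \<in> S" "\<bar>\<mu>\<bar> < \<delta>" for \<mu>
    proof -
      have "?e + h \<noteq> 0"
      proof
        assume "?e + h = 0"
        then have "norm h = 1" by (metis add_eq_0_iff norm_axis_1 norm_minus_cancel)
        then show False using h \<delta>(2) by simp
      qed
      moreover have "det (mat (of_real (- \<mu>)) + ?M) = 0"
        unfolding det_zero_iff_kernel
        by (rule exI[of _ "x \<mu>"])
           (simp add: S(5)[OF that(1)] matrix_vector_mult_add_rdistrib mat_mv S(4))
      ultimately have "(- \<mu>, ?e + h) \<in> Char A" by (simp add: Char_def zero_prod_def)
      moreover have "(- \<mu>, ?e + h) \<in> \<Gamma>"
      proof -
        have "dist (0, ?e) (- \<mu>, ?e + h) \<le> \<bar>\<mu>\<bar> + norm h"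
          unfolding dist_Pair_Pair
          by (rule order_trans[OF sqrt_sum_squares_le_sum]) (simp_all add: dist_norm)
        also have "\<dots> < r" using that(2) h by (simp add: \<delta>_def)
        finally show ?thesis using r(2) by (auto simp: subset_iff)
      qed
      ultimately have "(- \<mu>, ?e + h) \<in> (\<lambda>\<xi>. (\<tau> \<xi>, \<xi>)) ` U" using \<Gamma>(3) by blast
      then show ?thesis by auto
    qed
    let ?near = "{\<mu>\<in>S. \<bar>\<mu>\<bar> < \<delta>}" and ?far = "{\<mu>\<in>S. \<not> \<bar>\<mu>\<bar> < \<delta>}"
    define w' where "w' = (\<Sum>\<mu>\<in>?near. x \<mu>)"
    have Mw: "?M *v w = symb A h *v w"
      by (simp add: symb_add symb_axis matrix_vector_mult_add_rdistrib w)
    have Mw': "?M *v w = (\<Sum>\<mu>\<in>S. of_real \<mu> *s x \<mu>)"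
      by (simp add: S(3) mv_sum S(4))
    have far: "norm (x \<mu>) \<le> C * B / \<delta> * norm h * norm w" if "\<mu> \<in> ?far" for \<mu>
    proof -
      have "norm (of_real \<mu> *s x \<mu>) \<le> C * norm (\<Sum>\<mu>\<in>S. of_real \<mu> *s x \<mu>)"
        by (rule spectral_component_bound[OF C(2)[of "?e + h"] S(1), where x = "\<lambda>\<mu>. of_real \<mu> *s x \<mu>"])
           (use that in \<open>auto simp: mv_smult S(4)\<close>)
      also have "\<dots> \<le> C * (B * norm h * norm w)"
        unfolding Mw'[symmetric] Mw using B(2) C(1) by (intro mult_left_mono) auto
      finally have "\<bar>\<mu>\<bar> * norm (x \<mu>) \<le> C * B * norm h * norm w" by (simp add: norm_smult)
      moreover have "\<delta> * norm (x \<mu>) \<le> \<bar>\<mu>\<bar> * norm (x \<mu>)"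
        using that by (intro mult_right_mono) auto
      ultimately show ?thesis using \<delta>(1) by (simp add: field_simps)
    qed
    have "w = w' + (\<Sum>\<mu>\<in>?far. x \<mu>)"
      unfolding S(3) w'_def using S(1) by (subst sum.union_disjoint[symmetric]) (auto intro: sum.cong)
    then have "norm (w - w') = norm (\<Sum>\<mu>\<in>?far. x \<mu>)" by simp
    also have "\<dots> \<le> (\<Sum>\<mu>\<in>?far. C * B / \<delta> * norm h * norm w)"
      by (rule sum_norm_le) (rule far)
    also have "\<dots> = real (card ?far) * (C * B / \<delta> * norm h * norm w)" by simp
    also have "\<dots> \<le> real CARD('k) * (C * B / \<delta> * norm h * norm w)"
    proof (rule mult_right_mono)
      have "card ?far \<le> card S" using S(1) by (intro card_mono) auto
      then show "real (card ?far) \<le> real CARD('k)" using S(2) by linarith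
      show "0 \<le> C * B / \<delta> * norm h * norm w" using C(1) B(1) \<delta>(1) by simp
    qed
    finally have "norm (w - w') \<le> ?K * norm h * norm w" by (simp add: mult_ac)
    moreover have "?M *v w' = of_real (- \<tau> (?e + h)) *s w'"
      unfolding w'_def mv_sum vec.scale_sum_right
    proof (rule sum.cong[OF refl])
      fix \<mu> assume "\<mu> \<in> ?near"
      then have "complex_of_real \<mu> = of_real (- \<tau> (?e + h))" using near[of \<mu>] by simp
      then show "?M *v x \<mu> = of_real (- \<tau> (?e + h)) *s x \<mu>" by (simp only: S(4))
    qed
    ultimately show "\<exists>w'. ?M *v w' = of_real (- \<tau> (?e + h)) *s w' \<and> norm (w - w') \<le> ?K * norm h * norm w"
      by blast
  qed
qed


text \<open>Projecting \<open>symb A (axis i1 1 + h) w' = - \<tau> w'\<close> onto the kernel of \<open>A i1\<close> gives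
  \<open>P (symb A h w') = - \<tau> P w'\<close>.  Here \<open>w'\<close> is \<open>w\<close> up to an error of order \<open>h\<close>, and both \<open>\<tau>\<close> and
  \<open>symb A h\<close> are of order \<open>h\<close>; so \<open>w'\<close> may be replaced by \<open>w\<close> up to a quadratic error.\<close>
lemma projected_symbol_quadratic:
  fixes A :: "'d::finite \<Rightarrow> complex ^ 'k ^ 'k"
  assumes sh: "strongly_hyperbolic A" and det0: "det (A i1) = 0" and sv: "smooth_variety A i1 \<tau>"
  obtains \<delta> K where "\<delta> > 0" "K > 0"
    "\<And>h w. norm h < \<delta> \<Longrightarrow> A i1 *v w = 0 \<Longrightarrow>
       norm (of_real (- \<tau> (axis i1 1 + h)) *s w - ker_proj (A i1) *v (symb A h *v w)) \<le> K * (norm h)\<^sup>2 * norm w"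
proof -
  let ?e = "axis i1 1 :: real ^ 'd" and ?P = "ker_proj (A i1)"
  let ?l = "\<lambda>h. - \<tau> (?e + h)"
  obtain C0 where "\<And>\<xi>. bounded_group C0 (symb A \<xi>)"
    by (rule strongly_hyperbolic_bounded_group[OF sh]) blast
  then have "bounded_group C0 (A i1)" by (metis symb_axis)
  then have ss: "\<And>v. A i1 *v (A i1 *v v) = 0 \<Longrightarrow> A i1 *v v = 0" by (rule bounded_group_ker_sq)
  obtain B where B: "B > 0" "\<And>h w. norm (symb A h *v w) \<le> B * norm h * norm w"
    by (rule symb_bound[of A]) blast
  obtain D where D: "D > 0" "\<And>v. norm (?P *v v) \<le> norm v * D"
    using bounded_linear.pos_bounded[OF bounded_linear_mv[of ?P]] by blast
  obtain \<delta> C where \<delta>: "\<delta> > 0" "C > 0"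
    "\<And>h w. norm h < \<delta> \<Longrightarrow> A i1 *v w = 0 \<Longrightarrow>
       \<exists>w'. symb A (?e + h) *v w' = of_real (?l h) *s w' \<and> norm (w - w') \<le> C * norm h * norm w"
    by (rule kernel_perturbation[OF sh sv]) blast
  define \<delta>' where "\<delta>' = min \<delta> (min (1 / C) (1 / (2 * C * D)))"
  have \<delta>': "\<delta>' > 0" using \<delta>(1,2) D(1) by (simp add: \<delta>'_def)
  have main: "\<exists>w'. norm (w - w') \<le> C * norm h * norm w \<and> norm w' \<le> 2 * norm w \<and>
      norm w / 2 \<le> norm (?P *v w') \<and> ?P *v (symb A h *v w') = of_real (?l h) *s (?P *v w')"
    if h: "norm h < \<delta>'" and w: "A i1 *v w = 0" for h w
  proof -
    have hs: "norm h < \<delta>" "C * norm h \<le> 1" "C * norm h * D \<le> 1 / 2"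
      using h \<delta>(2) D(1) by (auto simp: \<delta>'_def field_simps)
    obtain w' where w': "symb A (?e + h) *v w' = of_real (?l h) *s w'" "norm (w - w') \<le> C * norm h * norm w"
      using \<delta>(3)[OF hs(1) w] by blast
    have "norm (w - w') \<le> 1 * norm w" using hs(2) by (intro order_trans[OF w'(2)] mult_right_mono) auto
    then have n2: "norm w' \<le> 2 * norm w" using norm_triangle_ineq2[of w' w] by (simp add: norm_minus_commute)
    have Pd: "?P *v (w - w') = w - ?P *v w'"
      by (simp add: matrix_vector_mult_diff_distrib ker_proj_ker[OF ss w])
    have "norm (w - ?P *v w') \<le> norm (w - w') * D" using D(2)[of "w - w'"] Pd by simp
    also have "\<dots> \<le> (C * norm h * norm w) * D" using w'(2) D(1) by (intro mult_right_mono) auto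
    also have "\<dots> = (C * norm h * D) * norm w" by simp
    also have "\<dots> \<le> 1 / 2 * norm w" using hs(3) by (rule mult_right_mono) simp
    finally have n3: "norm w / 2 \<le> norm (?P *v w')" using norm_triangle_ineq2[of w "?P *v w'"] by simp
    have "?P *v (symb A (?e + h) *v w') = ?P *v (symb A h *v w')"
      by (simp add: symb_add symb_axis matrix_vector_mult_add_rdistrib matrix_vector_right_distrib
          ker_proj_range[OF ss])
    then have "?P *v (symb A h *v w') = of_real (?l h) *s (?P *v w')"
      unfolding w'(1) mv_smult by simp
    with w'(2) n2 n3 show ?thesis by blast
  qed
  have lbound: "\<bar>?l h\<bar> \<le> 4 * B * D * norm h" if h: "norm h < \<delta>'" for h
  proof -
    obtain w where w: "w \<noteq> 0" "A i1 *v w = 0" using det0 det_zero_iff_kernel by blast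
    obtain w' where w': "norm w' \<le> 2 * norm w" "norm w / 2 \<le> norm (?P *v w')"
      "?P *v (symb A h *v w') = of_real (?l h) *s (?P *v w')"
      using main[OF h w(2)] by blast
    have "\<bar>?l h\<bar> * (norm w / 2) \<le> \<bar>?l h\<bar> * norm (?P *v w')" using w'(2) by (rule mult_left_mono) simp
    also have "\<dots> = norm (?P *v (symb A h *v w'))" unfolding w'(3) norm_smult by simp
    also have "\<dots> \<le> norm (symb A h *v w') * D" by (rule D(2))
    also have "\<dots> \<le> (B * norm h * norm w') * D" using B(2) D(1) by (intro mult_right_mono) auto
    also have "\<dots> \<le> (B * norm h * (2 * norm w)) * D"
      using w'(1) B(1) D(1) by (intro mult_right_mono mult_left_mono) auto
    finally have "\<bar>?l h\<bar> * norm w \<le> (4 * B * D * norm h) * norm w" by (simp add: algebra_simps)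
    then show ?thesis using w(1) by simp
  qed
  show ?thesis
  proof
    show "\<delta>' > 0" by fact
    show "4 * B * D * D * C + B * C * D > 0" using B(1) D(1) \<delta>(2) by (simp add: add_pos_pos)
    fix h :: "real ^ 'd" and w :: "complex ^ 'k"
    assume h: "norm h < \<delta>'" and w: "A i1 *v w = 0"
    obtain w' where w': "norm (w - w') \<le> C * norm h * norm w"
      "?P *v (symb A h *v w') = of_real (?l h) *s (?P *v w')"
      using main[OF h w] by blast
    have Pd: "?P *v (w - w') = w - ?P *v w'"
      by (simp add: matrix_vector_mult_diff_distrib ker_proj_ker[OF ss w])
    have eq: "of_real (?l h) *s w - ?P *v (symb A h *v w)
        = of_real (?l h) *s (?P *v (w - w')) - ?P *v (symb A h *v (w - w'))"
      unfolding Pd unfolding matrix_vector_mult_diff_distrib w'(2) vec.scale_right_diff_distrib by simp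
    have "norm (of_real (?l h) *s w - ?P *v (symb A h *v w))
        \<le> norm (of_real (?l h) *s (?P *v (w - w'))) + norm (?P *v (symb A h *v (w - w')))"
      unfolding eq by (rule norm_triangle_ineq4)
    also have "norm (of_real (?l h) *s (?P *v (w - w'))) \<le> (4 * B * D * norm h) * (C * norm h * norm w * D)"
      unfolding norm_smult norm_of_real
      using w'(1) D(1) B(1) by (intro mult_mono lbound[OF h] order_trans[OF D(2)] mult_right_mono) auto
    also have "norm (?P *v (symb A h *v (w - w'))) \<le> (B * norm h * (C * norm h * norm w)) * D"
    proof (rule order_trans[OF D(2)], rule mult_right_mono)
      show "norm (symb A h *v (w - w')) \<le> B * norm h * (C * norm h * norm w)"
        using w'(1) B(1) by (intro order_trans[OF B(2)] mult_left_mono) auto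
    qed (use D(1) in simp)
    finally show "norm (of_real (?l h) *s w - ?P *v (symb A h *v w))
        \<le> (4 * B * D * D * C + B * C * D) * (norm h)\<^sup>2 * norm w"
      by (simp add: algebra_simps power2_eq_square)
  qed
qed

text \<open>The quadratic estimate for a single unit vector \<open>w0\<close> of the kernel exhibits the derivative of \<open>- \<tau>\<close> as
  the linear functional \<open>l\<close>; the estimate for an arbitrary \<open>w\<close>, divided by the length of \<open>h\<close>, then compares
  \<open>P (A j w)\<close> with \<open>l (axis j 1) w\<close>.\<close>
lemma projected_symbol_group_velocity:
  fixes A :: "'d::finite \<Rightarrow> complex ^ 'k ^ 'k"
  assumes sh: "strongly_hyperbolic A" and det0: "det (A i1) = 0" and sv: "smooth_variety A i1 \<tau>"
    and w: "A i1 *v w = 0"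
  shows "ker_proj (A i1) *v (A j *v w) = (group_velocity i1 \<tau> $ j) *\<^sub>R w"
proof -
  let ?e = "axis i1 1 :: real ^ 'd" and ?P = "ker_proj (A i1)"
  obtain \<delta> K where K: "\<delta> > 0" "K > 0"
    "\<And>h w. norm h < \<delta> \<Longrightarrow> A i1 *v w = 0 \<Longrightarrow>
       norm (of_real (- \<tau> (?e + h)) *s w - ?P *v (symb A h *v w)) \<le> K * (norm h)\<^sup>2 * norm w"
    by (rule projected_symbol_quadratic[OF assms(1-3)]) blast
  obtain w1 where w1: "w1 \<noteq> 0" "A i1 *v w1 = 0" using det0 det_zero_iff_kernel by blast
  define w0 where "w0 = (1 / norm w1) *\<^sub>R w1"
  have w0: "norm w0 = 1" "A i1 *v w0 = 0" using w1 by (simp_all add: w0_def mv_scaleR2)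
  define l where "l h = inner w0 (?P *v (symb A h *v w0))" for h
  have llin: "linear l"
    by (rule linearI)
       (simp_all add: l_def symb_add symb_scaleR mv_scaleR mv_scaleR2 matrix_vector_mult_add_rdistrib
          matrix_vector_right_distrib inner_add_right)
  have lq: "\<bar>- \<tau> (?e + h) - l h\<bar> \<le> K * (norm h)\<^sup>2" if "norm h < \<delta>" for h
  proof -
    have "- \<tau> (?e + h) - l h = inner w0 (of_real (- \<tau> (?e + h)) *s w0 - ?P *v (symb A h *v w0))"
      using w0(1) by (simp add: l_def inner_diff_right scaleR_smult[symmetric] norm_eq_1 del: of_real_minus)
    also have "\<bar>\<dots>\<bar> \<le> norm w0 * norm (of_real (- \<tau> (?e + h)) *s w0 - ?P *v (symb A h *v w0))"
      by (rule Cauchy_Schwarz_ineq2)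
    also have "\<dots> \<le> K * (norm h)\<^sup>2" using K(3)[OF that w0(2)] w0(1) by simp
    finally show ?thesis .
  qed
  have "\<tau> ?e = 0" using sv by (simp add: smooth_variety_def)
  have "(\<tau> has_derivative (\<lambda>h. - l h)) (at ?e)"
    unfolding has_derivative_at
  proof
    show "bounded_linear (\<lambda>h. - l h)"
      using llin by (intro bounded_linear_minus) (simp add: linear_conv_bounded_linear)
    show "(\<lambda>h. norm (\<tau> (?e + h) - \<tau> ?e - - l h) / norm h) \<midarrow>0\<rightarrow> 0"
    proof (rule Lim_null_comparison)
      have "\<forall>\<^sub>F h :: real ^ 'd in at 0. norm h < \<delta>"
        using eventually_at_ball[OF K(1), of "0 :: real ^ 'd" UNIV] by (simp add: dist_norm)
      then show "\<forall>\<^sub>F h in at 0. norm (norm (\<tau> (?e + h) - \<tau> ?e - - l h) / norm h) \<le> K * norm h"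
      proof eventually_elim
        case (elim h)
        have "\<bar>\<tau> (?e + h) + l h\<bar> \<le> K * (norm h)\<^sup>2" using lq[OF elim] by (simp add: abs_minus_commute)
        then show ?case using \<open>\<tau> ?e = 0\<close> K(2)
          by (cases "h = 0") (simp_all add: field_simps power2_eq_square)
      qed
      show "(\<lambda>h. K * norm h) \<midarrow>0\<rightarrow> 0" by (auto intro!: tendsto_eq_intros)
    qed
  qed
  then have "frechet_derivative \<tau> (at ?e) = (\<lambda>h. - l h)" by (rule frechet_derivative_at[symmetric])
  then have gv: "group_velocity i1 \<tau> $ j = l (axis j 1)" by (simp add: group_velocity_def)
  let ?h = "axis j 1 :: real ^ 'd"
  define d where "d = l ?h *\<^sub>R w - ?P *v (A j *v w)"
  have small: "norm d \<le> s * (2 * K * norm w)" if s: "s > 0" "s < \<delta>" for s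
  proof -
    have n: "norm (s *\<^sub>R ?h) = s" using s by simp
    have "s *\<^sub>R d = (of_real (- \<tau> (?e + s *\<^sub>R ?h)) *s w - ?P *v (symb A (s *\<^sub>R ?h) *v w))
        - (- \<tau> (?e + s *\<^sub>R ?h) - l (s *\<^sub>R ?h)) *\<^sub>R w"
      unfolding scaleR_smult[symmetric] d_def linear_cmul[OF llin] symb_scaleR symb_axis mv_scaleR mv_scaleR2
      by (simp add: algebra_simps)
    then have "norm (s *\<^sub>R d) \<le> norm (of_real (- \<tau> (?e + s *\<^sub>R ?h)) *s w - ?P *v (symb A (s *\<^sub>R ?h) *v w))
        + norm ((- \<tau> (?e + s *\<^sub>R ?h) - l (s *\<^sub>R ?h)) *\<^sub>R w)"
      by (simp only: norm_triangle_ineq4)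
    also have "\<dots> \<le> K * s\<^sup>2 * norm w + K * s\<^sup>2 * norm w"
    proof (rule add_mono)
      have hs: "norm (s *\<^sub>R ?h) < \<delta>" unfolding n by (rule s(2))
      show "norm (of_real (- \<tau> (?e + s *\<^sub>R ?h)) *s w - ?P *v (symb A (s *\<^sub>R ?h) *v w)) \<le> K * s\<^sup>2 * norm w"
        using K(3)[OF hs w] unfolding n .
      show "norm ((- \<tau> (?e + s *\<^sub>R ?h) - l (s *\<^sub>R ?h)) *\<^sub>R w) \<le> K * s\<^sup>2 * norm w"
        unfolding norm_scaleR real_norm_def using lq[OF hs] unfolding n by (rule mult_right_mono) simp
    qed
    finally have "s * norm d \<le> s * (s * (2 * K * norm w))" using s(1) by (simp add: power2_eq_square algebra_simps)
    then show ?thesis using s(1) by simp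
  qed
  have "norm d \<le> 0"
  proof (rule tendsto_lowerbound)
    show "((\<lambda>s. s * (2 * K * norm w)) \<longlongrightarrow> 0) (at_right 0)" by (auto intro!: tendsto_eq_intros)
    show "\<forall>\<^sub>F s in at_right 0. norm d \<le> s * (2 * K * norm w)"
      using eventually_at_right_less[of "0::real"] order_tendstoD(2)[OF tendsto_ident_at K(1), of "{0<..}"]
      by eventually_elim (use small in auto)
  qed simp
  then show ?thesis by (simp add: d_def gv)
qed

section \<open>Smooth functions and a bump\<close>
lemma Ck_on_const: "Ck_on n S (\<lambda>_. c)"
proof (induction n arbitrary: c)
  case (Suc n)
  then show ?case by (auto intro!: exI[of _ "\<lambda>_ _. 0"])
qed simp

lemma Ck_on_continuous: "Ck_on n S f \<Longrightarrow> continuous_on S f"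
  by (cases n) (auto intro: has_derivative_continuous_on)

lemma Ck_on_SucD: "Ck_on (Suc n) S f \<Longrightarrow> Ck_on n S f"
proof (induction n arbitrary: f)
  case 0
  show ?case using Ck_on_continuous[OF 0] by simp
next
  case (Suc n)
  then obtain f' where "\<forall>x\<in>S. (f has_derivative f' x) (at x within S)" "\<And>v. Ck_on (Suc n) S (\<lambda>x. f' x v)"
    by auto
  with Suc.IH show ?case unfolding Ck_on.simps(2)[of n] by blast
qed

lemma Ck_on_add:
  "Ck_on n S f \<Longrightarrow> Ck_on n S g \<Longrightarrow> Ck_on n S (\<lambda>x. f x + g x)"
proof (induction n arbitrary: f g)
  case (Suc n)
  from Suc.prems obtain f' g' where
    "\<forall>x\<in>S. (f has_derivative f' x) (at x within S)" "\<And>v. Ck_on n S (\<lambda>x. f' x v)"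
    "\<forall>x\<in>S. (g has_derivative g' x) (at x within S)" "\<And>v. Ck_on n S (\<lambda>x. g' x v)"
    by auto
  then show ?case using Suc.IH
    by (auto intro!: exI[of _ "\<lambda>x v. f' x v + g' x v"] has_derivative_add)
qed (simp add: continuous_on_add)

lemma Ck_on_mult:
  fixes f g :: "'a::euclidean_space \<Rightarrow> real"
  shows "Ck_on n S f \<Longrightarrow> Ck_on n S g \<Longrightarrow> Ck_on n S (\<lambda>x. f x * g x)"
proof (induction n arbitrary: f g)
  case (Suc n)
  from Suc.prems obtain f' g' where
    fg: "\<forall>x\<in>S. (f has_derivative f' x) (at x within S)" "\<And>v. Ck_on n S (\<lambda>x. f' x v)"
    "\<forall>x\<in>S. (g has_derivative g' x) (at x within S)" "\<And>v. Ck_on n S (\<lambda>x. g' x v)"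
    by auto
  note low = Suc.prems[THEN Ck_on_SucD]
  have "Ck_on n S (\<lambda>x. f x * g' x v + f' x v * g x)" for v
    by (intro Ck_on_add Suc.IH low fg)
  then show ?case using fg
    by (auto intro!: exI[of _ "\<lambda>x v. f x * g' x v + f' x v * g x"] has_derivative_mult)
qed (simp add: continuous_on_mult)

lemma Ck_on_prod:
  fixes f :: "'i \<Rightarrow> 'a::euclidean_space \<Rightarrow> real"
  assumes "\<And>i. i \<in> I \<Longrightarrow> Ck_on n S (f i)"
  shows "Ck_on n S (\<lambda>x. \<Prod>i\<in>I. f i x)"
  using assms
proof (induction I rule: infinite_finite_induct)
  case (insert i I)
  then have "Ck_on n S (\<lambda>x. f i x * (\<Prod>i\<in>I. f i x))" by (intro Ck_on_mult) auto
  then show ?case using insert by simp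
qed (simp_all add: Ck_on_const)

lemma Ck_on_affine:
  assumes l: "bounded_linear l"
  shows "Ck_on n UNIV f \<Longrightarrow> Ck_on n UNIV (\<lambda>x. f (l x + c))"
proof (induction n arbitrary: f)
  case 0
  have "continuous_on UNIV (\<lambda>x. l x + c)"
    using l by (intro continuous_intros linear_continuous_on) auto
  then show ?case using 0 by (auto intro: continuous_on_compose2)
next
  case (Suc n)
  then obtain f' where f': "\<And>x. (f has_derivative f' x) (at x)" "\<And>v. Ck_on n UNIV (\<lambda>x. f' x v)"
    by auto
  have "((\<lambda>x. f (l x + c)) has_derivative (\<lambda>v. f' (l x + c) (l v))) (at x)" for x
  proof -
    have "((\<lambda>x. l x + c) has_derivative l) (at x)"
      using bounded_linear_imp_has_derivative[OF l, of "at x"] by (auto intro: has_derivative_add_const)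
    from has_derivative_compose[OF this f'(1)] show ?thesis .
  qed
  moreover have "Ck_on n UNIV (\<lambda>x. f' (l x + c) (l v))" for v
    by (rule Suc.IH[OF f'(2)])
  ultimately show ?case
    unfolding Ck_on.simps by (intro exI[of _ "\<lambda>x v. f' (l x + c) (l v)"]) blast
qed

text \<open>This class of functions contains \<open>exp (- 1 / s)\<close>, extended by zero, and is closed under
  differentiation; smoothness is therefore an induction inside the class.\<close>
definition flat :: "real poly \<Rightarrow> real \<Rightarrow> real" where
  "flat p s = (if s > 0 then poly p (1 / s) * exp (- (1 / s)) else 0)"

lemma poly_times_exp_minus_tendsto_0: "((\<lambda>x::real. poly p x * exp (- x)) \<longlongrightarrow> 0) at_top"
proof -
  have "((\<lambda>x::real. \<Sum>i\<le>degree p. coeff p i * (x ^ i / exp x)) \<longlongrightarrow> (\<Sum>i\<le>degree p. coeff p i * 0)) at_top"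
    by (intro tendsto_sum tendsto_mult tendsto_const tendsto_power_div_exp_0)
  then show ?thesis
    by (simp add: poly_altdef sum_distrib_right exp_minus divide_inverse mult.assoc)
qed

lemma flat_has_derivative:
  "(flat p has_real_derivative flat (monom 1 2 * (p - pderiv p)) s) (at s)"
proof -
  consider "s > 0" | "s < 0" | "s = 0" by linarith
  then show ?thesis
  proof cases
    case 1
    have i: "((\<lambda>s. 1 / s) has_real_derivative - ((1 / s)\<^sup>2)) (at s)"
      using 1 by (auto intro!: derivative_eq_intros simp: power2_eq_square)
    have "flat (monom 1 2 * (p - pderiv p)) s = poly (pderiv p) (1 / s) * - ((1 / s)\<^sup>2) * exp (- (1 / s))
        + exp (- (1 / s)) * - (- ((1 / s)\<^sup>2)) * poly p (1 / s)"
      using 1 by (simp only: flat_def poly_mult poly_monom poly_diff if_True) (simp add: algebra_simps)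
    then have der: "((\<lambda>s. poly p (1 / s) * exp (- (1 / s))) has_real_derivative
        flat (monom 1 2 * (p - pderiv p)) s) (at s)"
      using DERIV_mult[OF DERIV_chain2[OF poly_DERIV i] DERIV_chain2[OF DERIV_exp DERIV_minus[OF i]], of p]
      by simp
    have "\<forall>\<^sub>F x in nhds s. poly p (1 / x) * exp (- (1 / x)) = flat p x"
      using order_tendstoD(1)[OF filterlim_ident 1] by eventually_elim (auto simp: flat_def)
    from DERIV_cong_ev[OF refl this refl] show ?thesis using der by (simp only:)
  next
    case 2
    have "\<forall>\<^sub>F x in nhds s. 0 = flat p x"
      using order_tendstoD(2)[OF filterlim_ident 2] by eventually_elim (auto simp: flat_def)
    then have "(flat p has_real_derivative 0) (at s)"
      by (rule DERIV_cong_ev[OF refl _ refl, THEN iffD1]) simp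
    then show ?thesis using 2 by (simp add: flat_def[of "_ * _"])
  next
    case 3
    have "((\<lambda>h. flat p h / h) \<longlongrightarrow> 0) (at 0)"
    proof (rule filterlim_split_at)
      have "((\<lambda>h. poly (pCons 0 p) (inverse h) * exp (- inverse h)) \<longlongrightarrow> 0) (at_right 0)"
        by (rule filterlim_compose[OF poly_times_exp_minus_tendsto_0 filterlim_inverse_at_top_right])
      moreover have "\<forall>\<^sub>F h in at_right 0. poly (pCons 0 p) (inverse h) * exp (- inverse h) = flat p h / h"
        using eventually_at_right_less[of "0::real"] by eventually_elim (simp add: flat_def divide_inverse)
      ultimately show "((\<lambda>h. flat p h / h) \<longlongrightarrow> 0) (at_right 0)"
        by (rule Lim_transform_eventually)
      have "\<forall>\<^sub>F h in at_left (0::real). h < 0"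
        by (simp add: eventually_at_filter)
      then have "\<forall>\<^sub>F h in at_left 0. flat p h / h = 0"
        by eventually_elim (simp add: flat_def)
      then show "((\<lambda>h. flat p h / h) \<longlongrightarrow> 0) (at_left 0)" by (rule tendsto_eventually)
    qed
    then show ?thesis using 3 by (simp add: DERIV_def flat_def)
  qed
qed

lemma Ck_on_flat: "Ck_on n UNIV (flat p)"
proof (induction n arbitrary: p)
  case 0
  show ?case
    by (auto intro!: continuous_at_imp_continuous_on DERIV_isCont[OF flat_has_derivative])
next
  case (Suc n)
  have "(flat p has_derivative (\<lambda>v. flat (smult v (monom 1 2 * (p - pderiv p))) s)) (at s)" for s
  proof -
    have "(flat p has_derivative (*) (flat (monom 1 2 * (p - pderiv p)) s)) (at s)"
      using flat_has_derivative unfolding has_field_derivative_def .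
    also have "(*) (flat (monom 1 2 * (p - pderiv p)) s) = (\<lambda>v. flat (smult v (monom 1 2 * (p - pderiv p))) s)"
      by (auto simp: flat_def)
    finally show ?thesis .
  qed
  then show ?case
    unfolding Ck_on.simps using Suc
    by (intro exI[of _ "\<lambda>s v. flat (smult v (monom 1 2 * (p - pderiv p))) s"]) blast
qed

definition bump1 :: "real \<Rightarrow> real" where
  "bump1 s = flat 1 (1 + s) * flat 1 (1 - s)"

lemma Ck_on_bump1: "Ck_on n UNIV bump1"
proof -
  have "Ck_on n UNIV (\<lambda>s. flat 1 (s + 1))" "Ck_on n UNIV (\<lambda>s. flat 1 (- s + 1))"
    by (rule Ck_on_affine[OF _ Ck_on_flat], simp add: bounded_linear_ident bounded_linear_minus)+
  from Ck_on_mult[OF this] show ?thesis by (simp add: bump1_def[abs_def] add.commute)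
qed

lemma bump1_nonneg: "bump1 s \<ge> 0" by (simp add: bump1_def flat_def)

lemma bump1_pos: "\<bar>s\<bar> < 1 \<Longrightarrow> bump1 s > 0" by (auto simp: bump1_def flat_def)

lemma bump1_support: "bump1 s \<noteq> 0 \<Longrightarrow> \<bar>s\<bar> < 1"
  by (auto simp: bump1_def flat_def split: if_splits)

text \<open>The signs make the integral of the normal derivative of the bump over a half space nonzero in
  \<open>jump_relation\<close>.\<close>
lemma bump1_increasing:
  obtains b' where "(bump1 has_real_derivative b') (at s)" "s \<le> 0 \<Longrightarrow> b' \<ge> 0" "- 1 < s \<Longrightarrow> s < 0 \<Longrightarrow> b' > 0"
proof -
  let ?q = "monom 1 2 * (1 - pderiv 1) :: real poly"
  let ?b = "flat ?q (1 + s) * flat 1 (1 - s) - flat 1 (1 + s) * flat ?q (1 - s)"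
  have "(bump1 has_real_derivative ?b) (at s)"
    unfolding bump1_def[abs_def]
    by (auto intro!: derivative_eq_intros DERIV_chain2[OF flat_has_derivative])
  moreover have b: "?b = exp (- (1 / (1 + s))) * exp (- (1 / (1 - s))) * ((1 / (1 + s))\<^sup>2 - (1 / (1 - s))\<^sup>2)"
    if "-1 < s" "s \<le> 0"
    using that by (simp add: flat_def poly_monom algebra_simps)
  moreover have "?b > 0" if "-1 < s" "s < 0"
  proof -
    have "(1 / (1 - s))\<^sup>2 < (1 / (1 + s))\<^sup>2"
      using that by (intro power_strict_mono) (auto simp: field_simps)
    then show ?thesis unfolding b[OF that(1) less_imp_le[OF that(2)]] by simp
  qed
  moreover have "?b \<ge> 0" if "s \<le> 0"
  proof (cases "-1 < s")
    case True
    have "(1 / (1 - s))\<^sup>2 \<le> (1 / (1 + s))\<^sup>2"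
      using that True by (intro power_mono) (auto simp: field_simps)
    then show ?thesis unfolding b[OF True that] by simp
  qed (simp add: flat_def)
  ultimately show ?thesis using that by blast
qed

definition bump :: "real \<times> (real ^ 'd::finite) \<Rightarrow> real" where
  "bump p = bump1 (fst p) * (\<Prod>j\<in>UNIV. bump1 (snd p $ j))"

lemma Ck_on_bump: "Ck_on n UNIV bump"
proof -
  have c: "bounded_linear (\<lambda>p::real \<times> (real ^ 'd). snd p $ j)" for j
    by (intro bounded_linear_compose[OF bounded_linear_vec_nth] bounded_linear_snd)
  have "Ck_on n UNIV (\<lambda>p::real \<times> (real ^ 'd). bump1 (snd p $ j))" for j
    using Ck_on_affine[OF c Ck_on_bump1, where c = 0] by simp
  moreover have "Ck_on n UNIV (\<lambda>p::real \<times> (real ^ 'd). bump1 (fst p))"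
    using Ck_on_affine[OF bounded_linear_fst Ck_on_bump1, where c = 0] by simp
  ultimately show ?thesis unfolding bump_def[abs_def] by (intro Ck_on_mult Ck_on_prod)
qed

lemma bump_nonneg: "bump p \<ge> 0"
  by (simp add: bump_def bump1_nonneg prod_nonneg)

lemma bump_0: "bump 0 > 0"
  by (simp add: bump_def bump1_pos prod_pos)

lemma bump_support:
  fixes p :: "real \<times> (real ^ 'd::finite)"
  assumes "bump p \<noteq> 0" shows "norm p \<le> 1 + real CARD('d)"
proof -
  have f: "\<bar>fst p\<bar> < 1" and s: "\<And>j. \<bar>snd p $ j\<bar> < 1"
    using assms bump1_support by (auto simp: bump_def)
  have "norm (snd p) \<le> (\<Sum>j\<in>UNIV. \<bar>snd p $ j\<bar>)" by (rule norm_le_l1_cart)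
  also have "\<dots> \<le> (\<Sum>j\<in>(UNIV :: 'd set). 1)" using s by (intro sum_mono less_imp_le)
  finally have "norm (snd p) \<le> real CARD('d)" by simp
  then show ?thesis using f norm_Pair_le[of "fst p" "snd p"] by simp
qed

lemma bump_increasing:
  fixes D :: "real \<times> (real ^ 'd::finite) \<Rightarrow> real" and i :: 'd
  assumes D: "(bump has_derivative D) (at p)"
  shows "snd p $ i \<le> 0 \<Longrightarrow> D (0, axis i 1) \<ge> 0"
    and "p = (0, axis i (- 1 / 2)) \<Longrightarrow> D (0, axis i 1) > 0"
proof -
  let ?r = "bump1 (fst p) * (\<Prod>j\<in>UNIV - {i}. bump1 (snd p $ j))"
  obtain b' where b': "(bump1 has_real_derivative b') (at (snd p $ i))" "snd p $ i \<le> 0 \<Longrightarrow> b' \<ge> 0"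
    "- 1 < snd p $ i \<Longrightarrow> snd p $ i < 0 \<Longrightarrow> b' > 0"
    by (rule bump1_increasing[of "snd p $ i"]) blast
  have "bump (p + s *\<^sub>R (0, axis i 1)) = ?r * bump1 (snd p $ i + s)" for s
  proof -
    have "(\<Prod>j\<in>UNIV. bump1 (snd (p + s *\<^sub>R (0, axis i 1)) $ j))
        = bump1 (snd p $ i + s) * (\<Prod>j\<in>UNIV - {i}. bump1 (snd p $ j))"
      by (subst prod.remove[of _ i]) (auto simp: axis_def intro!: prod.cong)
    then show ?thesis by (simp add: bump_def)
  qed
  moreover have "((\<lambda>s. ?r * bump1 (snd p $ i + s)) has_real_derivative ?r * b') (at 0)"
    using b'(1) by (auto intro!: derivative_eq_intros DERIV_chain2[of bump1])
  ultimately have "((\<lambda>s. bump (p + s *\<^sub>R (0, axis i 1))) has_real_derivative ?r * b') (at 0)" by simp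
  moreover have "((\<lambda>s. bump (p + s *\<^sub>R (0, axis i 1))) has_vector_derivative D (0, axis i 1)) (at 0)"
  proof -
    have "((\<lambda>s. p + s *\<^sub>R (0, axis i 1)) has_derivative (\<lambda>s. s *\<^sub>R (0, axis i 1))) (at 0)"
      by (auto intro!: derivative_eq_intros)
    moreover have "(bump has_derivative D) (at (p + 0 *\<^sub>R (0, axis i 1)))"
      using D by (simp only: scaleR_zero_left add_0_right)
    ultimately have "((\<lambda>s. bump (p + s *\<^sub>R (0, axis i 1))) has_derivative (\<lambda>s. D (s *\<^sub>R (0, axis i 1)))) (at 0)"
      by (rule has_derivative_compose)
    then show ?thesis
      unfolding has_vector_derivative_def linear_cmul[OF has_derivative_linear[OF D]] .
  qed
  ultimately have e: "D (0, axis i 1) = ?r * b'"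
    using DERIV_unique by (auto simp: has_real_derivative_iff_has_vector_derivative[symmetric])
  have r0: "?r \<ge> 0" by (simp add: bump1_nonneg prod_nonneg)
  show "snd p $ i \<le> 0 \<Longrightarrow> D (0, axis i 1) \<ge> 0" unfolding e using r0 b'(2) by simp
  show "p = (0, axis i (- 1 / 2)) \<Longrightarrow> D (0, axis i 1) > 0"
    unfolding e using b'(3)
    by (intro mult_pos_pos prod_pos) (auto simp: axis_def intro!: bump1_pos)
qed

section \<open>Integration by parts by translation\<close>
lemma dir_deriv_eq:
  assumes D: "(h has_derivative D) (at p)"
  shows "dir_deriv e h p = D e"
proof -
  have "((\<lambda>s. p + s *\<^sub>R e) has_derivative (\<lambda>s. s *\<^sub>R e)) (at 0)"
    by (auto intro!: derivative_eq_intros)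
  moreover have "(h has_derivative D) (at (p + 0 *\<^sub>R e))" using D by simp
  ultimately have "((\<lambda>s. h (p + s *\<^sub>R e)) has_derivative (\<lambda>s. D (s *\<^sub>R e))) (at 0)"
    by (rule has_derivative_compose)
  then show ?thesis
    unfolding dir_deriv_def linear_cmul[OF has_derivative_linear[OF D]] has_vector_derivative_def[symmetric]
    by (rule vector_derivative_at)
qed

lemma integrable_bounded_support:
  fixes f :: "'a::euclidean_space \<Rightarrow> 'b::euclidean_space"
  assumes "f \<in> borel_measurable borel" "\<And>q. norm (f q) \<le> M * indicator (cball 0 R) q"
  shows "integrable lborel f"
proof (rule Bochner_Integration.integrable_bound)
  have "emeasure lborel (cball 0 R :: 'a set) < \<infinity>" by (rule emeasure_bounded_finite) simp
  then show "integrable lborel (\<lambda>q::'a. M * indicator (cball 0 R) q)"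
    by (intro integrable_mult_right integrable_real_indicator) auto
  show "AE q in lborel. norm (f q) \<le> norm (M * indicator (cball 0 R) q)"
    using assms(2) by (auto intro: order_trans[OF _ abs_ge_self])
qed (use assms(1) in simp)

lemma bounded_support_convergence:
  fixes X :: "nat \<Rightarrow> 'a::euclidean_space \<Rightarrow> 'b::euclidean_space"
  assumes "\<And>n. X n \<in> borel_measurable borel" "Y \<in> borel_measurable borel"
    and "\<And>n q. norm (X n q) \<le> M * indicator (cball 0 R) q"
    and "\<And>q. (\<lambda>n. X n q) \<longlonglongrightarrow> Y q"
  shows "(\<lambda>n. integral\<^sup>L lborel (X n)) \<longlonglongrightarrow> integral\<^sup>L lborel Y"
proof (rule integral_dominated_convergence)
  have "emeasure lborel (cball 0 R :: 'a set) < \<infinity>" by (rule emeasure_bounded_finite) simp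
  then show "integrable lborel (\<lambda>q::'a. M * indicator (cball 0 R) q)"
    by (intro integrable_mult_right integrable_real_indicator) auto
qed (use assms in auto)

text \<open>\<open>F\<close> is constant near \<open>q\<close>.\<close>
lemma derivative_outside_support:
  assumes F: "(F has_derivative D) (at q)" and supp: "\<And>q. norm q > R \<Longrightarrow> F q = 0" and q: "norm q > R"
  shows "D = (\<lambda>_. 0)"
proof -
  have op: "open {q. norm q > R}" by (rule open_Collect_less) (auto intro!: continuous_intros)
  have "((\<lambda>_. 0) has_derivative D) (at q)"
    by (rule has_derivative_transform_within_open[OF F op]) (use supp q in auto)
  then show ?thesis using has_derivative_unique has_derivative_const by blast
qed

lemma difference_quotient_tendsto:
  fixes f :: "real \<Rightarrow> 'b::real_normed_vector"
  assumes "(f has_vector_derivative D) (at 0)"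
  shows "((\<lambda>s. (f s - f 0) /\<^sub>R s) \<longlongrightarrow> D) (at 0)"
proof (rule Lim_transform2)
  have "(\<lambda>h. norm (f (0 + h) - f 0 - h *\<^sub>R D) / norm h) \<midarrow>0\<rightarrow> 0"
    using assms unfolding has_vector_derivative_def has_derivative_at by blast
  moreover have "norm (f (0 + h) - f 0 - h *\<^sub>R D) / norm h = norm ((f h - f 0) /\<^sub>R h - D)" if "h \<noteq> 0" for h
  proof -
    have "(f h - f 0) /\<^sub>R h - D = (f (0 + h) - f 0 - h *\<^sub>R D) /\<^sub>R h"
      using that by (simp add: scaleR_diff_right)
    then show ?thesis by (simp add: divide_inverse mult.commute)
  qed
  then have "\<forall>\<^sub>F h in at 0. norm (f (0 + h) - f 0 - h *\<^sub>R D) / norm h = norm ((f h - f 0) /\<^sub>R h - D)"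
    by (simp add: eventually_at_filter)
  ultimately have "(\<lambda>h. norm ((f h - f 0) /\<^sub>R h - D)) \<midarrow>0\<rightarrow> 0"
    by (rule Lim_transform_eventually)
  then have "(\<lambda>h. (f h - f 0) /\<^sub>R h - D) \<midarrow>0\<rightarrow> 0" by (rule tendsto_norm_zero_cancel)
  then show "(\<lambda>h. D - (f h - f 0) /\<^sub>R h) \<midarrow>0\<rightarrow> 0" using tendsto_minus by fastforce
qed simp

lemma integral_translation:
  fixes H :: "'a::euclidean_space \<Rightarrow> 'b::euclidean_space"
  assumes H: "H \<in> borel_measurable borel"
  shows "(\<integral>q. H (q + c) \<partial>lborel) = integral\<^sup>L lborel H"
proof -
  have "integral\<^sup>L lborel H = integral\<^sup>L (distr lborel borel ((+) c)) H"
    by (simp only: lborel_distr_plus)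
  also have "\<dots> = (\<integral>q. H (c + q) \<partial>lborel)" by (rule integral_distr) (use H in auto)
  finally show ?thesis by (simp add: add.commute)
qed

text \<open>Integration by parts without boundary terms: the integral of \<open>F\<close> over \<open>S\<close> does not change when
  \<open>F\<close> is translated along \<open>e\<close>; the derivative of this constant is the integral in question.\<close>
lemma integral_derivative_invariant_set:
  fixes F :: "'a::euclidean_space \<Rightarrow> 'b::euclidean_space"
  assumes F: "\<And>q. (F has_derivative F' q) (at q)" and cont: "continuous_on UNIV (\<lambda>q. F' q e)"
    and supp: "\<And>q. norm q > R \<Longrightarrow> F q = 0"
    and S: "S \<in> sets borel" and inv: "\<And>q s. q + s *\<^sub>R e \<in> S \<longleftrightarrow> q \<in> S"
  shows "integrable lborel (\<lambda>q. indicator S q *\<^sub>R F' q e)"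
    and "(\<integral>q. indicator S q *\<^sub>R F' q e \<partial>lborel) = 0"
proof -
  have F'0: "F' q e = 0" if "norm q > R" for q
    using derivative_outside_support[OF F supp that] by simp
  have cF: "continuous_on UNIV F"
    using F by (intro continuous_at_imp_continuous_on ballI has_derivative_continuous)
  have bd: "\<exists>M. 0 \<le> M \<and> (\<forall>q. norm (G q) \<le> M)"
    if "continuous_on UNIV G" "\<And>q. norm q > R \<Longrightarrow> G q = 0" for G :: "'a \<Rightarrow> 'b"
  proof -
    have "compact (G ` cball 0 R)"
      using that(1) by (intro compact_continuous_image) (auto intro: continuous_on_subset)
    then obtain M where M: "M > 0" "\<forall>x\<in>G ` cball 0 R. norm x \<le> M"
      using bounded_pos compact_imp_bounded by meson
    have "norm (G q) \<le> M" for q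
      using M that(2)[of q] by (cases "norm q > R") auto
    then show ?thesis using M(1) by (intro exI[of _ M]) auto
  qed
  obtain M where M: "0 \<le> M" "\<And>q. norm (F' q e) \<le> M" using bd[OF cont F'0] by blast
  obtain N where N: "0 \<le> N" "\<And>q. norm (F q) \<le> N" using bd[OF cF supp] by blast
  have mF: "F \<in> borel_measurable borel" using cF by (rule borel_measurable_continuous_onI)
  have mF': "(\<lambda>q. F' q e) \<in> borel_measurable borel" using cont by (rule borel_measurable_continuous_onI)
  have lip: "norm (F (q + s *\<^sub>R e) - F q) \<le> M * \<bar>s\<bar>" for q s
  proof -
    have "norm (F (q + s *\<^sub>R e) - F (q + 0 *\<^sub>R e)) \<le> M * norm (s - 0)"
    proof (rule differentiable_bound[of UNIV])
      fix r :: real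
      have "((\<lambda>s. q + s *\<^sub>R e) has_derivative (\<lambda>s. s *\<^sub>R e)) (at r)"
        by (auto intro!: derivative_eq_intros)
      from has_derivative_compose[OF this F]
      show "((\<lambda>s. F (q + s *\<^sub>R e)) has_derivative (\<lambda>s. F' (q + r *\<^sub>R e) (s *\<^sub>R e))) (at r)" .
      show "onorm (\<lambda>s. F' (q + r *\<^sub>R e) (s *\<^sub>R e)) \<le> M"
        unfolding linear_cmul[OF has_derivative_linear[OF F]]
        using M(2) by (intro onorm_le) (simp add: mult_left_mono mult.commute[of M])
    qed auto
    then show ?thesis by simp
  qed
  define h where "h n = inverse (real (Suc n))" for n
  have h: "0 < h n" "h n \<le> 1" for n by (simp_all add: h_def field_simps)
  define X where "X n q = indicator S q *\<^sub>R ((F (q + h n *\<^sub>R e) - F q) /\<^sub>R h n)" for n q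
  have mS: "(\<lambda>q. indicator S q :: real) \<in> borel_measurable borel"
    using S by (rule borel_measurable_indicator)
  have mFt: "(\<lambda>q. F (q + s *\<^sub>R e)) \<in> borel_measurable borel" for s
    by (rule measurable_compose[OF _ mF]) simp
  have int: "integrable lborel (\<lambda>q. indicator S q *\<^sub>R F (q + s *\<^sub>R e))" for s
  proof (rule integrable_bounded_support)
    show "(\<lambda>q. indicator S q *\<^sub>R F (q + s *\<^sub>R e)) \<in> borel_measurable borel"
      by (intro borel_measurable_scaleR mS mFt)
    show "norm (indicator S q *\<^sub>R F (q + s *\<^sub>R e)) \<le> N * indicator (cball 0 (R + norm (s *\<^sub>R e))) q" for q
    proof (cases "norm (q + s *\<^sub>R e) > R")
      case False
      have "norm q \<le> norm (q + s *\<^sub>R e) + norm (s *\<^sub>R e)"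
        using norm_triangle_ineq4[of "q + s *\<^sub>R e" "s *\<^sub>R e"] by simp
      then show ?thesis using False N by (auto simp: indicator_def)
    qed (use supp N in \<open>simp add: indicator_def\<close>)
  qed
  have X0: "integral\<^sup>L lborel (X n) = 0" for n
  proof -
    have "(\<lambda>q. indicator S q *\<^sub>R F (q + h n *\<^sub>R e)) = (\<lambda>q. indicator S (q + h n *\<^sub>R e) *\<^sub>R F (q + h n *\<^sub>R e))"
      by (simp add: indicator_def inv)
    then have "(\<integral>q. indicator S q *\<^sub>R F (q + h n *\<^sub>R e) \<partial>lborel) = (\<integral>q. indicator S q *\<^sub>R F q \<partial>lborel)"
      using integral_translation[of "\<lambda>q. indicator S q *\<^sub>R F q" "h n *\<^sub>R e"] mS mF by simp
    moreover have "X n = (\<lambda>q. (indicator S q *\<^sub>R F (q + h n *\<^sub>R e) - indicator S q *\<^sub>R F q) /\<^sub>R h n)"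
      by (auto simp: X_def fun_eq_iff algebra_simps)
    ultimately show ?thesis
      using int[of "h n"] int[of 0] by simp
  qed
  have "(\<lambda>n. integral\<^sup>L lborel (X n)) \<longlonglongrightarrow> (\<integral>q. indicator S q *\<^sub>R F' q e \<partial>lborel)"
  proof (rule bounded_support_convergence)
    show "X n \<in> borel_measurable borel" for n
      unfolding X_def[abs_def]
      by (intro borel_measurable_scaleR borel_measurable_diff borel_measurable_const mS mF mFt)
    show "(\<lambda>q. indicator S q *\<^sub>R F' q e) \<in> borel_measurable borel"
      by (intro borel_measurable_scaleR mS mF')
    show "norm (X n q) \<le> M * indicator (cball 0 (R + norm e)) q" for n q
    proof (cases "norm q > R + norm e")
      case True
      have "norm (h n *\<^sub>R e) \<le> norm e" using h[of n] by (simp add: mult_left_le_one_le)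
      then have "norm (q + h n *\<^sub>R e) > R"
        using True norm_triangle_ineq4[of "q + h n *\<^sub>R e" "h n *\<^sub>R e"] by simp
      moreover have "norm q > R" using True norm_ge_zero[of e] by linarith
      ultimately show ?thesis using supp M by (simp add: X_def)
    next
      case False
      have "norm (X n q) \<le> norm ((F (q + h n *\<^sub>R e) - F q) /\<^sub>R h n)"
        by (simp add: X_def indicator_def)
      also have "\<dots> = norm (F (q + h n *\<^sub>R e) - F q) / h n" using h[of n] by (simp add: divide_inverse)
      also have "\<dots> \<le> M" using lip[of q "h n"] h[of n] by (simp add: pos_divide_le_eq)
      finally show ?thesis using False by (simp add: indicator_def)
    qed
    show "(\<lambda>n. X n q) \<longlonglongrightarrow> indicator S q *\<^sub>R F' q e" for q
    proof -
      have "((\<lambda>s. q + s *\<^sub>R e) has_derivative (\<lambda>s. s *\<^sub>R e)) (at 0)"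
        by (auto intro!: derivative_eq_intros)
      moreover have "(F has_derivative F' q) (at (q + 0 *\<^sub>R e))" using F by simp
      ultimately have "((\<lambda>s. F (q + s *\<^sub>R e)) has_derivative (\<lambda>s. F' q (s *\<^sub>R e))) (at 0)"
        by (rule has_derivative_compose)
      then have "((\<lambda>s. F (q + s *\<^sub>R e)) has_vector_derivative F' q e) (at 0)"
        unfolding linear_cmul[OF has_derivative_linear[OF F]] has_vector_derivative_def .
      then have "((\<lambda>s. (F (q + s *\<^sub>R e) - F q) /\<^sub>R s) \<longlongrightarrow> F' q e) (at 0)"
        using difference_quotient_tendsto[of "\<lambda>s. F (q + s *\<^sub>R e)"] by simp
      moreover have "filterlim h (at 0) sequentially"
        unfolding h_def[abs_def] filterlim_at using LIMSEQ_inverse_real_of_nat by (auto simp: less_imp_neq)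
      ultimately have "(\<lambda>n. (F (q + h n *\<^sub>R e) - F q) /\<^sub>R h n) \<longlonglongrightarrow> F' q e"
        by (rule filterlim_compose)
      then show ?thesis unfolding X_def by (intro tendsto_scaleR tendsto_const)
    qed
  qed
  then show "(\<integral>q. indicator S q *\<^sub>R F' q e \<partial>lborel) = 0"
    unfolding X0 using LIMSEQ_unique tendsto_const by blast
  show "integrable lborel (\<lambda>q. indicator S q *\<^sub>R F' q e)"
  proof (rule integrable_bounded_support)
    show "(\<lambda>q. indicator S q *\<^sub>R F' q e) \<in> borel_measurable borel"
      by (intro borel_measurable_scaleR mS mF')
    show "norm (indicator S q *\<^sub>R F' q e) \<le> M * indicator (cball 0 R) q" for q
      using F'0[of q] M by (cases "norm q > R") (auto simp: indicator_def)
  qed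
qed

section \<open>The weak equation at small scales\<close>
text \<open>The value of \<open>\<partial>_t + \<Sum> A_j \<partial>_j\<close> at a point where the derivative is \<open>D\<close>.  The same expression, at
  \<open>D e = \<partial>_e \<phi> u\<close>, is the integrand of the weak equation.\<close>
definition principal_part ::
  "('d::finite \<Rightarrow> complex ^ 'k ^ 'k) \<Rightarrow> (real \<times> (real ^ 'd) \<Rightarrow> complex ^ 'k) \<Rightarrow> complex ^ 'k" where
  "principal_part A D = D (1, 0) + (\<Sum>j\<in>UNIV. A j *v D (0, axis j 1))"

lemma principal_part_0: "principal_part A (\<lambda>_. 0) = 0"
  by (simp add: principal_part_def)

lemma principal_part_diff: "principal_part A (\<lambda>e. D e - D' e) = principal_part A D - principal_part A D'"
  by (simp add: principal_part_def matrix_vector_mult_diff_distrib sum_subtractf)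

lemma principal_part_scaleR: "principal_part A (\<lambda>e. r *\<^sub>R D e) = r *\<^sub>R principal_part A D"
  by (simp add: principal_part_def mv_scaleR2 scaleR_sum_right scaleR_add_right)

lemma principal_part_bound:
  obtains C where "C > 0"
    "\<And>D B. (\<And>e. e \<in> insert (1, 0) (range (\<lambda>j. (0, axis j 1))) \<Longrightarrow> norm (D e) \<le> B) \<Longrightarrow>
       norm (principal_part A D) \<le> C * B"
proof -
  define C where "C = 1 + (\<Sum>j\<in>UNIV. onorm ((*v) (A j)))"
  have o: "0 \<le> onorm ((*v) (A j))" for j by (rule onorm_pos_le[OF bounded_linear_mv])
  have "norm (principal_part A D) \<le> C * B"
    if B: "\<And>e. e \<in> insert (1, 0) (range (\<lambda>j. (0, axis j 1))) \<Longrightarrow> norm (D e) \<le> B" for D B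
  proof -
    have "norm (principal_part A D) \<le> norm (D (1, 0)) + (\<Sum>j\<in>UNIV. norm (A j *v D (0, axis j 1)))"
      unfolding principal_part_def by (intro order_trans[OF norm_triangle_ineq] add_left_mono norm_sum)
    also have "\<dots> \<le> B + (\<Sum>j\<in>UNIV. onorm ((*v) (A j)) * B)"
      using o by (intro add_mono sum_mono order_trans[OF onorm[OF bounded_linear_mv]] mult_left_mono B) auto
    finally show ?thesis unfolding C_def distrib_right sum_distrib_right by simp
  qed
  moreover have "C > 0" using o by (simp add: C_def add_pos_nonneg sum_nonneg)
  ultimately show ?thesis using that by blast
qed

lemma principal_part_tendsto:
  assumes "\<And>e. ((\<lambda>n. D n e) \<longlongrightarrow> D' e) F"
  shows "((\<lambda>n. principal_part A (D n)) \<longlongrightarrow> principal_part A D') F"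
  unfolding principal_part_def
  by (intro tendsto_add tendsto_sum bounded_linear.tendsto[OF bounded_linear_mv] assms)

lemma principal_part_measurable:
  assumes "\<And>e. (\<lambda>p. D p e) \<in> borel_measurable M"
  shows "(\<lambda>p. principal_part A (D p)) \<in> borel_measurable M"
proof -
  have m: "(\<lambda>p. A j *v D p e) \<in> borel_measurable M" for j e
    by (rule measurable_compose[OF assms borel_measurable_continuous_onI])
       (rule linear_continuous_on[OF bounded_linear_mv])
  show ?thesis unfolding principal_part_def by (intro borel_measurable_add borel_measurable_sum m assms)
qed

lemma principal_part_integral:
  assumes int: "\<And>e. e \<in> insert (1, 0) (range (\<lambda>j. (0, axis j 1))) \<Longrightarrow> integrable M (\<lambda>p. D p e)"
  shows "(\<integral>p. principal_part A (D p) \<partial>M) = principal_part A (\<lambda>e. \<integral>p. D p e \<partial>M)"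
proof -
  have i: "integrable M (\<lambda>p. A j *v D p (0, axis j 1))" for j
    by (rule integrable_bounded_linear[OF bounded_linear_mv]) (rule int, simp)
  have "integral\<^sup>L M (\<lambda>p. A j *v D p (0, axis j 1)) = A j *v (\<integral>p. D p (0, axis j 1) \<partial>M)" for j
    by (rule integral_bounded_linear[OF bounded_linear_mv]) (rule int, simp)
  then show ?thesis
    unfolding principal_part_def using i int[of "(1, 0)"] by simp
qed

definition dbump :: "real \<times> (real ^ 'd::finite) \<Rightarrow> real \<times> (real ^ 'd) \<Rightarrow> real" where
  "dbump p = frechet_derivative bump (at p)"

lemma dbump:
  fixes p :: "real \<times> (real ^ 'd::finite)"
  shows "(bump has_derivative dbump p) (at p)"
proof -
  obtain D where D: "\<forall>p\<in>UNIV. ((bump :: real \<times> (real ^ 'd) \<Rightarrow> real) has_derivative D p) (at p)"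
    using Ck_on_bump[of "Suc 0"] unfolding Ck_on.simps by blast
  have "bump differentiable (at p)" by (rule differentiableI[OF D[rule_format, OF UNIV_I]])
  then show ?thesis unfolding dbump_def by (rule frechet_derivative_works[THEN iffD1])
qed

lemma continuous_dbump:
  fixes e :: "real \<times> (real ^ 'd::finite)"
  shows "continuous_on UNIV (\<lambda>p. dbump p e)"
proof -
  obtain D where D: "\<forall>p\<in>UNIV. ((bump :: real \<times> (real ^ 'd) \<Rightarrow> real) has_derivative D p) (at p)"
    "\<forall>v. continuous_on UNIV (\<lambda>p. D p v)"
    using Ck_on_bump[of "Suc 0"] unfolding Ck_on.simps by blast
  have "D p = dbump p" for p using has_derivative_unique[OF D(1)[rule_format, OF UNIV_I] dbump] .
  then show ?thesis using D(2)[rule_format, of e] by simp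
qed

lemma dbump_measurable: "(\<lambda>p. dbump p e) \<in> borel_measurable borel"
  by (rule borel_measurable_continuous_onI[OF continuous_dbump])

definition bump_radius :: "'d itself \<Rightarrow> real" where
  "bump_radius _ = 1 + real CARD('d)"

lemma bump_outside: "norm p > bump_radius TYPE('d) \<Longrightarrow> bump (p :: real \<times> (real ^ 'd::finite)) = 0"
  using bump_support[of p] by (fastforce simp: bump_radius_def)

lemma dbump_outside:
  "norm p > bump_radius TYPE('d) \<Longrightarrow> dbump (p :: real \<times> (real ^ 'd::finite)) e = 0"
  by (subst derivative_outside_support[OF dbump bump_outside]) simp_all

lemma dbump_bounded:
  obtains M where "M > 0"
    "\<And>p e. e \<in> insert (1, 0) (range (\<lambda>j. (0, axis j 1))) \<Longrightarrow>
       \<bar>dbump (p :: real \<times> (real ^ 'd::finite)) e\<bar> \<le> M * indicator (cball 0 (bump_radius TYPE('d))) p"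
proof -
  let ?R = "bump_radius TYPE('d)"
  have "\<exists>m. \<forall>p\<in>cball 0 ?R. \<bar>dbump (p :: real \<times> (real ^ 'd)) e\<bar> \<le> m" for e
  proof -
    have "compact ((\<lambda>p. dbump (p :: real \<times> (real ^ 'd)) e) ` cball 0 ?R)"
      by (intro compact_continuous_image continuous_on_subset[OF continuous_dbump]) auto
    then show ?thesis using compact_imp_bounded bounded_iff by (metis image_eqI real_norm_def)
  qed
  then obtain m where m: "\<And>e p. p \<in> cball 0 ?R \<Longrightarrow> \<bar>dbump (p :: real \<times> (real ^ 'd)) e\<bar> \<le> m e" by metis
  let ?E = "insert (1, 0) (range (\<lambda>j. (0, axis j 1))) :: (real \<times> (real ^ 'd)) set"
  define M where "M = 1 + (\<Sum>e\<in>?E. \<bar>m e\<bar>)"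
  have "\<bar>dbump p e\<bar> \<le> M * indicator (cball 0 ?R) p" if e: "e \<in> ?E" for p e
  proof (cases "p \<in> cball 0 ?R")
    case True
    have "\<bar>m e\<bar> \<le> (\<Sum>e\<in>?E. \<bar>m e\<bar>)" using e by (intro member_le_sum) auto
    then show ?thesis using m[OF True, of e] True by (simp add: M_def)
  next
    case False
    then show ?thesis using dbump_outside[of p e] by simp
  qed
  moreover have "M > 0" by (simp add: M_def add_pos_nonneg sum_nonneg)
  ultimately show ?thesis using that by blast
qed

lemma lborel_integral_affine_zero:
  fixes f :: "'a::euclidean_space \<Rightarrow> 'b::euclidean_space"
  assumes f: "f \<in> borel_measurable borel" and c: "c \<noteq> 0" and z: "integral\<^sup>L lborel f = 0"
  shows "(\<integral>q. f (t + c *\<^sub>R q) \<partial>lborel) = 0"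
proof -
  have T: "(\<lambda>x. t + c *\<^sub>R x) \<in> lborel \<rightarrow>\<^sub>M borel" by simp
  have "integral\<^sup>L lborel f
      = integral\<^sup>L (density (distr lborel borel (\<lambda>x. t + c *\<^sub>R x)) (\<lambda>_. \<bar>c\<bar> ^ DIM('a))) f"
    by (rule arg_cong[OF lborel_affine[OF c, of t], of "\<lambda>M. integral\<^sup>L M f"])
  also have "\<dots> = (\<integral>x. \<bar>c\<bar> ^ DIM('a) *\<^sub>R f x \<partial>distr lborel borel (\<lambda>x. t + c *\<^sub>R x))"
    by (rule integral_density) (use f in auto)
  also have "\<dots> = (\<integral>x. \<bar>c\<bar> ^ DIM('a) *\<^sub>R f (t + c *\<^sub>R x) \<partial>lborel)"
    by (rule integral_distr[OF T]) (use f in auto)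
  finally show ?thesis using z c by simp
qed

text \<open>Testing with the bump function rescaled to size \<open>\<epsilon>\<close> around \<open>p0\<close>; the source does not enter because
  it vanishes near \<open>p0\<close>.\<close>
lemma blow_up:
  fixes A :: "'d::finite \<Rightarrow> complex ^ 'k ^ 'k" and u w :: "real \<times> (real ^ 'd) \<Rightarrow> complex ^ 'k"
  assumes weak: "weak_solution A u f" and f0: "\<And>t x. t \<ge> T \<Longrightarrow> f (t, x) = 0"
    and w: "w \<in> borel_measurable borel" and uw: "AE p in lebesgue. w p = u p"
    and p0: "fst p0 > T" and \<epsilon>: "\<epsilon> > 0" "\<epsilon> * bump_radius TYPE('d) < fst p0 - T"
  shows "(\<integral>q. principal_part A (\<lambda>e. dbump q e *\<^sub>R w (p0 + \<epsilon> *\<^sub>R q)) \<partial>lborel) = 0"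
proof -
  let ?R = "bump_radius TYPE('d)"
  define c where "c = - ((1 / \<epsilon>) *\<^sub>R p0)"
  define \<phi> :: "real \<times> (real ^ 'd) \<Rightarrow> real" where "\<phi> p = bump ((1 / \<epsilon>) *\<^sub>R p + c)" for p
  have bl: "bounded_linear (\<lambda>p::real \<times> (real ^ 'd). (1 / \<epsilon>) *\<^sub>R p)" by (rule bounded_linear_scaleR_right)
  have smooth: "Cinf_on UNIV \<phi>"
    unfolding Cinf_on_def \<phi>_def using Ck_on_affine[OF bl Ck_on_bump, of _ c] by simp
  have near: "norm (p - p0) \<le> \<epsilon> * ?R" if "\<phi> p \<noteq> 0" for p
  proof -
    have "\<not> norm ((1 / \<epsilon>) *\<^sub>R p + c) > ?R" using that bump_outside unfolding \<phi>_def by blast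
    then have "norm ((1 / \<epsilon>) *\<^sub>R p + c) \<le> ?R" by simp
    moreover have "(1 / \<epsilon>) *\<^sub>R p + c = (1 / \<epsilon>) *\<^sub>R (p - p0)" by (simp add: c_def scaleR_diff_right)
    ultimately have "norm (p - p0) / \<epsilon> \<le> ?R" using \<epsilon>(1) by simp
    then show ?thesis using \<epsilon>(1) by (simp add: pos_divide_le_eq mult.commute)
  qed
  have "{p. \<phi> p \<noteq> 0} \<subseteq> cball p0 (\<epsilon> * ?R)" using near by (auto simp: dist_norm norm_minus_commute)
  then have "bounded {p. \<phi> p \<noteq> 0}" using bounded_cball bounded_subset by blast
  then have supp: "compactly_supported \<phi>" unfolding compactly_supported_def by simp
  have "\<phi> p *\<^sub>R f p = 0" for p
  proof (cases "\<phi> p = 0")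
    case False
    have "\<bar>fst p - fst p0\<bar> \<le> norm (p - p0)" using norm_fst_le[of "fst (p - p0)" "snd (p - p0)"]
      unfolding prod.collapse by simp
    then have "fst p \<ge> T" using near[OF False] \<epsilon>(2) by linarith
    then show ?thesis using f0[of "fst p" "snd p"] by simp
  qed simp
  then have rhs: "(LINT p|lebesgue. \<phi> p *\<^sub>R f p) = 0" by (simp only: Bochner_Integration.integral_zero)
  have d\<phi>: "dir_deriv e \<phi> p = (1 / \<epsilon>) * dbump ((1 / \<epsilon>) *\<^sub>R p + c) e" for e p
  proof -
    have "((\<lambda>p. (1 / \<epsilon>) *\<^sub>R p + c) has_derivative (\<lambda>v. (1 / \<epsilon>) *\<^sub>R v)) (at p)"
      by (rule has_derivative_add_const[OF bounded_linear_imp_has_derivative[OF bl]])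
    from has_derivative_compose[OF this dbump]
    have "(\<phi> has_derivative (\<lambda>v. dbump ((1 / \<epsilon>) *\<^sub>R p + c) ((1 / \<epsilon>) *\<^sub>R v))) (at p)"
      unfolding \<phi>_def[abs_def] .
    from dir_deriv_eq[OF this, of e] show ?thesis
      unfolding linear_cmul[OF has_derivative_linear[OF dbump]] by simp
  qed
  define G where "G v p = principal_part A (\<lambda>e. ((1 / \<epsilon>) * dbump ((1 / \<epsilon>) *\<^sub>R p + c) e) *\<^sub>R v p)"
    for v :: "real \<times> (real ^ 'd) \<Rightarrow> complex ^ 'k" and p
  have "Dt \<phi> p *\<^sub>R u p + (\<Sum>j\<in>UNIV. Dx j \<phi> p *\<^sub>R (A j *v u p)) = G u p" for p
    by (simp add: G_def principal_part_def d\<phi> mv_scaleR2)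
  moreover have "- (LINT p|lebesgue. Dt \<phi> p *\<^sub>R u p + (\<Sum>j\<in>UNIV. Dx j \<phi> p *\<^sub>R (A j *v u p))) = (LINT p|lebesgue. \<phi> p *\<^sub>R f p)"
    using weak smooth supp unfolding weak_solution_def by blast
  ultimately have Gu: "integral\<^sup>L lebesgue (G u) = 0" using rhs by simp
  have md: "(\<lambda>p. (1 / \<epsilon>) * dbump ((1 / \<epsilon>) *\<^sub>R p + c) e) \<in> borel_measurable borel" for e
    by (rule borel_measurable_times[OF borel_measurable_const measurable_compose[OF _ dbump_measurable]]) simp
  have Gw: "G w \<in> borel_measurable borel"
    unfolding G_def[abs_def] by (rule principal_part_measurable[OF borel_measurable_scaleR[OF md w]])
  have eq: "AE p in lebesgue. G w p = G u p" using uw by eventually_elim (simp add: G_def)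
  have mw: "G w \<in> borel_measurable lebesgue"
    using Gw by (intro measurable_completion) simp
  have mu: "G u \<in> borel_measurable lebesgue" by (rule borel_measurable_AE[OF mw eq])
  have "integral\<^sup>L lebesgue (G w) = 0"
    unfolding integral_cong_AE[OF mw mu eq] by (rule Gu)
  then have "integral\<^sup>L lborel (G w) = 0" using integral_completion[of "G w" lborel] Gw by simp
  from lborel_integral_affine_zero[OF Gw _ this, of \<epsilon> p0]
  have "(\<integral>q. G w (p0 + \<epsilon> *\<^sub>R q) \<partial>lborel) = 0" using \<epsilon>(1) by simp
  moreover have "G w (p0 + \<epsilon> *\<^sub>R q) = (1 / \<epsilon>) *\<^sub>R principal_part A (\<lambda>e. dbump q e *\<^sub>R w (p0 + \<epsilon> *\<^sub>R q))" for q
  proof -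
    have "(1 / \<epsilon>) *\<^sub>R (p0 + \<epsilon> *\<^sub>R q) + c = q" using \<epsilon>(1) by (simp add: c_def scaleR_add_right)
    then show ?thesis unfolding G_def scaleR_scaleR[symmetric] principal_part_scaleR by simp
  qed
  ultimately show ?thesis using \<epsilon>(1) by simp
qed

lemma integral_pos_of_continuous:
  fixes g G :: "'a::euclidean_space \<Rightarrow> real"
  assumes int: "integrable lborel g" and nn: "\<And>q. g q \<ge> 0" and S: "open S" "\<And>q. q \<in> S \<Longrightarrow> g q = G q"
    and G: "continuous_on UNIV G" and q0: "q0 \<in> S" "G q0 \<noteq> 0"
  shows "integral\<^sup>L lborel g > 0"
proof (rule ccontr)
  assume "\<not> integral\<^sup>L lborel g > 0"
  moreover have "integral\<^sup>L lborel g \<ge> 0" using nn by (rule Bochner_Integration.integral_nonneg)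
  ultimately have "integral\<^sup>L lborel g = 0" by simp
  then have "AE q in lborel. g q = 0"
    using integral_nonneg_eq_0_iff_AE[OF int] nn by simp
  then have "AE q in lebesgue. g q = 0" by (rule AE_completion)
  then have "AE q\<in>S in lebesgue. q \<in> {q. G q = 0}" by eventually_elim (use S(2) in auto)
  moreover have "closed {q. G q = 0}" using G by (intro closed_Collect_eq continuous_on_const)
  ultimately have "q0 \<in> {q. G q = 0}" using mem_closed_if_AE_lebesgue_open[OF S(1)] q0(1) by blast
  then show False using q0(2) by simp
qed

context
  fixes e :: "real \<times> (real ^ 'd::finite)"
begin

lemma dbump_integrable: "integrable lborel (\<lambda>q. dbump q e)"
  using integral_derivative_invariant_set(1)[of bump dbump e "bump_radius TYPE('d)" UNIV]
  by (simp add: dbump continuous_dbump bump_outside)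

lemma dbump_integral: "(\<integral>q. dbump q e \<partial>lborel) = 0"
  using integral_derivative_invariant_set(2)[of bump dbump e "bump_radius TYPE('d)" UNIV]
  by (simp add: dbump continuous_dbump bump_outside)

lemma dbump_integral_invariant:
  assumes "S \<in> sets borel" "\<And>q s. q + s *\<^sub>R e \<in> S \<longleftrightarrow> q \<in> S"
  shows "(\<integral>q. indicator S q *\<^sub>R dbump q e \<partial>lborel) = 0"
  by (rule integral_derivative_invariant_set(2)[OF dbump continuous_dbump bump_outside assms])

end

lemma bump_continuous: "continuous_on UNIV (bump :: real \<times> (real ^ 'd::finite) \<Rightarrow> real)"
  using Ck_on_bump[of 0] by simp

lemma bump_integrable: "integrable lborel (bump :: real \<times> (real ^ 'd::finite) \<Rightarrow> real)"
proof -
  let ?R = "bump_radius TYPE('d)"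
  have "compact ((bump :: real \<times> (real ^ 'd) \<Rightarrow> real) ` cball 0 ?R)"
    by (rule compact_continuous_image[OF continuous_on_subset[OF bump_continuous]]) auto
  then obtain M where M: "\<forall>x\<in>(bump :: real \<times> (real ^ 'd) \<Rightarrow> real) ` cball 0 ?R. norm x \<le> M"
    using compact_imp_bounded bounded_iff by metis
  show ?thesis
  proof (rule integrable_bounded_support)
    show "(bump :: real \<times> (real ^ 'd) \<Rightarrow> real) \<in> borel_measurable borel"
      by (rule borel_measurable_continuous_onI[OF bump_continuous])
    show "norm (bump q) \<le> M * indicator (cball 0 ?R) q" for q :: "real \<times> (real ^ 'd)"
      using M bump_outside[of q] by (cases "norm q > ?R") auto
  qed
qed

lemma bump_integral_pos: "integral\<^sup>L lborel (bump :: real \<times> (real ^ 'd::finite) \<Rightarrow> real) > 0"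
proof (rule integral_pos_of_continuous[OF bump_integrable bump_nonneg open_UNIV _ bump_continuous])
  show "bump (0 :: real \<times> (real ^ 'd)) \<noteq> 0" using bump_0 by (metis less_irrefl)
qed simp_all

lemma bump_radius_pos: "bump_radius TYPE('d::finite) > 0"
  by (simp add: bump_radius_def add_pos_nonneg)

text \<open>Radii tending to \<open>0\<close> for which \<open>blow_up\<close> applies and the rescaled bump stays within distance \<open>d\<close>.\<close>
lemma blow_up_scales:
  assumes "t > (T::real)" "d > 0"
  obtains \<epsilon> :: "nat \<Rightarrow> real" where "\<And>n. \<epsilon> n > 0" "\<And>n. \<epsilon> n * bump_radius TYPE('d::finite) < t - T"
    "\<And>n. \<epsilon> n * bump_radius TYPE('d) < d" "filterlim \<epsilon> (at_right 0) sequentially"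
proof -
  let ?R = "bump_radius TYPE('d)"
  define E where "E = min (t - T) d / (2 * ?R)"
  have E: "E > 0" "E * ?R < t - T" "E * ?R < d"
    using assms bump_radius_pos[where 'd = 'd] by (auto simp: E_def min_def)
  define \<epsilon> where "\<epsilon> n = E * inverse (real (Suc n))" for n
  have \<epsilon>: "0 < \<epsilon> n" "\<epsilon> n \<le> E" for n using E(1) by (simp_all add: \<epsilon>_def field_simps)
  have "\<epsilon> n * ?R \<le> E * ?R" for n using \<epsilon>(2) bump_radius_pos[where 'd = 'd] by (intro mult_right_mono) auto
  moreover have "filterlim \<epsilon> (at_right 0) sequentially"
  proof -
    have "\<epsilon> \<longlonglongrightarrow> E * 0" unfolding \<epsilon>_def[abs_def] by (intro tendsto_mult tendsto_const LIMSEQ_inverse_real_of_nat)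
    then show ?thesis using \<epsilon>(1) by (auto simp: filterlim_at intro!: always_eventually less_imp_neq[symmetric])
  qed
  ultimately show ?thesis using that[of \<epsilon>] \<epsilon>(1) E by (meson le_less_trans)
qed

text \<open>The terms of order zero in the blow-up integrate to zero, since the bump has compact support.  The
  first order term is \<open>\<partial>_e bump D q\<close>, and moving the derivative to the linear map \<open>D\<close> leaves the integral of
  the bump times the expression in question.\<close>
lemma interior_equation:
  fixes A :: "'d::finite \<Rightarrow> complex ^ 'k ^ 'k" and u w :: "real \<times> (real ^ 'd) \<Rightarrow> complex ^ 'k"
  assumes weak: "weak_solution A u f" and f0: "\<And>t x. t \<ge> T \<Longrightarrow> f (t, x) = 0"
    and w: "w \<in> borel_measurable borel" and uw: "AE p in lebesgue. w p = u p"
    and p0: "fst p0 > T" and D: "(w has_derivative D) (at p0)"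
  shows "principal_part A D = 0"
proof -
  let ?R = "bump_radius TYPE('d)"
  have bl: "bounded_linear D" using D by (rule has_derivative_bounded_linear)
  obtain K where K: "K > 0" "\<And>v. norm (D v) \<le> norm v * K" using bounded_linear.pos_bounded[OF bl] by blast
  obtain d where d: "d > 0" "\<And>y. norm (y - p0) < d \<Longrightarrow> norm (w y - w p0 - D (y - p0)) \<le> 1 * norm (y - p0)"
    using D[unfolded has_derivative_at_alt] zero_less_one by blast
  obtain \<epsilon> where \<epsilon>: "\<And>n. \<epsilon> n > 0" "\<And>n. \<epsilon> n * ?R < fst p0 - T" "\<And>n. \<epsilon> n * ?R < d"
    "filterlim \<epsilon> (at_right 0) sequentially"
    using blow_up_scales[OF p0 d(1), where 'd = 'd] by metis
  obtain C where C: "C > 0"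
    "\<And>D B. (\<And>e. e \<in> insert (1, 0) (range (\<lambda>j. (0, axis j 1))) \<Longrightarrow> norm (D e) \<le> B) \<Longrightarrow>
       norm (principal_part A D) \<le> C * B"
    using principal_part_bound[of A] by blast
  obtain M where M: "M > 0" "\<And>p e. e \<in> insert (1, 0) (range (\<lambda>j. (0, axis j 1))) \<Longrightarrow>
       \<bar>dbump (p :: real \<times> (real ^ 'd)) e\<bar> \<le> M * indicator (cball 0 ?R) p"
    using dbump_bounded by blast
  define Q where "Q n q = (w (p0 + \<epsilon> n *\<^sub>R q) - w p0) /\<^sub>R \<epsilon> n" for n q
  define X where "X n q = principal_part A (\<lambda>e. dbump q e *\<^sub>R Q n q)" for n q
  have mw: "(\<lambda>q. w (p0 + r *\<^sub>R q)) \<in> borel_measurable borel" for r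
    by (rule measurable_compose[OF _ w]) simp
  have mQ: "Q n \<in> borel_measurable borel" for n
    unfolding Q_def[abs_def]
    by (rule borel_measurable_scaleR[OF borel_measurable_const borel_measurable_diff[OF mw borel_measurable_const]])
  have mX: "X n \<in> borel_measurable borel" for n
    unfolding X_def[abs_def] by (rule principal_part_measurable[OF borel_measurable_scaleR[OF dbump_measurable mQ]])
  have Qb: "norm (Q n q) \<le> (1 + K) * ?R" if "norm q \<le> ?R" for n q
  proof -
    have n: "norm (\<epsilon> n *\<^sub>R q) = \<epsilon> n * norm q" unfolding norm_scaleR using \<epsilon>(1)[of n] by (simp only: real_norm_def abs_of_pos)
    also have "\<dots> \<le> \<epsilon> n * ?R" using that \<epsilon>(1)[of n] by (intro mult_left_mono) auto
    also have "\<dots> < d" by (rule \<epsilon>(3))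
    finally have "norm (w (p0 + \<epsilon> n *\<^sub>R q) - w p0 - D (\<epsilon> n *\<^sub>R q)) \<le> \<epsilon> n * norm q"
      using d(2)[of "p0 + \<epsilon> n *\<^sub>R q"] unfolding add_diff_cancel_left' n by simp
    moreover have "norm (D (\<epsilon> n *\<^sub>R q)) \<le> \<epsilon> n * norm q * K" using K(2)[of "\<epsilon> n *\<^sub>R q"] unfolding n .
    ultimately have "norm (w (p0 + \<epsilon> n *\<^sub>R q) - w p0) \<le> \<epsilon> n * norm q + \<epsilon> n * norm q * K"
      using norm_triangle_ineq2[of "w (p0 + \<epsilon> n *\<^sub>R q) - w p0" "D (\<epsilon> n *\<^sub>R q)"] by linarith
    also have "\<dots> = \<epsilon> n * ((1 + K) * norm q)" by (simp add: algebra_simps)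
    finally have "norm (w (p0 + \<epsilon> n *\<^sub>R q) - w p0) / \<epsilon> n \<le> (1 + K) * norm q"
      using \<epsilon>(1)[of n] by (simp add: pos_divide_le_eq mult.commute)
    also have "\<dots> \<le> (1 + K) * ?R" using that K(1) by (intro mult_left_mono) auto
    finally show ?thesis using \<epsilon>(1)[of n] by (simp add: Q_def divide_inverse mult.commute)
  qed
  have Xb: "norm (X n q) \<le> C * (M * ((1 + K) * ?R)) * indicator (cball 0 ?R) q" for n q
  proof -
    have "norm (X n q) \<le> C * (M * indicator (cball 0 ?R) q * ((1 + K) * ?R))"
      unfolding X_def
    proof (rule C(2))
      fix e :: "real \<times> (real ^ 'd)" assume e: "e \<in> insert (1, 0) (range (\<lambda>j. (0, axis j 1)))"
      show "norm (dbump q e *\<^sub>R Q n q) \<le> M * indicator (cball 0 ?R) q * ((1 + K) * ?R)"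
      proof (cases "norm q \<le> ?R")
        case True
        then show ?thesis unfolding norm_scaleR real_norm_def
          using M(1) by (intro mult_mono M(2)[OF e] Qb) auto
      next
        case False
        then have "dbump q e = 0" using M(2)[OF e, of q] by simp
        with False show ?thesis by simp
      qed
    qed
    then show ?thesis by (simp add: mult_ac)
  qed
  have iX: "integrable lborel (X n)" for n by (rule integrable_bounded_support[OF mX Xb])
  let ?c = "\<lambda>q. principal_part A (\<lambda>e. dbump q e *\<^sub>R w p0)"
  have di: "integrable lborel (\<lambda>q. dbump q e *\<^sub>R v)" for e and v :: "complex ^ 'k"
    by (rule integrable_scaleR_left) (rule dbump_integrable)
  have ic: "integrable lborel ?c"
    unfolding principal_part_def
    by (intro Bochner_Integration.integrable_add Bochner_Integration.integrable_sum di
          integrable_bounded_linear[OF bounded_linear_mv])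
  have c0: "integral\<^sup>L lborel ?c = 0"
  proof -
    have z: "(\<integral>q. dbump q e *\<^sub>R w p0 \<partial>lborel) = 0" for e :: "real \<times> (real ^ 'd)"
      using integral_scaleR_left[OF dbump_integrable[of e], of "w p0"] by (simp add: dbump_integral)
    have "integral\<^sup>L lborel ?c = principal_part A (\<lambda>e. \<integral>q. dbump q e *\<^sub>R w p0 \<partial>lborel)"
      by (rule principal_part_integral) (rule di)
    then show ?thesis by (simp only: z principal_part_0)
  qed
  have X0: "integral\<^sup>L lborel (X n) = 0" for n
  proof -
    have "principal_part A (\<lambda>e. dbump q e *\<^sub>R w (p0 + \<epsilon> n *\<^sub>R q)) = \<epsilon> n *\<^sub>R X n q + ?c q" for q
    proof -
      have "w (p0 + \<epsilon> n *\<^sub>R q) = \<epsilon> n *\<^sub>R Q n q + w p0" using \<epsilon>(1)[of n] by (simp add: Q_def)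
      then show ?thesis
        by (simp add: X_def principal_part_def mv_scaleR2 matrix_vector_right_distrib scaleR_add_right
            scaleR_sum_right sum.distrib mult.commute)
    qed
    with blow_up[OF weak f0 w uw p0 \<epsilon>(1,2)[of n]]
    have "(\<integral>q. \<epsilon> n *\<^sub>R X n q + ?c q \<partial>lborel) = 0" by simp
    then have "\<epsilon> n *\<^sub>R integral\<^sup>L lborel (X n) + integral\<^sup>L lborel ?c = 0"
      using iX[of n] ic by simp
    then show ?thesis using \<epsilon>(1)[of n] by (simp add: c0)
  qed
  have mD: "D \<in> borel_measurable borel"
    by (rule borel_measurable_continuous_onI[OF linear_continuous_on[OF bl]])
  have "(\<lambda>n. integral\<^sup>L lborel (X n)) \<longlonglongrightarrow> (\<integral>q. principal_part A (\<lambda>e. dbump q e *\<^sub>R D q) \<partial>lborel)"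
  proof (rule bounded_support_convergence[OF mX _ Xb])
    show "(\<lambda>q. principal_part A (\<lambda>e. dbump q e *\<^sub>R D q)) \<in> borel_measurable borel"
      by (rule principal_part_measurable[OF borel_measurable_scaleR[OF dbump_measurable mD]])
    show "(\<lambda>n. X n q) \<longlonglongrightarrow> principal_part A (\<lambda>e. dbump q e *\<^sub>R D q)" for q
    proof -
      have "((\<lambda>s. p0 + s *\<^sub>R q) has_derivative (\<lambda>s. s *\<^sub>R q)) (at 0)"
        by (auto intro!: derivative_eq_intros)
      moreover have "(w has_derivative D) (at (p0 + 0 *\<^sub>R q))" using D by simp
      ultimately have "((\<lambda>s. w (p0 + s *\<^sub>R q)) has_derivative (\<lambda>s. D (s *\<^sub>R q))) (at 0)"
        by (rule has_derivative_compose)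
      then have "((\<lambda>s. w (p0 + s *\<^sub>R q)) has_vector_derivative D q) (at 0)"
        unfolding linear_cmul[OF has_derivative_linear[OF D]] has_vector_derivative_def .
      from difference_quotient_tendsto[OF this]
      have "((\<lambda>s. (w (p0 + s *\<^sub>R q) - w p0) /\<^sub>R s) \<longlongrightarrow> D q) (at 0)" by simp
      moreover have "filterlim \<epsilon> (at 0) sequentially"
        using \<epsilon>(4) by (rule filterlim_mono) (simp_all add: at_le)
      ultimately have "(\<lambda>n. Q n q) \<longlonglongrightarrow> D q" unfolding Q_def by (rule filterlim_compose)
      then show ?thesis unfolding X_def by (intro principal_part_tendsto tendsto_scaleR tendsto_const)
    qed
  qed
  then have lim0: "(\<integral>q. principal_part A (\<lambda>e. dbump q e *\<^sub>R D q) \<partial>lborel) = 0"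
    unfolding X0 using LIMSEQ_unique tendsto_const by blast
  have parts: "integrable lborel (\<lambda>q. dbump q e *\<^sub>R D q)"
    "(\<integral>q. dbump q e *\<^sub>R D q \<partial>lborel) = - integral\<^sup>L lborel (bump :: real \<times> (real ^ 'd) \<Rightarrow> real) *\<^sub>R D e"
    for e :: "real \<times> (real ^ 'd)"
  proof -
    have Dd: "(D has_derivative D) (at q)" for q by (rule bounded_linear_imp_has_derivative[OF bl])
    have der: "((\<lambda>q. bump q *\<^sub>R D q) has_derivative (\<lambda>e. bump q *\<^sub>R D e + dbump q e *\<^sub>R D q)) (at q)" for q
      by (rule has_derivative_scaleR[OF dbump Dd])
    have cont: "continuous_on UNIV (\<lambda>q. bump q *\<^sub>R D e + dbump q e *\<^sub>R D q)"
      by (intro continuous_intros bump_continuous continuous_dbump linear_continuous_on bl)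
    have supp: "bump q *\<^sub>R D q = 0" if "norm q > ?R" for q using bump_outside[OF that] by simp
    note ib = integral_derivative_invariant_set[where e = e and S = UNIV and R = ?R, OF der cont supp, simplified]
    have i2: "integrable lborel (\<lambda>q :: real \<times> (real ^ 'd). bump q *\<^sub>R D e)"
      by (rule integrable_scaleR_left) (rule bump_integrable)
    have "integrable lborel (\<lambda>q. (bump q *\<^sub>R D e + dbump q e *\<^sub>R D q) - bump q *\<^sub>R D e)"
      by (rule Bochner_Integration.integrable_diff[OF ib(1) i2])
    then show i3: "integrable lborel (\<lambda>q. dbump q e *\<^sub>R D q)" by simp
    have "integral\<^sup>L lborel (\<lambda>q :: real \<times> (real ^ 'd). bump q *\<^sub>R D e) + (\<integral>q. dbump q e *\<^sub>R D q \<partial>lborel) = 0"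
      using ib(2) unfolding Bochner_Integration.integral_add[OF i2 i3] .
    then show "(\<integral>q. dbump q e *\<^sub>R D q \<partial>lborel) = - integral\<^sup>L lborel (bump :: real \<times> (real ^ 'd) \<Rightarrow> real) *\<^sub>R D e"
      using integral_scaleR_left[OF bump_integrable[where 'd = 'd], of "D e"] by (simp add: eq_neg_iff_add_eq_0 add.commute)
  qed
  have "principal_part A (\<lambda>e. - integral\<^sup>L lborel (bump :: real \<times> (real ^ 'd) \<Rightarrow> real) *\<^sub>R D e) = 0"
    using lim0 principal_part_integral[of lborel "\<lambda>q e. dbump q e *\<^sub>R D q" A] parts by simp
  then show ?thesis using bump_integral_pos[where 'd = 'd] unfolding principal_part_scaleR by simp
qed

text \<open>At a point of the hyperplane the blow-up limit is the step function with values \<open>gp\<close> and \<open>gm\<close>.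
  The half space is invariant under tangential translations, so only the normal derivative of the bump
  contributes, and its integrals over the two half spaces are opposite and nonzero.\<close>
lemma jump_relation:
  fixes A :: "'d::finite \<Rightarrow> complex ^ 'k ^ 'k" and u w :: "real \<times> (real ^ 'd) \<Rightarrow> complex ^ 'k"
  assumes weak: "weak_solution A u f" and f0: "\<And>t x. t \<ge> T \<Longrightarrow> f (t, x) = 0"
    and w: "w \<in> borel_measurable borel" and uw: "AE p in lebesgue. w p = u p"
    and p0: "fst p0 > T"
    and lim: "\<And>q. ((\<lambda>\<epsilon>. w (p0 + \<epsilon> *\<^sub>R q)) \<longlongrightarrow> (if snd q $ i1 > 0 then gp else gm)) (at_right 0)"
    and bd: "d > 0" "\<And>p. norm (p - p0) < d \<Longrightarrow> norm (w p) \<le> N"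
  shows "A i1 *v (gp - gm) = 0"
proof -
  let ?R = "bump_radius TYPE('d)"
  let ?p = "{q :: real \<times> (real ^ 'd). snd q $ i1 > 0}" and ?m = "{q :: real \<times> (real ^ 'd). snd q $ i1 \<le> 0}"
  have N: "N \<ge> 0" using bd(2)[of p0] bd(1) by (simp add: order_trans[OF norm_ge_zero])
  obtain \<epsilon> where \<epsilon>: "\<And>n. \<epsilon> n > 0" "\<And>n. \<epsilon> n * ?R < fst p0 - T" "\<And>n. \<epsilon> n * ?R < d"
    "filterlim \<epsilon> (at_right 0) sequentially"
    using blow_up_scales[OF p0 bd(1), where 'd = 'd] by metis
  obtain C where C: "C > 0"
    "\<And>D B. (\<And>e. e \<in> insert (1, 0) (range (\<lambda>j. (0, axis j 1))) \<Longrightarrow> norm (D e) \<le> B) \<Longrightarrow>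
       norm (principal_part A D) \<le> C * B"
    using principal_part_bound[of A] by blast
  obtain M where M: "M > 0" "\<And>p e. e \<in> insert (1, 0) (range (\<lambda>j. (0, axis j 1))) \<Longrightarrow>
       \<bar>dbump (p :: real \<times> (real ^ 'd)) e\<bar> \<le> M * indicator (cball 0 ?R) p"
    using dbump_bounded by blast
  define X where "X n q = principal_part A (\<lambda>e. dbump q e *\<^sub>R w (p0 + \<epsilon> n *\<^sub>R q))" for n q
  define w0 where "w0 q = (if snd q $ i1 > 0 then gp else gm)" for q :: "real \<times> (real ^ 'd)"
  have op: "open ?p" by (rule open_Collect_less) (auto intro!: continuous_intros)
  have sp: "?p \<in> sets borel" using op by (rule borel_open)
  have "?m = - ?p" by auto
  then have sm: "?m \<in> sets borel" using sp by (simp only: borel_comp)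
  have mw: "(\<lambda>q. w (p0 + r *\<^sub>R q)) \<in> borel_measurable borel" for r
    by (rule measurable_compose[OF _ w]) simp
  have w0_alt: "w0 q = indicator ?p q *\<^sub>R gp + indicator ?m q *\<^sub>R gm" for q
    by (simp add: w0_def indicator_def)
  have mw0: "w0 \<in> borel_measurable borel"
    unfolding w0_alt[abs_def]
    by (rule borel_measurable_add[OF borel_measurable_scaleR[OF borel_measurable_indicator[OF sp] borel_measurable_const]
          borel_measurable_scaleR[OF borel_measurable_indicator[OF sm] borel_measurable_const]])
  have mX: "X n \<in> borel_measurable borel" for n
    unfolding X_def[abs_def] by (rule principal_part_measurable[OF borel_measurable_scaleR[OF dbump_measurable mw]])
  have wb: "norm (w (p0 + \<epsilon> n *\<^sub>R q)) \<le> N" if "norm q \<le> ?R" for n q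
  proof -
    have "norm (\<epsilon> n *\<^sub>R q) = \<epsilon> n * norm q"
      unfolding norm_scaleR using \<epsilon>(1)[of n] by (simp only: real_norm_def abs_of_pos)
    also have "\<dots> \<le> \<epsilon> n * ?R" using that \<epsilon>(1)[of n] by (intro mult_left_mono) auto
    also have "\<dots> < d" by (rule \<epsilon>(3))
    finally show ?thesis using bd(2)[of "p0 + \<epsilon> n *\<^sub>R q"] unfolding add_diff_cancel_left' by simp
  qed
  have Xb: "norm (X n q) \<le> C * (M * N) * indicator (cball 0 ?R) q" for n q
  proof -
    have "norm (X n q) \<le> C * (M * indicator (cball 0 ?R) q * N)"
      unfolding X_def
    proof (rule C(2))
      fix e :: "real \<times> (real ^ 'd)" assume e: "e \<in> insert (1, 0) (range (\<lambda>j. (0, axis j 1)))"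
      show "norm (dbump q e *\<^sub>R w (p0 + \<epsilon> n *\<^sub>R q)) \<le> M * indicator (cball 0 ?R) q * N"
      proof (cases "norm q \<le> ?R")
        case True
        then show ?thesis unfolding norm_scaleR real_norm_def
          using M(1) by (intro mult_mono M(2)[OF e] wb) auto
      next
        case False
        then have "dbump q e = 0" using M(2)[OF e, of q] by simp
        with False show ?thesis by simp
      qed
    qed
    then show ?thesis by (simp add: mult_ac)
  qed
  have X0: "integral\<^sup>L lborel (X n) = 0" for n
    using blow_up[OF weak f0 w uw p0 \<epsilon>(1,2)[of n]] by (simp add: X_def[abs_def])
  have "(\<lambda>n. integral\<^sup>L lborel (X n)) \<longlonglongrightarrow> (\<integral>q. principal_part A (\<lambda>e. dbump q e *\<^sub>R w0 q) \<partial>lborel)"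
  proof (rule bounded_support_convergence[OF mX _ Xb])
    show "(\<lambda>q. principal_part A (\<lambda>e. dbump q e *\<^sub>R w0 q)) \<in> borel_measurable borel"
      by (rule principal_part_measurable[OF borel_measurable_scaleR[OF dbump_measurable mw0]])
    show "(\<lambda>n. X n q) \<longlonglongrightarrow> principal_part A (\<lambda>e. dbump q e *\<^sub>R w0 q)" for q
      unfolding X_def w0_def
      by (intro principal_part_tendsto tendsto_scaleR tendsto_const filterlim_compose[OF lim \<epsilon>(4)])
  qed
  then have lim0: "(\<integral>q. principal_part A (\<lambda>e. dbump q e *\<^sub>R w0 q) \<partial>lborel) = 0"
    unfolding X0 using LIMSEQ_unique tendsto_const by blast
  define c where "c S e = (\<integral>q. indicator S q *\<^sub>R dbump q e \<partial>lborel)"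
    for S and e :: "real \<times> (real ^ 'd)"
  have ic: "integrable lborel (\<lambda>q. indicator S q *\<^sub>R dbump q e)" if "S \<in> sets borel"
    for S and e :: "real \<times> (real ^ 'd)"
    by (rule integrable_mult_indicator[OF _ dbump_integrable]) (use that in simp)
  have dw0: "dbump q e *\<^sub>R w0 q = (indicator ?p q *\<^sub>R dbump q e) *\<^sub>R gp + (indicator ?m q *\<^sub>R dbump q e) *\<^sub>R gm"
    for q e by (simp add: w0_alt scaleR_add_right mult.commute)
  have ip: "integrable lborel (\<lambda>q. (indicator ?p q *\<^sub>R dbump q e) *\<^sub>R gp)" for e
    by (rule integrable_scaleR_left) (rule ic[OF sp])
  have im: "integrable lborel (\<lambda>q. (indicator ?m q *\<^sub>R dbump q e) *\<^sub>R gm)" for e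
    by (rule integrable_scaleR_left) (rule ic[OF sm])
  have idw0: "integrable lborel (\<lambda>q. dbump q e *\<^sub>R w0 q)" for e
    unfolding dw0 by (rule Bochner_Integration.integrable_add[OF ip im])
  have cdw0: "(\<integral>q. dbump q e *\<^sub>R w0 q \<partial>lborel) = c ?p e *\<^sub>R gp + c ?m e *\<^sub>R gm" for e
    unfolding dw0 Bochner_Integration.integral_add[OF ip im] c_def
    using integral_scaleR_left[OF ic[OF sp, of e], of gp] integral_scaleR_left[OF ic[OF sm, of e], of gm] by simp
  have eq: "principal_part A (\<lambda>e. c ?p e *\<^sub>R gp + c ?m e *\<^sub>R gm) = 0"
    using lim0 principal_part_integral[of lborel "\<lambda>q e. dbump q e *\<^sub>R w0 q" A, OF idw0] unfolding cdw0 by simp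
  have tang: "c ?p e = 0" "c ?m e = 0" if "snd e $ i1 = 0" for e
    unfolding c_def by (rule dbump_integral_invariant[OF sp], simp add: that)
      (rule dbump_integral_invariant[OF sm], simp add: that)
  let ?e = "(0, axis i1 1) :: real \<times> (real ^ 'd)"
  have opp: "c ?p ?e = - c ?m ?e"
  proof -
    have "indicator ?p q *\<^sub>R dbump q ?e + indicator ?m q *\<^sub>R dbump q ?e = dbump q ?e" for q
      by (simp add: indicator_def)
    then have "c ?p ?e + c ?m ?e = 0"
      unfolding c_def Bochner_Integration.integral_add[OF ic[OF sp] ic[OF sm], symmetric]
      by (simp only: dbump_integral)
    then show ?thesis by simp
  qed
  have pos: "c ?m ?e > 0"
    unfolding c_def
  proof (rule integral_pos_of_continuous[OF ic[OF sm] _ _ _ continuous_dbump])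
    show "indicator ?m q *\<^sub>R dbump q ?e \<ge> 0" for q
      using bump_increasing(1)[OF dbump, of q i1] by (auto simp: indicator_def)
    show "open {q :: real \<times> (real ^ 'd). snd q $ i1 < 0}"
      by (rule open_Collect_less) (auto intro!: continuous_intros)
    show "(0, axis i1 (- 1 / 2)) \<in> {q :: real \<times> (real ^ 'd). snd q $ i1 < 0}"
      by simp
    show "dbump (0, axis i1 (- 1 / 2)) ?e \<noteq> 0"
      using bump_increasing(2)[OF dbump refl, of i1] by simp
  qed (auto simp: indicator_def)
  have "principal_part A (\<lambda>e. c ?p e *\<^sub>R gp + c ?m e *\<^sub>R gm) = A i1 *v (c ?p ?e *\<^sub>R gp + c ?m ?e *\<^sub>R gm)"
  proof -
    have t: "c ?p (1, 0) *\<^sub>R gp + c ?m (1, 0) *\<^sub>R gm = 0" by (simp add: tang)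
    have "(\<Sum>j\<in>UNIV. A j *v (c ?p (0, axis j 1) *\<^sub>R gp + c ?m (0, axis j 1) *\<^sub>R gm))
        = (\<Sum>j\<in>{i1}. A j *v (c ?p (0, axis j 1) *\<^sub>R gp + c ?m (0, axis j 1) *\<^sub>R gm))"
      by (rule sum.mono_neutral_right) (auto simp: tang axis_def)
    then show ?thesis unfolding principal_part_def t by simp
  qed
  also have "c ?p ?e *\<^sub>R gp + c ?m ?e *\<^sub>R gm = (- c ?m ?e) *\<^sub>R (gp - gm)"
    unfolding opp by (simp add: algebra_simps)
  finally have "(- c ?m ?e) *\<^sub>R (A i1 *v (gp - gm)) = 0"
    using eq unfolding mv_scaleR2 by simp
  then show ?thesis using pos by simp
qed

section \<open>Symmetry of second derivatives\<close>
text \<open>The second difference is the increment over \<open>{0..s}\<close> of \<open>g (x + r a + s b) - g (x + r a)\<close> as a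
  function of \<open>r\<close>, and the derivative of that function is \<open>s G b\<close> up to a small multiple of \<open>s\<close>.\<close>
lemma second_difference_estimate:
  fixes g :: "'a::real_normed_vector \<Rightarrow> 'b::real_normed_vector"
  assumes S: "open S" "x \<in> S" and g: "\<And>y. y \<in> S \<Longrightarrow> (g has_derivative g' y) (at y)"
    and ga: "((\<lambda>y. g' y a) has_derivative G) (at x)" and e: "e > 0"
  shows "\<exists>d>0. \<forall>s. 0 < s \<and> s < d \<longrightarrow>
    norm (g (x + s *\<^sub>R a + s *\<^sub>R b) - g (x + s *\<^sub>R a) - g (x + s *\<^sub>R b) + g x - (s * s) *\<^sub>R G b) \<le> e * (s * s)"
proof -
  define N where "N = norm a + norm b + 1"
  have pos: "N > 0" by (simp add: N_def add_nonneg_pos)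
  define e' where "e' = e / (2 * N)"
  have e': "e' > 0" "2 * (e' * N) = e" using e pos by (simp_all add: e'_def)
  obtain d1 where d1: "d1 > 0"
    "\<And>y. norm (y - x) < d1 \<Longrightarrow> norm (g' y a - g' x a - G (y - x)) \<le> e' * norm (y - x)"
    using ga[unfolded has_derivative_at_alt] e'(1) by blast
  obtain d2 where d2: "d2 > 0" "ball x d2 \<subseteq> S" using S open_contains_ball by blast
  have G: "linear G" using ga by (rule has_derivative_linear)
  define d where "d = min d1 d2 / N"
  have d: "d > 0" using d1(1) d2(1) pos by (simp add: d_def)
  have "norm (g (x + s *\<^sub>R a + s *\<^sub>R b) - g (x + s *\<^sub>R a) - g (x + s *\<^sub>R b) + g x - (s * s) *\<^sub>R G b) \<le> e * (s * s)"
    if s: "0 < s" "s < d" for s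
  proof -
    have near: "norm (r *\<^sub>R a + q *\<^sub>R b) \<le> s * N" "s * N < min d1 d2"
      if "0 \<le> r" "r \<le> s" "0 \<le> q" "q \<le> s" for r q
    proof -
      have "norm (r *\<^sub>R a + q *\<^sub>R b) \<le> r * norm a + q * norm b"
        using norm_triangle_ineq[of "r *\<^sub>R a" "q *\<^sub>R b"] that by simp
      also have "\<dots> \<le> s * norm a + s * norm b" using that by (intro add_mono mult_right_mono) auto
      also have "\<dots> \<le> s * N" using s by (simp add: N_def algebra_simps)
      finally show "norm (r *\<^sub>R a + q *\<^sub>R b) \<le> s * N" .
      show "s * N < min d1 d2"
        using s(2) pos unfolding d_def by (simp only: pos_less_divide_eq)
    qed
    have inS: "x + (r *\<^sub>R a + q *\<^sub>R b) \<in> S" if "0 \<le> r" "r \<le> s" "0 \<le> q" "q \<le> s" for r q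
    proof -
      have "norm (r *\<^sub>R a + q *\<^sub>R b) < d2" using near[OF that] by linarith
      then have "x + (r *\<^sub>R a + q *\<^sub>R b) \<in> ball x d2"
        by (metis add_diff_cancel_left' dist_commute dist_norm mem_ball)
      then show ?thesis using d2(2) by blast
    qed
    have est: "norm (g' (x + (r *\<^sub>R a + q *\<^sub>R b)) a - g' x a - G (r *\<^sub>R a + q *\<^sub>R b))
        \<le> e' * (s * N)" if "0 \<le> r" "r \<le> s" "0 \<le> q" "q \<le> s" for r q
      using d1(2)[of "x + (r *\<^sub>R a + q *\<^sub>R b)"] near[OF that] e'(1)
      by (auto intro: order_trans[OF _ mult_left_mono])
    define \<psi> where "\<psi> r = g (x + (r *\<^sub>R a + s *\<^sub>R b)) - g (x + (r *\<^sub>R a + 0 *\<^sub>R b)) - r *\<^sub>R (s *\<^sub>R G b)" for r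
    have "norm (\<psi> s - \<psi> 0) \<le> (e * s) * norm (s - 0)"
    proof (rule differentiable_bound[of "{0..s}"])
      fix r assume r: "r \<in> {0..s}"
      have der: "((\<lambda>r. g (x + (r *\<^sub>R a + q *\<^sub>R b))) has_derivative (\<lambda>h. h *\<^sub>R g' (x + (r *\<^sub>R a + q *\<^sub>R b)) a)) (at r within {0..s})"
        if "0 \<le> q" "q \<le> s" for q
      proof -
        have gy: "(g has_derivative g' (x + (r *\<^sub>R a + q *\<^sub>R b))) (at (x + (r *\<^sub>R a + q *\<^sub>R b)))"
          by (rule g[OF inS]) (use r that in auto)
        have "((\<lambda>r. x + (r *\<^sub>R a + q *\<^sub>R b)) has_derivative (\<lambda>h. h *\<^sub>R a)) (at r within {0..s})"
          by (auto intro!: derivative_eq_intros)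
        from has_derivative_compose[OF this gy] show ?thesis
          unfolding linear_cmul[OF has_derivative_linear[OF gy]] .
      qed
      show "(\<psi> has_derivative (\<lambda>h. h *\<^sub>R g' (x + (r *\<^sub>R a + s *\<^sub>R b)) a - h *\<^sub>R g' (x + (r *\<^sub>R a + 0 *\<^sub>R b)) a
          - h *\<^sub>R (s *\<^sub>R G b))) (at r within {0..s})"
        unfolding \<psi>_def[abs_def] using s
        by (intro has_derivative_diff der) (auto intro!: derivative_eq_intros)
      have "norm (g' (x + (r *\<^sub>R a + s *\<^sub>R b)) a - g' (x + (r *\<^sub>R a + 0 *\<^sub>R b)) a - s *\<^sub>R G b) \<le> e * s"
      proof -
        have "g' (x + (r *\<^sub>R a + s *\<^sub>R b)) a - g' (x + (r *\<^sub>R a + 0 *\<^sub>R b)) a - s *\<^sub>R G b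
            = (g' (x + (r *\<^sub>R a + s *\<^sub>R b)) a - g' x a - G (r *\<^sub>R a + s *\<^sub>R b))
            - (g' (x + (r *\<^sub>R a + 0 *\<^sub>R b)) a - g' x a - G (r *\<^sub>R a + 0 *\<^sub>R b))"
          by (simp add: linear_add[OF G] linear_cmul[OF G])
        also have "norm \<dots> \<le> e' * (s * N) + e' * (s * N)"
          by (rule order_trans[OF norm_triangle_ineq4 add_mono[OF est est]]) (use r s in auto)
        also have "\<dots> = (2 * (e' * N)) * s" by (simp add: algebra_simps)
        finally show ?thesis unfolding e'(2) .
      qed
      then show "onorm (\<lambda>h. h *\<^sub>R g' (x + (r *\<^sub>R a + s *\<^sub>R b)) a - h *\<^sub>R g' (x + (r *\<^sub>R a + 0 *\<^sub>R b)) a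
          - h *\<^sub>R (s *\<^sub>R G b)) \<le> e * s"
        unfolding scaleR_diff_right[symmetric]
        by (intro onorm_le) (simp add: mult_left_mono mult.commute[of "e * s"])
    qed (use s in auto)
    moreover have "\<psi> s - \<psi> 0 = g (x + s *\<^sub>R a + s *\<^sub>R b) - g (x + s *\<^sub>R a) - g (x + s *\<^sub>R b) + g x - (s * s) *\<^sub>R G b"
      by (simp add: \<psi>_def add.assoc)
    ultimately show ?thesis using s by (simp add: mult.assoc)
  qed
  with d show ?thesis by blast
qed

text \<open>The second difference is symmetric in the two directions.\<close>
lemma second_derivative_symmetric:
  fixes g :: "'a::real_normed_vector \<Rightarrow> 'b::real_normed_vector"
  assumes S: "open S" "x \<in> S" and g: "\<And>y. y \<in> S \<Longrightarrow> (g has_derivative g' y) (at y)"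
    and ga: "((\<lambda>y. g' y a) has_derivative Ga) (at x)" and gb: "((\<lambda>y. g' y b) has_derivative Gb) (at x)"
  shows "Ga b = Gb a"
proof -
  have "norm (Ga b - Gb a) \<le> 0 + e" if e: "e > 0" for e
  proof -
    have e2: "e / 2 > 0" using e by simp
    let ?D = "\<lambda>s. g (x + s *\<^sub>R a + s *\<^sub>R b) - g (x + s *\<^sub>R a) - g (x + s *\<^sub>R b) + g x"
    obtain d1 where d1: "d1 > 0" "\<And>s. 0 < s \<Longrightarrow> s < d1 \<Longrightarrow> norm (?D s - (s * s) *\<^sub>R Ga b) \<le> e / 2 * (s * s)"
      using second_difference_estimate[OF S g ga e2, of b] by blast
    have "\<exists>d>0. \<forall>s. 0 < s \<and> s < d \<longrightarrow>
        norm (g (x + s *\<^sub>R b + s *\<^sub>R a) - g (x + s *\<^sub>R b) - g (x + s *\<^sub>R a) + g x - (s * s) *\<^sub>R Gb a) \<le> e / 2 * (s * s)"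
      by (rule second_difference_estimate[OF S g gb e2])
    then obtain d2 where d2: "d2 > 0" "\<And>s. 0 < s \<Longrightarrow> s < d2 \<Longrightarrow>
        norm (g (x + s *\<^sub>R b + s *\<^sub>R a) - g (x + s *\<^sub>R b) - g (x + s *\<^sub>R a) + g x - (s * s) *\<^sub>R Gb a) \<le> e / 2 * (s * s)"
      by blast
    define s where "s = min d1 d2 / 2"
    have s: "0 < s" "s < d1" "s < d2" using d1(1) d2(1) by (auto simp: s_def min_def)
    have eqD: "g (x + s *\<^sub>R b + s *\<^sub>R a) - g (x + s *\<^sub>R b) - g (x + s *\<^sub>R a) + g x = ?D s"
      by (simp add: algebra_simps)
    have "(s * s) *\<^sub>R (Ga b - Gb a) = (?D s - (s * s) *\<^sub>R Gb a) - (?D s - (s * s) *\<^sub>R Ga b)"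
      by (simp add: scaleR_diff_right)
    also have "norm \<dots> \<le> e / 2 * (s * s) + e / 2 * (s * s)"
      by (rule order_trans[OF norm_triangle_ineq4 add_mono])
        (use d2(2)[OF s(1,3)] d1(2)[OF s(1,2)] in \<open>simp_all only: eqD\<close>)
    finally have "norm (Ga b - Gb a) * (s * s) \<le> e * (s * s)" by (simp add: mult.commute)
    then show ?thesis using s(1) by simp
  qed
  then have "norm (Ga b - Gb a) \<le> 0" by (rule field_le_epsilon)
  then show ?thesis by simp
qed

lemma mv_minus: "M *v (- x) = - (M *v (x :: complex ^ 'n))" for M :: "complex ^ 'n ^ 'm"
  by (simp add: matrix_vector_mult_def vec_eq_iff sum_negf)

section \<open>Transport of the jumps along rays\<close>

definition tangential ::
  "('d::finite \<Rightarrow> complex ^ 'k ^ 'k) \<Rightarrow> 'd \<Rightarrow> (real \<times> (real ^ 'd) \<Rightarrow> complex ^ 'k) \<Rightarrow> complex ^ 'k" where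
  "tangential A i1 D = D (1, 0) + (\<Sum>j\<in>UNIV - {i1}. A j *v D (0, axis j 1))"

lemma principal_part_split: "principal_part A D = tangential A i1 D + A i1 *v D (0, axis i1 1)"
  by (simp add: principal_part_def tangential_def sum.remove[of UNIV i1])

lemma L_tan_eq:
  assumes "(h has_derivative D) (at p)"
  shows "L_tan A i1 h p = tangential A i1 D"
  by (simp add: L_tan_def tangential_def dir_deriv_eq[OF assms])

lemma set_coord_zero_decomposition:
  "(1 :: real, set_coord i 0 v) = (1, 0) + (\<Sum>j\<in>UNIV - {i}. (v $ j) *\<^sub>R (0, axis j 1 :: real ^ 'd::finite))"
proof -
  have "set_coord i 0 v = (\<Sum>j\<in>UNIV - {i}. (v $ j) *\<^sub>R axis j 1)"
    by (auto simp: set_coord_def vec_eq_iff axis_def if_distrib[of "\<lambda>a. _ * a"] cong: if_cong)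
  moreover have "snd (\<Sum>j\<in>UNIV - {i}. (v $ j) *\<^sub>R (0 :: real, axis j 1 :: real ^ 'd))
      = (\<Sum>j\<in>UNIV - {i}. (v $ j) *\<^sub>R axis j 1)"
    by (simp add: snd_sum)
  moreover have "fst (\<Sum>j\<in>UNIV - {i}. (v $ j) *\<^sub>R (0 :: real, axis j 1 :: real ^ 'd)) = 0"
    by (simp add: fst_sum)
  ultimately show ?thesis by (intro prod_eqI) simp_all
qed

lemma derivative_invariant_translate:
  assumes "open S" "q \<in> S" and F: "(F has_derivative D) (at q)" "(F has_derivative D') (at (q + c))"
    and inv: "\<And>y. y \<in> S \<Longrightarrow> F (y + c) = F y"
  shows "D' = D"
proof -
  have "((\<lambda>y. y + c) has_derivative (\<lambda>y. y)) (at q)" by (auto intro!: derivative_eq_intros)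
  from has_derivative_compose[OF this F(2)] have "((\<lambda>y. F (y + c)) has_derivative D') (at q)" .
  then have "(F has_derivative D') (at q)"
    by (rule has_derivative_transform_within_open[OF _ assms(1,2)]) (rule inv)
  then show ?thesis using F(1) has_derivative_unique by blast
qed

lemma constant_along_ray:
  fixes F :: "'a::real_normed_vector \<Rightarrow> 'b::real_normed_vector"
  assumes F: "\<And>s. s \<ge> 0 \<Longrightarrow> (F has_derivative D s) (at (p + s *\<^sub>R r))" and K: "\<And>s. s \<ge> 0 \<Longrightarrow> D s r = K"
    and s: "s \<ge> 0"
  shows "F (p + s *\<^sub>R r) = F p + s *\<^sub>R K"
proof -
  have "\<exists>c. \<forall>s\<in>{0..}. F (p + s *\<^sub>R r) - s *\<^sub>R K = c"
  proof (rule has_derivative_zero_constant)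
    fix s :: real assume "s \<in> {0..}"
    then have s: "s \<ge> 0" by simp
    have "((\<lambda>s. p + s *\<^sub>R r) has_derivative (\<lambda>h. h *\<^sub>R r)) (at s within {0..})"
      by (auto intro!: derivative_eq_intros)
    from has_derivative_compose[OF this F[OF s]]
    have "((\<lambda>s. F (p + s *\<^sub>R r)) has_derivative (\<lambda>h. h *\<^sub>R K)) (at s within {0..})"
      unfolding linear_cmul[OF has_derivative_linear[OF F[OF s]]] K[OF s] .
    then have "((\<lambda>s. F (p + s *\<^sub>R r) - s *\<^sub>R K) has_derivative (\<lambda>h. h *\<^sub>R K - h *\<^sub>R K)) (at s within {0..})"
      by (intro has_derivative_diff) (auto intro!: derivative_eq_intros)
    then show "((\<lambda>s. F (p + s *\<^sub>R r) - s *\<^sub>R K) has_derivative (\<lambda>h. 0)) (at s within {0..})" by simp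
  qed simp
  then obtain c where c: "\<And>s. s \<ge> 0 \<Longrightarrow> F (p + s *\<^sub>R r) - s *\<^sub>R K = c" by auto
  from c[OF s] c[of 0] show ?thesis by (simp add: algebra_simps)
qed

text \<open>The computation with \<open>J0\<close> and \<open>J1\<close> described at the beginning.  Constancy of \<open>K\<close> along rays is obtained
  from that of \<open>J0\<close> by comparing derivatives at a point and at its translate along the ray, so that no second
  derivatives of \<open>J0\<close> appear.\<close>
lemma jump_transport:
  fixes A :: "'d::finite \<Rightarrow> complex ^ 'k ^ 'k" and P Q :: "complex ^ 'k ^ 'k" and v :: "real ^ 'd" and i1 :: 'd
    and J0 J1 :: "real \<times> (real ^ 'd) \<Rightarrow> complex ^ 'k"
  defines "r \<equiv> (1 :: real, set_coord i1 0 v)"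
  assumes PM: "\<And>w. P *v (A i1 *v w) = 0" "\<And>w. A i1 *v (P *v w) = 0"
    and Pker: "\<And>w. A i1 *v w = 0 \<Longrightarrow> P *v w = w"
    and Q: "\<And>w. Q *v (A i1 *v w) = w - P *v w"
    and gv: "\<And>j w. A i1 *v w = 0 \<Longrightarrow> P *v (A j *v w) = (v $ j) *\<^sub>R w"
    and D0: "\<And>p. (J0 has_derivative D0 p) (at p)" and D1: "\<And>p. (J1 has_derivative D1 p) (at p)"
    and E0: "\<And>p. fst p > T \<Longrightarrow> A i1 *v J0 p = 0"
    and E1: "\<And>p. fst p > T \<Longrightarrow> tangential A i1 (D0 p) + A i1 *v J1 p = 0"
    and E2: "\<And>p. fst p > T \<Longrightarrow> P *v tangential A i1 (D1 p) = 0"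
    and p: "fst p > T" and s: "s \<ge> 0"
  shows "J1 (p + s *\<^sub>R r) = J1 p + s *\<^sub>R (P *v L_tan A i1 (\<lambda>q. Q *v L_tan A i1 J0 q) p)"
proof -
  let ?S = "{p :: real \<times> (real ^ 'd). fst p > T}"
  have op: "open ?S" by (rule open_Collect_less) (auto intro!: continuous_intros)
  have r1: "fst r = 1" by (simp add: r_def)
  have ray: "fst (q + s *\<^sub>R r) > T" if "fst q > T" "s \<ge> 0" for q s using that by (simp add: r1)
  \<comment> \<open>On the kernel the projected tangential operator is the derivative along the ray.\<close>
  have PLP: "P *v tangential A i1 D = D r" if D: "linear D" and k: "\<And>e. A i1 *v D e = 0" for D
    unfolding r_def set_coord_zero_decomposition tangential_def
    by (simp only: matrix_vector_right_distrib mv_sum gv[OF k] Pker[OF k] linear_add[OF D] linear_sum[OF D]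
        linear_cmul[OF D])
  have k0: "A i1 *v D0 q e = 0" if q: "fst q > T" for q e
  proof -
    have "((\<lambda>q. A i1 *v J0 q) has_derivative (\<lambda>e. A i1 *v D0 q e)) (at q)"
      by (rule bounded_linear.has_derivative[OF bounded_linear_mv D0])
    then have "((\<lambda>q. 0) has_derivative (\<lambda>e. A i1 *v D0 q e)) (at q)"
      by (rule has_derivative_transform_within_open[OF _ op]) (use q E0 in auto)
    then have "(\<lambda>e. A i1 *v D0 q e) = (\<lambda>e. 0)" using has_derivative_unique has_derivative_const by blast
    then show ?thesis by meson
  qed
  have D0r: "D0 q r = 0" if q: "fst q > T" for q
  proof -
    have "D0 q r = P *v tangential A i1 (D0 q)"
      by (rule PLP[symmetric, OF has_derivative_linear[OF D0] k0[OF q]])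
    also have "tangential A i1 (D0 q) = - (A i1 *v J1 q)" using E1[OF q] by (simp add: eq_neg_iff_add_eq_0)
    also have "\<dots> = A i1 *v (- J1 q)" by (simp only: mv_minus)
    finally show ?thesis by (simp only: PM(1))
  qed
  have J0_inv: "J0 (q + s *\<^sub>R r) = J0 q" if "fst q > T" "s \<ge> 0" for q s
    using constant_along_ray[of J0 "\<lambda>s. D0 (q + s *\<^sub>R r)" q r 0 s] D0 D0r ray that by simp
  have L0_inv: "L_tan A i1 J0 (q + s *\<^sub>R r) = L_tan A i1 J0 q" if "fst q > T" "s \<ge> 0" for q s
  proof -
    have "D0 (q + s *\<^sub>R r) = D0 q"
      by (rule derivative_invariant_translate[OF op _ D0 D0]) (use that J0_inv in auto)
    then show ?thesis by (simp add: L_tan_eq[OF D0])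
  qed
  define W where "W q = Q *v L_tan A i1 J0 q" for q
  have W: "W q = P *v J1 q - J1 q" if q: "fst q > T" for q
  proof -
    have "tangential A i1 (D0 q) = - (A i1 *v J1 q)" using E1[OF q] by (simp add: eq_neg_iff_add_eq_0)
    also have "\<dots> = A i1 *v (- J1 q)" by (simp only: mv_minus)
    finally have "W q = (- J1 q) - P *v (- J1 q)" by (simp only: W_def L_tan_eq[OF D0] Q)
    also have "P *v (- J1 q) = - (P *v J1 q)" by (simp only: mv_minus)
    finally show ?thesis by simp
  qed
  define DP where "DP q e = P *v D1 q e" for q e
  have DP: "((\<lambda>q. P *v J1 q) has_derivative DP q) (at q)" for q
    unfolding DP_def[abs_def] by (rule bounded_linear.has_derivative[OF bounded_linear_mv D1])
  have DW: "(W has_derivative (\<lambda>e. DP q e - D1 q e)) (at q)" if q: "fst q > T" for q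
    by (rule has_derivative_transform_within_open[OF has_derivative_diff[OF DP D1] op]) (use q W in auto)
  have W_inv: "W (q + s *\<^sub>R r) = W q" if "fst q > T" "s \<ge> 0" for q s
    by (simp add: W_def L0_inv[OF that])
  define K where "K = P *v L_tan A i1 W p"
  have DPr: "DP (p + s *\<^sub>R r) r = K" if s: "s \<ge> 0" for s
  proof -
    let ?q = "p + s *\<^sub>R r"
    have q: "fst ?q > T" by (rule ray[OF p s])
    have e: "(\<lambda>e. DP ?q e - D1 ?q e) = (\<lambda>e. DP p e - D1 p e)"
      by (rule derivative_invariant_translate[OF op _ DW[OF p] DW[OF q]]) (use p s W_inv in auto)
    have "DP ?q r = P *v tangential A i1 (DP ?q)"
      by (rule PLP[symmetric, OF has_derivative_linear[OF DP]]) (simp add: DP_def PM(2))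
    also have "\<dots> = P *v tangential A i1 (\<lambda>e. DP ?q e - D1 ?q e) + P *v tangential A i1 (D1 ?q)"
      unfolding matrix_vector_right_distrib[symmetric]
      by (simp add: tangential_def matrix_vector_mult_diff_distrib sum_subtractf)
    also have "\<dots> = K" unfolding E2[OF q] e K_def L_tan_eq[OF DW[OF p]] by simp
    finally show ?thesis .
  qed
  have "P *v J1 (p + s *\<^sub>R r) = P *v J1 p + s *\<^sub>R K"
    by (rule constant_along_ray[of "\<lambda>q. P *v J1 q", OF DP DPr s])
  moreover have "P *v J1 (p + s *\<^sub>R r) - J1 (p + s *\<^sub>R r) = P *v J1 p - J1 p"
    using W_inv[OF p s] unfolding W[OF p] W[OF ray[OF p s]] .
  ultimately have "J1 (p + s *\<^sub>R r) = J1 p + s *\<^sub>R K" by (simp add: algebra_simps)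
  then show ?thesis by (simp add: K_def W_def[abs_def])
qed

section \<open>Equations and limits on the two sides of the hyperplane\<close>
definition on_plane :: "'d::finite \<Rightarrow> real \<times> (real ^ 'd) \<Rightarrow> real \<times> (real ^ 'd)" where
  "on_plane i p = (fst p, set_coord i 0 (snd p))"

lemma on_plane_simps [simp]:
  "fst (on_plane i p) = fst p" "snd (on_plane i p) $ i = 0"
  by (simp_all add: on_plane_def set_coord_def)

lemma on_plane_add: "(t, set_coord i s x) = on_plane i (t, x) + s *\<^sub>R (0, axis i 1)"
  by (simp add: on_plane_def set_coord_def vec_eq_iff axis_def)

lemma bounded_linear_on_plane: "bounded_linear (on_plane i)"
  by (rule linear_conv_bounded_linear[THEN iffD1], rule linearI)
     (simp_all add: on_plane_def set_coord_def vec_eq_iff prod_eq_iff)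

lemma on_plane_unit: "on_plane i (1, 0) = (1, 0)" "j \<noteq> i \<Longrightarrow> on_plane i (0, axis j 1) = (0, axis j 1)"
  by (auto simp: on_plane_def set_coord_def vec_eq_iff axis_def)

text \<open>The two closed half spaces are treated simultaneously; \<open>\<sigma>\<close> is the sign of the side.\<close>
definition side :: "'d::finite \<Rightarrow> real \<Rightarrow> (real \<times> (real ^ 'd)) set" where
  "side i \<sigma> = {p. \<sigma> * snd p $ i \<ge> 0}"

lemma open_side_interior: "open {p :: real \<times> (real ^ 'd::finite). \<sigma> * snd p $ i > 0}"
  by (rule open_Collect_less) (auto intro!: continuous_intros)

lemma on_plane_in_side: "on_plane i p \<in> side i \<sigma>"
  by (simp add: side_def)

lemma at_within_side:
  assumes "\<sigma> * snd p $ i > 0"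
  shows "at p within side i \<sigma> = at p"
  by (rule at_within_open_subset[OF _ open_side_interior[of \<sigma> i]]) (use assms in \<open>auto simp: side_def\<close>)

lemma continuous_on_side_limit:
  fixes F :: "real \<times> (real ^ 'd::finite) \<Rightarrow> 'b::real_normed_vector"
  assumes F: "continuous_on (side i \<sigma>) F" and p: "p \<in> side i \<sigma>" and s: "\<forall>\<^sub>F s in G. \<sigma> * s * snd e $ i \<ge> 0"
    and p0: "snd p $ i = 0" and G: "G \<le> at 0"
  shows "((\<lambda>s. F (p + s *\<^sub>R e)) \<longlongrightarrow> F p) G"
proof -
  have "((\<lambda>s. p + s *\<^sub>R e) \<longlongrightarrow> p + 0 *\<^sub>R e) (at 0)" by (intro tendsto_intros)
  then have "((\<lambda>s. p + s *\<^sub>R e) \<longlongrightarrow> p) G" using tendsto_mono[OF G] by fastforce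
  moreover have "\<forall>\<^sub>F s in G. p + s *\<^sub>R e \<in> side i \<sigma>"
    using s by eventually_elim (simp add: side_def p0 mult.assoc)
  ultimately show ?thesis
    by (rule continuous_on_tendsto_compose[OF F _ p])
qed

text \<open>In the open half space the equation for \<open>g\<close> may be differentiated in the normal direction, and exchanging
  the order of differentiation gives the equation for the normal derivative.  Both extend to the hyperplane by
  continuity.\<close>
lemma one_sided_equations:
  fixes A :: "'d::finite \<Rightarrow> complex ^ 'k ^ 'k" and g :: "real \<times> (real ^ 'd) \<Rightarrow> complex ^ 'k"
  assumes g: "Cinf_on (side i \<sigma>) g" and \<sigma>: "\<sigma> \<noteq> 0"
    and wg: "\<And>p. \<sigma> * snd p $ i > 0 \<Longrightarrow> w p = g p"
    and eqn: "\<And>p D. fst p > T \<Longrightarrow> (w has_derivative D) (at p) \<Longrightarrow> principal_part A D = 0"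
  shows "\<exists>g' g1. \<forall>p\<in>side i \<sigma>. (g has_derivative g' p) (at p within side i \<sigma>) \<and>
    ((\<lambda>p. g' p (0, axis i 1)) has_derivative g1 p) (at p within side i \<sigma>) \<and>
    (fst p > T \<longrightarrow> principal_part A (g' p) = 0 \<and> principal_part A (g1 p) = 0)"
proof -
  let ?H = "side i \<sigma>" and ?n = "(0, axis i 1) :: real \<times> (real ^ 'd)"
  let ?O = "{p :: real \<times> (real ^ 'd). \<sigma> * snd p $ i > 0}"
  have "Ck_on (Suc (Suc 0)) ?H g" using g unfolding Cinf_on_def by blast
  then obtain g' where g': "\<forall>p\<in>?H. (g has_derivative g' p) (at p within ?H)"
    and c1: "\<forall>v. Ck_on (Suc 0) ?H (\<lambda>p. g' p v)"
    unfolding Ck_on.simps(2)[of "Suc 0"] by blast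
  have "\<forall>v. \<exists>G. (\<forall>p\<in>?H. ((\<lambda>p. g' p v) has_derivative G p) (at p within ?H)) \<and> (\<forall>e. continuous_on ?H (\<lambda>p. G p e))"
    using c1 unfolding Ck_on.simps by blast
  then obtain G where G: "\<And>v p. p \<in> ?H \<Longrightarrow> ((\<lambda>p. g' p v) has_derivative G v p) (at p within ?H)"
    "\<And>v e. continuous_on ?H (\<lambda>p. G v p e)" by metis
  have cg': "continuous_on ?H (\<lambda>p. g' p v)" for v
    by (rule has_derivative_continuous_on[OF G(1)])
  have cp: "continuous_on ?H (\<lambda>p. principal_part A (F p))"
    if "\<And>e. continuous_on ?H (\<lambda>p. F p e)" for F :: "_ \<Rightarrow> _ \<Rightarrow> complex ^ 'k"
    unfolding principal_part_def
    by (intro continuous_on_add continuous_on_sum bounded_linear.continuous_on[OF bounded_linear_mv] that)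
  have OH: "p \<in> ?H" if "p \<in> ?O" for p using that by (simp add: side_def)
  have gO: "(g has_derivative g' p) (at p)" if "p \<in> ?O" for p
    using g' OH[OF that] at_within_side[of \<sigma> p i] that by fastforce
  have GO: "((\<lambda>p. g' p v) has_derivative G v p) (at p)" if "p \<in> ?O" for v p
    using G(1)[OF OH[OF that], of v] at_within_side[of \<sigma> p i] that by simp
  have eq0: "principal_part A (g' p) = 0" if p: "p \<in> ?O" "fst p > T" for p
  proof (rule eqn[OF p(2)])
    show "(w has_derivative g' p) (at p)"
      by (rule has_derivative_transform_within_open[OF gO[OF p(1)] open_side_interior p(1)]) (simp add: wg)
  qed
  have eq1: "principal_part A (G ?n p) = 0" if p: "p \<in> ?O" "fst p > T" for p
  proof -
    have "((\<lambda>p. principal_part A (g' p)) has_derivative (\<lambda>v. principal_part A (\<lambda>e. G e p v))) (at p)"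
      unfolding principal_part_def
      by (intro has_derivative_add has_derivative_sum bounded_linear.has_derivative[OF bounded_linear_mv] GO p)
    moreover have "open (?O \<inter> {p. fst p > T})"
      by (intro open_Int open_side_interior open_Collect_less) (auto intro!: continuous_intros)
    ultimately have "((\<lambda>p. 0) has_derivative (\<lambda>v. principal_part A (\<lambda>e. G e p v))) (at p)"
      by (rule has_derivative_transform_within_open) (use p eq0 in auto)
    then have "(\<lambda>v. principal_part A (\<lambda>e. G e p v)) = (\<lambda>v. 0)"
      using has_derivative_unique has_derivative_const by blast
    then have "principal_part A (\<lambda>e. G e p ?n) = 0" by meson
    moreover have "G e p ?n = G ?n p e" for e
      by (rule second_derivative_symmetric[OF open_side_interior p(1) gO GO[OF p(1)] GO[OF p(1)]])
    ultimately show ?thesis by simp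
  qed
  have closure: "F p = 0"
    if F: "continuous_on ?H F" and O: "\<And>q. q \<in> ?O \<Longrightarrow> fst q > T \<Longrightarrow> F q = 0" and p: "p \<in> ?H" "fst p > T"
    for F :: "real \<times> (real ^ 'd) \<Rightarrow> complex ^ 'k" and p
  proof (cases "p \<in> ?O")
    case False
    then have p0: "snd p $ i = 0" using p(1) \<sigma> by (auto simp: side_def)
    let ?e = "\<sigma> *\<^sub>R ?n"
    have ev: "\<forall>\<^sub>F s in at_right (0::real). s > 0" by (rule eventually_at_right_less)
    have "((\<lambda>s. F (p + s *\<^sub>R ?e)) \<longlongrightarrow> F p) (at_right 0)"
    proof (rule continuous_on_side_limit[OF F p(1) _ p0])
      show "\<forall>\<^sub>F s in at_right 0. \<sigma> * s * snd ?e $ i \<ge> 0"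
        using ev by eventually_elim (simp add: mult.commute mult.left_commute)
    qed (simp add: at_le)
    moreover have "\<forall>\<^sub>F s in at_right 0. F (p + s *\<^sub>R ?e) = 0"
      using ev
    proof eventually_elim
      case (elim s)
      have "\<sigma> * (s * \<sigma>) = s * (\<sigma> * \<sigma>)" by simp
      also have "\<dots> > 0" using \<sigma> by (intro mult_pos_pos[OF elim]) (metis linorder_neqE_linordered_idom mult_neg_neg mult_pos_pos)
      finally have "p + s *\<^sub>R ?e \<in> ?O" by (simp add: p0)
      then show ?case using O p(2) by simp
    qed
    then have "((\<lambda>s. F (p + s *\<^sub>R ?e)) \<longlongrightarrow> 0) (at_right 0)" by (rule tendsto_eventually)
    ultimately show ?thesis using tendsto_unique trivial_limit_at_right_real by blast
  qed (use O p in auto)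
  have "principal_part A (g' p) = 0" "principal_part A (G ?n p) = 0" if "p \<in> ?H" "fst p > T" for p
    using closure[OF cp[OF cg'] eq0 that] closure[OF cp[OF G(2)] eq1 that] by blast+
  then show ?thesis using g' G(1) by (intro exI[of _ g'] exI[of _ "G ?n"]) simp
qed

lemma one_sided_limits:
  fixes u g :: "real \<times> (real ^ 'd::finite) \<Rightarrow> complex ^ 'k"
  assumes ug: "\<And>p. \<sigma> * snd p $ i > 0 \<Longrightarrow> u p = g p"
    and g': "\<And>p. p \<in> side i \<sigma> \<Longrightarrow> (g has_derivative g' p) (at p within side i \<sigma>)"
    and g1: "\<And>p. p \<in> side i \<sigma> \<Longrightarrow> ((\<lambda>p. g' p (0, axis i 1)) has_derivative g1 p) (at p within side i \<sigma>)"
    and F: "F \<le> at 0" "F \<noteq> bot" "\<forall>\<^sub>F s in F. \<sigma> * s > 0"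
  shows "Lim F (\<lambda>s. (Dx i ^^ 0) u (t, set_coord i s x)) = g (on_plane i (t, x))"
    and "Lim F (\<lambda>s. (Dx i ^^ 1) u (t, set_coord i s x)) = g' (on_plane i (t, x)) (0, axis i 1)"
proof -
  let ?n = "(0, axis i 1) :: real \<times> (real ^ 'd)" and ?p = "on_plane i (t, x)"
  have lim: "((\<lambda>s. h (?p + s *\<^sub>R ?n)) \<longlongrightarrow> h ?p) F" if "continuous_on (side i \<sigma>) h"
    for h :: "real \<times> (real ^ 'd) \<Rightarrow> complex ^ 'k"
  proof (rule continuous_on_side_limit[OF that on_plane_in_side])
    show "\<forall>\<^sub>F s in F. \<sigma> * s * snd ?n $ i \<ge> 0" using F(3) by eventually_elim simp
  qed (use F(1) in simp_all)
  have D: "dir_deriv ?n u q = g' q ?n" if q: "\<sigma> * snd q $ i > 0" for q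
  proof (rule dir_deriv_eq)
    have "(g has_derivative g' q) (at q)"
      using g'[of q] q at_within_side[OF q] by (simp add: side_def)
    then show "(u has_derivative g' q) (at q)"
      by (rule has_derivative_transform_within_open[OF _ open_side_interior[of \<sigma> i]]) (use q ug in auto)
  qed
  have "\<forall>\<^sub>F s in F. g (?p + s *\<^sub>R ?n) = (Dx i ^^ 0) u (t, set_coord i s x)"
    using F(3) by eventually_elim (simp add: on_plane_add ug)
  from Lim_transform_eventually[OF lim[OF has_derivative_continuous_on[OF g']] this]
  show "Lim F (\<lambda>s. (Dx i ^^ 0) u (t, set_coord i s x)) = g ?p" by (rule tendsto_Lim[OF F(2)])
  have "\<forall>\<^sub>F s in F. g' (?p + s *\<^sub>R ?n) ?n = (Dx i ^^ 1) u (t, set_coord i s x)"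
    using F(3) by eventually_elim (simp add: on_plane_add D)
  from Lim_transform_eventually[OF lim[OF has_derivative_continuous_on[OF g1]] this]
  show "Lim F (\<lambda>s. (Dx i ^^ 1) u (t, set_coord i s x)) = g' ?p ?n" by (rule tendsto_Lim[OF F(2)])
qed

lemma has_derivative_trace:
  assumes "\<And>p. p \<in> side i \<sigma> \<Longrightarrow> (g has_derivative g' p) (at p within side i \<sigma>)"
  shows "((\<lambda>p. g (on_plane i p)) has_derivative (\<lambda>e. g' (on_plane i p) (on_plane i e))) (at p)"
proof -
  have "(g has_derivative g' (on_plane i p)) (at (on_plane i p) within range (on_plane i))"
    by (rule has_derivative_subset[OF assms]) (auto simp: on_plane_in_side)
  from has_derivative_in_compose[OF bounded_linear_imp_has_derivative[OF bounded_linear_on_plane] this]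
  show ?thesis .
qed

lemma tangential_on_plane: "tangential A i (\<lambda>e. D (on_plane i e)) = tangential A i D"
  by (simp add: tangential_def on_plane_unit)

lemma local_bound:
  assumes "continuous_on S F" "p \<in> S"
  shows "\<exists>d>0. \<forall>y\<in>S. norm (y - p) < d \<longrightarrow> norm (F y) \<le> norm (F p) + 1"
proof -
  obtain d where d: "d > 0" "\<And>y. y \<in> S \<Longrightarrow> dist y p < d \<Longrightarrow> dist (F y) (F p) < 1"
    using assms zero_less_one unfolding continuous_on_iff by metis
  have "norm (F y) \<le> norm (F p) + 1" if "y \<in> S" "norm (y - p) < d" for y
    using d(2)[of y] that norm_triangle_ineq2[of "F y" "F p"] by (simp add: dist_norm)
  then show ?thesis using d(1) by blast
qed

section \<open>Growth of the jump of the normal derivative\<close>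

theorem mainTheorem3:
  fixes A :: "'d::finite \<Rightarrow> complex ^ 'k ^ 'k"
    and i1 :: 'd
    and \<tau> :: "real ^ 'd \<Rightarrow> real"
    and T :: real
    and f u :: "real \<times> (real ^ 'd) \<Rightarrow> complex ^ 'k"
  defines "v' \<equiv> set_coord i1 0 (group_velocity i1 \<tau>)"
    and "K \<equiv> K_fun A i1 (jump i1 0 u)"
  assumes "strongly_hyperbolic A"
    and "det (A i1) = 0"
    and "smooth_variety A i1 \<tau>"
    and "compactly_supported f"
    and "piecewise_smooth i1 f"
    and "\<And>t x. t \<le> 0 \<Longrightarrow> f (t, x) = 0"
    and "\<And>t x. t \<ge> T \<Longrightarrow> f (t, x) = 0"
    and "weak_solution A u f"
    and "\<And>t x. t \<le> 0 \<Longrightarrow> u (t, x) = 0"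
    and "piecewise_smooth i1 u"
  shows "(\<forall>t x. t > T \<longrightarrow> K (t, x) = 0) \<or>
         (\<forall>t0 x0. t0 > T \<and> K (t0, x0) \<noteq> 0 \<longrightarrow>
            (\<exists>l>0. ((\<lambda>s. norm (jump i1 1 u (t0 + s, x0 + s *\<^sub>R v')) / s) \<longlongrightarrow> l) at_top))"
proof -
  let ?n = "(0, axis i1 1) :: real \<times> (real ^ 'd)" and ?P = "ker_proj (A i1)" and ?Z = "on_plane i1"
  note weak = \<open>weak_solution A u f\<close> and f0 = \<open>\<And>t x. t \<ge> T \<Longrightarrow> f (t, x) = 0\<close>
  obtain C where "\<And>\<xi>. bounded_group C (symb A \<xi>)"
    by (rule strongly_hyperbolic_bounded_group[OF \<open>strongly_hyperbolic A\<close>]) blast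
  then have "bounded_group C (A i1)" by (metis symb_axis)
  then have ss: "A i1 *v (A i1 *v v) = 0 \<Longrightarrow> A i1 *v v = 0" for v by (rule bounded_group_ker_sq)

  have sides: "{(t, x). x $ i1 \<ge> 0} = side i1 1" "{(t, x). x $ i1 \<le> 0} = side i1 (- 1)"
    by (auto simp: side_def)
  obtain gp gm where gp: "Cinf_on (side i1 1) gp" "\<And>t x. x $ i1 > 0 \<Longrightarrow> u (t, x) = gp (t, x)"
    and gm: "Cinf_on (side i1 (- 1)) gm" "\<And>t x. x $ i1 < 0 \<Longrightarrow> u (t, x) = gm (t, x)"
    using \<open>piecewise_smooth i1 u\<close> unfolding piecewise_smooth_def sides by blast
  have up: "u p = gp p" if "1 * snd p $ i1 > 0" for p using gp(2)[of "snd p" "fst p"] that by simp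
  have um: "u p = gm p" if "- 1 * snd p $ i1 > 0" for p using gm(2)[of "snd p" "fst p"] that by simp
  have cgp: "continuous_on (side i1 1) gp" and cgm: "continuous_on (side i1 (- 1)) gm"
    using gp(1) gm(1) Ck_on_continuous unfolding Cinf_on_def by blast+

  \<comment> \<open>The values of \<open>u\<close> on the hyperplane are arbitrary; \<open>w\<close> is a Borel function equal to \<open>u\<close> elsewhere.\<close>
  define w where "w p = (if snd p $ i1 > 0 then gp p else gm p)" for p
  have w: "w \<in> borel_measurable borel"
  proof -
    have op: "open {p :: real \<times> (real ^ 'd). snd p $ i1 > 0}"
      by (rule open_Collect_less) (auto intro!: continuous_intros)
    have "closed {p :: real \<times> (real ^ 'd). snd p $ i1 \<le> 0}"
      by (rule closed_Collect_le) (auto intro!: continuous_intros)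
    then have sm: "{p :: real \<times> (real ^ 'd). snd p $ i1 \<le> 0} \<in> sets borel" by (rule borel_closed)
    have "(\<lambda>p. indicator {p. snd p $ i1 > 0} p *\<^sub>R gp p) \<in> borel_measurable borel"
      by (rule borel_measurable_continuous_on_indicator[OF borel_open[OF op] continuous_on_subset[OF cgp]])
         (auto simp: side_def)
    moreover have "(\<lambda>p. indicator {p. snd p $ i1 \<le> 0} p *\<^sub>R gm p) \<in> borel_measurable borel"
      by (rule borel_measurable_continuous_on_indicator[OF sm continuous_on_subset[OF cgm]])
         (auto simp: side_def)
    ultimately have "(\<lambda>p. indicator {p. snd p $ i1 > 0} p *\<^sub>R gp p + indicator {p. snd p $ i1 \<le> 0} p *\<^sub>R gm p)
        \<in> borel_measurable borel"
      by (rule borel_measurable_add)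
    moreover have "w = (\<lambda>p. indicator {p. snd p $ i1 > 0} p *\<^sub>R gp p + indicator {p. snd p $ i1 \<le> 0} p *\<^sub>R gm p)"
      by (auto simp: w_def indicator_def fun_eq_iff)
    ultimately show ?thesis by simp
  qed
  have uw: "AE p in lebesgue. w p = u p"
  proof (rule AE_I')
    have "?n \<in> Basis" by (simp add: Basis_prod_def axis_in_Basis_iff)
    then have "negligible {p :: real \<times> (real ^ 'd). p \<bullet> ?n = 0}" by (rule negligible_standard_hyperplane)
    then show "{p :: real \<times> (real ^ 'd). p \<bullet> ?n = 0} \<in> null_sets lebesgue" by (simp add: negligible_iff_null_sets)
    show "{p \<in> space lebesgue. w p \<noteq> u p} \<subseteq> {p. p \<bullet> ?n = 0}"
    proof
      fix p assume "p \<in> {p \<in> space lebesgue. w p \<noteq> u p}"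
      then have "w p \<noteq> u p" by simp
      then have "\<not> snd p $ i1 > 0" "\<not> snd p $ i1 < 0" using up[of p] um[of p] by (auto simp: w_def)
      then have "snd p $ i1 = 0" by simp
      then show "p \<in> {p. p \<bullet> ?n = 0}" by (simp add: inner_prod_def inner_axis)
    qed
  qed

  have wp: "w p = gp p" if "1 * snd p $ i1 > 0" for p using that by (simp add: w_def)
  have wm: "w p = gm p" if "- 1 * snd p $ i1 > 0" for p using that by (simp add: w_def)
  have neg1: "- 1 \<noteq> (0::real)" by simp
  have eqn: "principal_part A D = 0" if "fst p > T" "(w has_derivative D) (at p)" for p D
    by (rule interior_equation[OF weak f0 w uw that])
  have "\<exists>g' g1. \<forall>p\<in>side i1 1. (gp has_derivative g' p) (at p within side i1 1) \<and>
      ((\<lambda>p. g' p ?n) has_derivative g1 p) (at p within side i1 1) \<and>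
      (fst p > T \<longrightarrow> principal_part A (g' p) = 0 \<and> principal_part A (g1 p) = 0)"
    by (rule one_sided_equations[OF gp(1) zero_neq_one[symmetric]]) (fact wp, fact eqn)
  then obtain gp' gp1 where gpE: "\<forall>p\<in>side i1 1. (gp has_derivative gp' p) (at p within side i1 1) \<and>
      ((\<lambda>p. gp' p ?n) has_derivative gp1 p) (at p within side i1 1) \<and>
      (fst p > T \<longrightarrow> principal_part A (gp' p) = 0 \<and> principal_part A (gp1 p) = 0)"
    by (elim exE) (rule that)
  have p': "p \<in> side i1 1 \<Longrightarrow> (gp has_derivative gp' p) (at p within side i1 1)"
    "p \<in> side i1 1 \<Longrightarrow> ((\<lambda>p. gp' p ?n) has_derivative gp1 p) (at p within side i1 1)"
    "p \<in> side i1 1 \<Longrightarrow> fst p > T \<Longrightarrow> principal_part A (gp' p) = 0"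
    "p \<in> side i1 1 \<Longrightarrow> fst p > T \<Longrightarrow> principal_part A (gp1 p) = 0" for p
    using gpE[rule_format, of p] by simp_all
  have "\<exists>g' g1. \<forall>p\<in>side i1 (- 1). (gm has_derivative g' p) (at p within side i1 (- 1)) \<and>
      ((\<lambda>p. g' p ?n) has_derivative g1 p) (at p within side i1 (- 1)) \<and>
      (fst p > T \<longrightarrow> principal_part A (g' p) = 0 \<and> principal_part A (g1 p) = 0)"
    by (rule one_sided_equations[OF gm(1) neg1]) (fact wm, fact eqn)
  then obtain gm' gm1 where gmE: "\<forall>p\<in>side i1 (- 1). (gm has_derivative gm' p) (at p within side i1 (- 1)) \<and>
      ((\<lambda>p. gm' p ?n) has_derivative gm1 p) (at p within side i1 (- 1)) \<and>
      (fst p > T \<longrightarrow> principal_part A (gm' p) = 0 \<and> principal_part A (gm1 p) = 0)"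
    by (elim exE) (rule that)
  have m': "p \<in> side i1 (- 1) \<Longrightarrow> (gm has_derivative gm' p) (at p within side i1 (- 1))"
    "p \<in> side i1 (- 1) \<Longrightarrow> ((\<lambda>p. gm' p ?n) has_derivative gm1 p) (at p within side i1 (- 1))"
    "p \<in> side i1 (- 1) \<Longrightarrow> fst p > T \<Longrightarrow> principal_part A (gm' p) = 0"
    "p \<in> side i1 (- 1) \<Longrightarrow> fst p > T \<Longrightarrow> principal_part A (gm1 p) = 0" for p
    using gmE[rule_format, of p] by simp_all

  define J0 where "J0 p = gp (?Z p) - gm (?Z p)" for p
  define J1 where "J1 p = gp' (?Z p) ?n - gm' (?Z p) ?n" for p
  have evr: "\<forall>\<^sub>F s in at_right (0::real). 1 * s > 0" and evl: "\<forall>\<^sub>F s in at_left (0::real). - 1 * s > 0"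
    by (simp_all add: eventually_at_filter)
  note limp = one_sided_limits[OF up p'(1,2) _ _ evr] and limm = one_sided_limits[OF um m'(1,2) _ _ evl]
  have J0: "jump i1 0 u = J0" and J1: "jump i1 1 u = J1"
    using limp limm by (simp_all add: jump_def J0_def[abs_def] J1_def[abs_def] fun_eq_iff at_le)

  define D0 where "D0 p e = gp' (?Z p) (?Z e) - gm' (?Z p) (?Z e)" for p e
  define D1 where "D1 p e = gp1 (?Z p) (?Z e) - gm1 (?Z p) (?Z e)" for p e
  have D0: "(J0 has_derivative D0 p) (at p)" for p
    unfolding J0_def[abs_def] D0_def[abs_def]
    by (rule has_derivative_diff[OF has_derivative_trace[OF p'(1)] has_derivative_trace[OF m'(1)]])
  have D1: "(J1 has_derivative D1 p) (at p)" for p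
    unfolding J1_def[abs_def] D1_def[abs_def]
    by (rule has_derivative_diff[OF has_derivative_trace[OF p'(2)] has_derivative_trace[OF m'(2)]])

  have E0: "A i1 *v J0 p = 0" if p: "fst p > T" for p
    unfolding J0_def
  proof -
    have Zp: "fst (?Z p) > T" using p by simp
    have lim: "((\<lambda>\<epsilon>. w (?Z p + \<epsilon> *\<^sub>R q)) \<longlongrightarrow> (if snd q $ i1 > 0 then gp (?Z p) else gm (?Z p))) (at_right 0)" for q
    proof (cases "snd q $ i1 > 0")
      case True
      have "\<forall>\<^sub>F s in at_right 0. 1 * s * snd q $ i1 \<ge> 0"
        using evr by eventually_elim (use True in simp)
      then have "((\<lambda>s. gp (?Z p + s *\<^sub>R q)) \<longlongrightarrow> gp (?Z p)) (at_right 0)"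
        by (intro continuous_on_side_limit[OF cgp on_plane_in_side]) (simp_all add: at_le)
      moreover have "\<forall>\<^sub>F s in at_right 0. gp (?Z p + s *\<^sub>R q) = w (?Z p + s *\<^sub>R q)"
        using evr by eventually_elim (use True in \<open>simp add: w_def\<close>)
      ultimately show ?thesis using True by (simp add: Lim_transform_eventually)
    next
      case False
      have "\<forall>\<^sub>F s in at_right 0. - 1 * s * snd q $ i1 \<ge> 0"
        using evr by eventually_elim (use False in \<open>simp add: mult_nonneg_nonpos\<close>)
      then have "((\<lambda>s. gm (?Z p + s *\<^sub>R q)) \<longlongrightarrow> gm (?Z p)) (at_right 0)"
        by (intro continuous_on_side_limit[OF cgm on_plane_in_side]) (simp_all add: at_le)
      moreover have "\<forall>\<^sub>F s in at_right 0. gm (?Z p + s *\<^sub>R q) = w (?Z p + s *\<^sub>R q)"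
        using evr by eventually_elim (use False in \<open>simp add: w_def zero_less_mult_iff\<close>)
      ultimately show ?thesis using False by (simp add: Lim_transform_eventually)
    qed
    obtain dp where dp: "dp > 0" "\<And>y. y \<in> side i1 1 \<Longrightarrow> norm (y - ?Z p) < dp \<Longrightarrow> norm (gp y) \<le> norm (gp (?Z p)) + 1"
      using local_bound[OF cgp on_plane_in_side] by blast
    obtain dm where dm: "dm > 0" "\<And>y. y \<in> side i1 (- 1) \<Longrightarrow> norm (y - ?Z p) < dm \<Longrightarrow> norm (gm y) \<le> norm (gm (?Z p)) + 1"
      using local_bound[OF cgm on_plane_in_side] by blast
    have "norm (w y) \<le> max (norm (gp (?Z p)) + 1) (norm (gm (?Z p)) + 1)" if "norm (y - ?Z p) < min dp dm" for y
      using that dp(2)[of y] dm(2)[of y] by (auto simp: w_def side_def le_max_iff_disj)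
    with dp(1) dm(1) show "A i1 *v (gp (?Z p) - gm (?Z p)) = 0"
      by (intro jump_relation[OF weak f0 w uw Zp lim, of "min dp dm"]) auto
  qed
  have diff: "tangential A i1 (\<lambda>e. D (?Z e) - D' (?Z e)) + A i1 *v (D ?n - D' ?n) = 0"
    if "principal_part A D = 0" "principal_part A D' = 0" for D D' :: "real \<times> (real ^ 'd) \<Rightarrow> complex ^ 'k"
    using that principal_part_diff[of A D D'] tangential_on_plane[of A i1 "\<lambda>e. D e - D' e"]
    unfolding principal_part_split[of A _ i1] by simp
  have E1: "tangential A i1 (D0 p) + A i1 *v J1 p = 0" if "fst p > T" for p
    unfolding D0_def[abs_def] J1_def
    by (rule diff[OF p'(3) m'(3)]) (use that in \<open>simp_all add: on_plane_in_side\<close>)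
  have E2: "?P *v tangential A i1 (D1 p) = 0" if "fst p > T" for p
  proof -
    have "tangential A i1 (D1 p) + A i1 *v (gp1 (?Z p) ?n - gm1 (?Z p) ?n) = 0"
      unfolding D1_def[abs_def]
      by (rule diff[OF p'(4) m'(4)]) (use that in \<open>simp_all add: on_plane_in_side\<close>)
    then have "?P *v (tangential A i1 (D1 p) + A i1 *v (gp1 (?Z p) ?n - gm1 (?Z p) ?n)) = 0" by simp
    then show ?thesis by (simp only: matrix_vector_right_distrib ker_proj_range[OF ss] add_0_right)
  qed

  have transport: "J1 ((t0, x0) + s *\<^sub>R (1, v')) = J1 (t0, x0) + s *\<^sub>R K (t0, x0)"
    if "t0 > T" "s \<ge> 0" for t0 x0 s
    unfolding v'_def K_def K_fun_def J0
    by (rule jump_transport[OF ker_proj_range[OF ss] ker_proj_in_ker[OF ss] ker_proj_ker[OF ss]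
          partial_inverse_mult[OF ss] projected_symbol_group_velocity[OF assms(3,4,5)] D0 D1 E0 E1 E2])
       (use that in auto)
  have "((\<lambda>s. norm (jump i1 1 u (t0 + s, x0 + s *\<^sub>R v')) / s) \<longlongrightarrow> norm (K (t0, x0))) at_top" if t0: "t0 > T" for t0 x0
  proof (rule Lim_transform_eventually)
    have "((\<lambda>s. inverse s *\<^sub>R J1 (t0, x0) + K (t0, x0)) \<longlongrightarrow> 0 *\<^sub>R J1 (t0, x0) + K (t0, x0)) at_top"
      by (intro tendsto_intros tendsto_inverse_0_at_top filterlim_ident)
    then show "((\<lambda>s. norm (inverse s *\<^sub>R J1 (t0, x0) + K (t0, x0))) \<longlongrightarrow> norm (K (t0, x0))) at_top"
      by (intro tendsto_norm) simp
    show "\<forall>\<^sub>F s in at_top. norm (inverse s *\<^sub>R J1 (t0, x0) + K (t0, x0)) = norm (jump i1 1 u (t0 + s, x0 + s *\<^sub>R v')) / s"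
      using eventually_gt_at_top[of 0]
    proof eventually_elim
      case (elim s)
      have "jump i1 1 u (t0 + s, x0 + s *\<^sub>R v') = J1 (t0, x0) + s *\<^sub>R K (t0, x0)"
        unfolding J1 using transport[OF t0, of s x0] elim by simp
      also have "\<dots> = s *\<^sub>R (inverse s *\<^sub>R J1 (t0, x0) + K (t0, x0))"
        using elim by (simp add: scaleR_add_right)
      finally show ?case using elim by simp
    qed
  qed
  note lim = this
  show ?thesis
  proof (rule disjI2, intro allI impI)
    fix t0 :: real and x0 :: "real ^ 'd" assume "t0 > T \<and> K (t0, x0) \<noteq> 0"
    then show "\<exists>l>0. ((\<lambda>s. norm (jump i1 1 u (t0 + s, x0 + s *\<^sub>R v')) / s) \<longlongrightarrow> l) at_top"
      by (intro exI[of _ "norm (K (t0, x0))"] conjI lim) simp_all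
  qed
qed

end
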